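(* Let $\alpha\in(0,1)$, $p\in(0,\frac n{n+\alpha}]$ and $\frac1q=\frac1p-\frac\alpha n$. For some $r\in(\frac n{n-\alpha},\infty)$, if the weight $\omega$ satisfies $\omega^{\frac{nr}{nr-n-r\alpha}}\in A^{\mathrm{loc}}_1(\mathbb{R}^n)$ and $\int_{\mathbb{R}^n}[\omega(x)]^p\,dx=\infty$, then there exists a positive constant $C$ such that for all $f\in h^p_{\omega^p}(\mathbb{R}^n)$, $$\|I^{\mathrm{loc}}_\alpha(f)\|_{h^q_{\omega^q}(\mathbb{R}^n)}\le C\|f\|_{h^p_{\omega^p}(\mathbb{R}^n)}.$$
   Context: Cubes are closed with sides parallel to the axes; $Q(x,t)$ is the cube with center $x$ and sidelength $t$; $v(E)=\int_Ev\,dx$; $\mathbb{Z}_+=\{0,1,2,\dots\}$; $\lfloor r\rfloor$ is the largest integer not exceeding $r$. A weight is a locally integrable function positive a.e. Local fractional integral. Fix $\phi_0\in\mathcal{D}(\mathbb{R}^n)$ with $\phi_0\equiv1$ on $Q(0,1)$ and $\mathrm{supp}\,\phi_0\subset Q(0,2)$. $I^{\mathrm{loc}}_\alpha(f)(x)=\int_{\mathbb{R}^n}\frac{\phi_0(y)}{|y|^{n-\alpha}}f(x-y)\,dy$ for Schwartz $f$, i.e. convolution with the compactly supported integrable kernel $\phi_0(y)|y|^{\alpha-n}$, which is meaningful for $f\in\mathcal{D}'(\mathbb{R}^n)$. Weights. For $u\in(1,\infty)$, $A^{\mathrm{loc}}_u(\mathbb{R}^n)$ is the set of nonnegative locally integrable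 $v$ with $\sup_{|Q|\le1}|Q|^{-u}\int_Qv\,dx\,(\int_Qv^{-u'/u}dx)^{u/u'}<\infty$ ($1/u+1/u'=1$); $A^{\mathrm{loc}}_1$: $\sup_{|Q|\le1}|Q|^{-1}\int_Qv\,dx\cdot\mathrm{ess\,sup}_Q\,v^{-1}<\infty$; $A^{\mathrm{loc}}_\infty=\bigcup_{1\le u<\infty}A^{\mathrm{loc}}_u$. $q_v=\inf\{u\in[1,\infty):v\in A^{\mathrm{loc}}_u\}$. $\|g\|_{L^u_v}=(\int|g|^uv\,dx)^{1/u}$ for $0<u<\infty$. Weighted local Hardy spaces. Let $p\in(0,1]$, $v\in A^{\mathrm{loc}}_\infty$. $\mathcal{D}=C_c^\infty(\mathbb{R}^n)$, $\mathcal{D}'$ its dual; $\psi_t(x)=t^{-n}\psi(x/t)$. $\mathcal{G}_N(f)(x)=\sup|\psi_t*f(x)|$ over $t\in(0,1)$ and $\psi\in\mathcal{D}$ with $\mathrm{supp}\,\psi\subset B(0,2^{3(10+n)})$ and $\sup_x\sup_{|\beta|\le N}|\partial^\beta\psi(x)|\le1$. $h^p_v(\mathbb{R}^n)=\{f\in\mathcal{D}':\mathcal{G}_N(f)\in L^p_v\}$ with $\|f\|_{h^p_v}=\|\mathcal{G}_N(f)\|_{L^p_v}$, for any integer $N\ge N_{p,v}$ (different such $N$ give the same space with equivalent quasi-norms). Here $h^p_{\omega^p}$ is $h^p_v$ with $v=\omega^p$, and $h^q_{\omega^q}$ is the same space with exponent $q\in(0,1]$ and $v=\omega^q$. The integer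 $N_{p,v}$. Fix $\psi_0\in\mathcal{D}$ with $\int\psi_0\neq0$; $(\psi_0)_j(x)=2^{jn}\psi_0(2^jx)$ ($j\in\mathbb{Z}_+$), $m_{j,A,B}(y)=(1+2^j|y|)^A2^{B|y|}$, $M^{\mathrm{loc}}g(x)=\sup_{Q\ni x,|Q|\le1}|Q|^{-1}\int_Q|g|$, $K_Bg(x)=\int|g(y)|2^{-B|x-y|}dy$. $A_0$ is a positive constant depending only on $\mathrm{supp}\,\psi_0$ (such a constant exists) such that for every $u>0$, $A>\max\{A_0,n/u\}$, $B\ge0$ there is $C=C(n,u,\psi_0,A,B)$ with $[\sup_y|(\psi_0)_j*f(x-y)|/m_{j,A,B}(y)]^u\le C\sum_{k\ge j}2^{(j-k)(Au-n)}\{M^{\mathrm{loc}}(|(\psi_0)_k*f|^u)(x)+K_{Bu}(|(\psi_0)_k*f|^u)(x)\}$ for all $f\in\mathcal{D}'$, $x\in\mathbb{R}^n$, $j\in\mathbb{Z}_+$. $N_{p,v}=\max\{\lfloor n(q_v/p-1)\rfloor+2,\ \lfloor2\max\{A_0,nq_v/p\}\rfloor+1\}$. *)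

theory Defs
  imports "HOL-Analysis.Analysis" "HOL-Probability.Essential_Supremum"
begin

definition pderiv_dir :: "'n \<Rightarrow> (real^'n::finite \<Rightarrow> complex) \<Rightarrow> real^'n \<Rightarrow> complex" where
  "pderiv_dir i f x = frechet_derivative f (at x) (axis i 1)"

text \<open>A multi-index is given as a list of directions, its order being the length of the list.
  For smooth functions the order of differentiation is immaterial, so lists of length at most
  \<open>N\<close> enumerate exactly the derivatives with \<open>\<bar>\<beta>\<bar> \<le> N\<close>.\<close>

definition iter_pderiv :: "'n list \<Rightarrow> (real^'n::finite \<Rightarrow> complex) \<Rightarrow> real^'n \<Rightarrow> complex" where
  "iter_pderiv is f = foldr pderiv_dir is f"

definition smooth :: "(real^'n::finite \<Rightarrow> complex) \<Rightarrow> bool" where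
  "smooth f \<longleftrightarrow> (\<forall>is x. iter_pderiv is f differentiable (at x))"

definition supp :: "(real^'n::finite \<Rightarrow> complex) \<Rightarrow> (real^'n) set" where
  "supp f = closure {x. f x \<noteq> 0}"

definition test_functions :: "(real^'n::finite \<Rightarrow> complex) set" where
  "test_functions = {\<phi>. smooth \<phi> \<and> compact (supp \<phi>)}"

text \<open>\<open>sup\<^sub>x sup\<^bsub>\<bar>\<beta>\<bar> \<le> N\<^esub> \<bar>\<partial>\<^sup>\<beta> \<phi>(x)\<bar> \<le> M\<close>\<close>

definition derivs_bounded :: "nat \<Rightarrow> (real^'n::finite \<Rightarrow> complex) \<Rightarrow> real \<Rightarrow> bool" where
  "derivs_bounded N \<phi> M \<longleftrightarrow> (\<forall>is x. length is \<le> N \<longrightarrow> cmod (iter_pderiv is \<phi> x) \<le> M)"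

text \<open>The topological dual of the test functions: linear functionals whose restriction to the test
  functions supported in any fixed compact set is continuous.  A functional is a total HOL function;
  its values outside \<open>test_functions\<close> are irrelevant.\<close>

type_synonym 'n functional = "(real^'n \<Rightarrow> complex) \<Rightarrow> complex"

definition distributions :: "'n::finite functional set" where
  "distributions = {f.
     (\<forall>\<phi>\<in>test_functions. \<forall>\<psi>\<in>test_functions. \<forall>a b.
        f (\<lambda>x. a * \<phi> x + b * \<psi> x) = a * f \<phi> + b * f \<psi>) \<and>
     (\<forall>K. compact K \<longrightarrow> (\<exists>C N. \<forall>\<phi>\<in>test_functions. \<forall>M.
        supp \<phi> \<subseteq> K \<longrightarrow> derivs_bounded N \<phi> M \<longrightarrow> cmod (f \<phi>) \<le> C * M))}"

definition conv :: "(real^'n::finite \<Rightarrow> complex) \<Rightarrow> 'n functional \<Rightarrow> real^'n \<Rightarrow> complex" where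
  "conv \<psi> f x = f (\<lambda>y. \<psi> (x - y))"

definition dilate :: "real \<Rightarrow> (real^'n::finite \<Rightarrow> complex) \<Rightarrow> real^'n \<Rightarrow> complex" where
  "dilate t \<psi> x = of_real (inverse (t ^ CARD('n))) * \<psi> (inverse t *\<^sub>R x)"

text \<open>Convolution of a distribution with the kernel \<open>k(y) = \<phi>0(y) / \<bar>y\<bar>\<^bsup>n-\<alpha>\<^esup>\<close>, transposed onto the
  test function: \<open>\<langle>k * f, \<phi>\<rangle> = \<langle>f, x \<mapsto> \<integral> k(y) \<phi>(x + y) dy\<rangle>\<close>.\<close>

definition loc_frac_int ::
    "(real^'n::finite \<Rightarrow> complex) \<Rightarrow> real \<Rightarrow> 'n functional \<Rightarrow> 'n functional" where
  "loc_frac_int \<phi>0 \<alpha> f \<phi> =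
     f (\<lambda>x. \<integral>y. \<phi>0 y / of_real (norm y powr (real CARD('n) - \<alpha>)) * \<phi> (x + y) \<partial>lborel)"

definition cube :: "real^'n::finite \<Rightarrow> real \<Rightarrow> (real^'n) set" where
  "cube x t = {y. \<forall>i. \<bar>y $ i - x $ i\<bar> \<le> t / 2}"

definition vol :: "(real^'n::finite) set \<Rightarrow> real" where
  "vol E = measure lebesgue E"

definition small_cubes :: "(real^'n::finite) set set" where
  "small_cubes = {cube x t | x t. 0 < t \<and> vol (cube x t) \<le> 1}"

text \<open>Real powers on \<open>[0,\<infinity>]\<close>, with \<open>0\<^sup>a = \<infinity>\<close> and \<open>\<infinity>\<^sup>a = 0\<close> for \<open>a < 0\<close>.\<close>

definition epowr :: "ennreal \<Rightarrow> real \<Rightarrow> ennreal" where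
  "epowr x a =
     (if a = 0 then 1
      else if x = 0 then (if a > 0 then 0 else top)
      else if x = top then (if a > 0 then top else 0)
      else ennreal (enn2real x powr a))"

definition locally_integrable :: "(real^'n::finite \<Rightarrow> real) \<Rightarrow> bool" where
  "locally_integrable v \<longleftrightarrow> (\<forall>K. compact K \<longrightarrow> v absolutely_integrable_on K)"

definition weight :: "(real^'n::finite \<Rightarrow> real) \<Rightarrow> bool" where
  "weight v \<longleftrightarrow> locally_integrable v \<and> (AE x in lebesgue. 0 < v x)"

definition conj_exponent :: "real \<Rightarrow> real" where
  "conj_exponent u = u / (u - 1)"

definition A_loc_const :: "real \<Rightarrow> (real^'n::finite \<Rightarrow> real) \<Rightarrow> ennreal" where
  "A_loc_const u v =
     (if u = 1 then
        (SUP Q\<in>small_cubes.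
           ennreal (1 / vol Q) * (\<integral>\<^sup>+x\<in>Q. ennreal (v x) \<partial>lebesgue)
             * esssup (lebesgue_on Q) (\<lambda>x. inverse (ennreal (v x))))
      else
        (let u' = conj_exponent u in
         SUP Q\<in>small_cubes.
           ennreal (vol Q powr (- u)) * (\<integral>\<^sup>+x\<in>Q. ennreal (v x) \<partial>lebesgue)
             * epowr (\<integral>\<^sup>+x\<in>Q. epowr (ennreal (v x)) (- (u' / u)) \<partial>lebesgue) (u / u')))"

text \<open>Meaningful only for \<open>1 \<le> u\<close>.\<close>

definition A_loc :: "real \<Rightarrow> (real^'n::finite \<Rightarrow> real) set" where
  "A_loc u = {v. locally_integrable v \<and> (AE x in lebesgue. 0 \<le> v x) \<and> A_loc_const u v < top}"

definition q_crit :: "(real^'n::finite \<Rightarrow> real) \<Rightarrow> real" where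
  "q_crit v = Inf {u. 1 \<le> u \<and> v \<in> A_loc u}"

definition Lp_norm :: "real \<Rightarrow> (real^'n::finite \<Rightarrow> real) \<Rightarrow> (real^'n \<Rightarrow> ennreal) \<Rightarrow> ennreal" where
  "Lp_norm u v g = epowr (\<integral>\<^sup>+x. epowr (g x) u * ennreal (v x) \<partial>lebesgue) (1 / u)"

definition grand_maximal :: "nat \<Rightarrow> 'n::finite functional \<Rightarrow> real^'n \<Rightarrow> ennreal" where
  "grand_maximal N f x =
     (SUP (t, \<psi>)\<in>{(t, \<psi>). 0 < t \<and> t < 1 \<and> \<psi> \<in> test_functions
                        \<and> supp \<psi> \<subseteq> ball 0 (2 ^ (3 * (10 + CARD('n)))) \<and> derivs_bounded N \<psi> 1}.
        ennreal (cmod (conv (dilate t \<psi>) f x)))"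

definition hardy_norm ::
    "nat \<Rightarrow> real \<Rightarrow> (real^'n::finite \<Rightarrow> real) \<Rightarrow> 'n functional \<Rightarrow> ennreal" where
  "hardy_norm N p v f = Lp_norm p v (grand_maximal N f)"

definition hardy :: "nat \<Rightarrow> real \<Rightarrow> (real^'n::finite \<Rightarrow> real) \<Rightarrow> 'n functional set" where
  "hardy N p v = {f \<in> distributions. hardy_norm N p v f < top}"

definition M_loc :: "(real^'n::finite \<Rightarrow> real) \<Rightarrow> real^'n \<Rightarrow> ennreal" where
  "M_loc g x =
     (SUP Q\<in>{Q \<in> small_cubes. x \<in> Q}.
        ennreal (1 / vol Q) * (\<integral>\<^sup>+y\<in>Q. ennreal \<bar>g y\<bar> \<partial>lebesgue))"

definition K_op :: "real \<Rightarrow> (real^'n::finite \<Rightarrow> real) \<Rightarrow> real^'n \<Rightarrow> ennreal" where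
  "K_op B g x = (\<integral>\<^sup>+y. ennreal (\<bar>g y\<bar> * 2 powr (- B * norm (x - y))) \<partial>lebesgue)"

definition m_weight :: "nat \<Rightarrow> real \<Rightarrow> real \<Rightarrow> real^'n::finite \<Rightarrow> real" where
  "m_weight j A B y = (1 + 2 ^ j * norm y) powr A * 2 powr (B * norm y)"

definition dyadic :: "(real^'n::finite \<Rightarrow> complex) \<Rightarrow> nat \<Rightarrow> real^'n \<Rightarrow> complex" where
  "dyadic \<psi> j x = 2 ^ (j * CARD('n)) * \<psi> (2 ^ j *\<^sub>R x)"

text \<open>\<open>A0\<close> depends on \<open>\<psi>0\<close> only through its support: it is admissible for a set \<open>S\<close> if the
  estimate holds for every test function with support \<open>S\<close> and nonzero integral.\<close>

definition peetre_constant :: "(real^'n::finite) set \<Rightarrow> real \<Rightarrow> bool" where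
  "peetre_constant S A0 \<longleftrightarrow> 0 < A0 \<and>
     (\<forall>\<psi>0\<in>test_functions. supp \<psi>0 = S \<longrightarrow> (\<integral>x. \<psi>0 x \<partial>lborel) \<noteq> 0 \<longrightarrow>
       (\<forall>u A B. 0 < u \<longrightarrow> max A0 (real CARD('n) / u) < A \<longrightarrow> 0 \<le> B \<longrightarrow>
         (\<exists>C::real. \<forall>f\<in>distributions. \<forall>x j.
            epowr (SUP y. ennreal (cmod (conv (dyadic \<psi>0 j) f (x - y)) / m_weight j A B y)) u
            \<le> ennreal C * (\<Sum>\<^sub>\<infinity>k\<in>{j..}.
                 ennreal (2 powr ((real j - real k) * (A * u - real CARD('n))))
                 * (M_loc (\<lambda>z. cmod (conv (dyadic \<psi>0 k) f z) powr u) x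
                    + K_op (B * u) (\<lambda>z. cmod (conv (dyadic \<psi>0 k) f z) powr u) x)))))"

definition N_crit :: "real \<Rightarrow> real \<Rightarrow> (real^'n::finite \<Rightarrow> real) \<Rightarrow> int" where
  "N_crit A0 p v =
     max (\<lfloor>real CARD('n) * (q_crit v / p - 1)\<rfloor> + 2)
         (\<lfloor>2 * max A0 (real CARD('n) * q_crit v / p)\<rfloor> + 1)"

end

theory Submission
  imports Defs
begin

text \<open>Write \<open>n\<close> for the dimension and \<open>g\<close> for the grand maximal function of \<open>f\<close>.

  A bump adapted to a dyadic cell \<open>Q\<close> -- smooth at the scale of \<open>Q\<close>, supported near \<open>Q\<close>, of integral
  size \<open>L\<close> -- is, seen from any point of \<open>Q\<close>, up to the factor \<open>C L\<close> one of the functions admitted in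
  the definition of \<open>g\<close>.  Hence \<open>f\<close> is at most \<open>C L inf\<^sub>Q g\<close> on it (\<open>bump_estimate\<close>).  The grand
  maximal function of the fractional integral of \<open>f\<close> at \<open>x\<close> tests \<open>f\<close> against functions
  \<open>k * \<psi>\<^sub>t (x - \<cdot>)\<close> with the kernel \<open>k\<close>, and these are decomposed into bumps.  The kernel is the sum of
  pieces \<open>2\<^sup>-\<^sup>j\<^sup>\<alpha> \<eta>\<^sub>j\<close> with smooth \<open>\<eta>\<^sub>j\<close> of scale \<open>2\<^sup>-\<^sup>j\<close> and constant \<open>L\<^sup>1\<close> norm.  Convolution with the
  pieces coarser than \<open>t\<close> gives bumps at once.  The remaining part has \<open>N'\<close> controlled derivatives,
  whereas bumps need \<open>N\<close>.  If \<open>S\<^sub>l\<close> denotes smoothing at scale \<open>2\<^sup>-\<^sup>l\<close> and \<open>T\<^sub>l = I - S\<^sub>l\<close>, then the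
  telescoping sum of \<open>T\<^sub>l\<^sup>m - T\<^sub>l\<^sub>+\<^sub>1\<^sup>m\<close> with \<open>m = N' + 1\<close> writes it as a sum of bumps of all finer scales:
  the difference contains the factor \<open>S\<^sub>l\<^sub>+\<^sub>1 - S\<^sub>l\<close>, which smooths, and \<open>N'\<close> factors \<open>T\<close>, each of which
  turns a derivative into a factor \<open>2\<^sup>-\<^sup>l\<close> (\<open>fine_scale_estimate\<close>).  As \<open>q \<le> 1\<close>, taking \<open>q\<close>-th powers
  term by term gives \<open>pointwise_estimate\<close>, in which a sum over the scales dominates the supremum.

  This bound is integrated against \<open>\<omega>\<^sup>q\<close>, which is a local \<open>A\<^sub>1\<close> weight because a power of \<open>\<omega>\<close> with
  exponent at least 1 is one (\<open>local_A1_lower_power\<close>).  By \<open>A\<^sub>1\<close> a cell \<open>Q\<close> carries at least a constant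
  times its share of the mass of the larger cubes around it (\<open>mass_cube_cell\<close>), and the lower bound
  \<open>N' > n / q - n + \<alpha>\<close> makes the sum over the finer scales converge.  What is left is the sum of
  \<open>2\<^sup>-\<^sup>j\<^sup>\<alpha>\<^sup>q (inf\<^sub>Q g)\<^sup>q \<omega>\<^sup>q(Q)\<close> over all levels \<open>j\<close> and all cells \<open>Q\<close> of level \<open>j\<close> (\<open>scale_sum_integral\<close>).

  With \<open>c\<^sub>Q = (inf\<^sub>Q g)\<^sup>p (\<omega>\<^sup>q(Q) / \<bar>Q\<bar>)\<^bsup>p/q\<^esup>\<close> the summand is \<open>(\<bar>Q\<bar> c\<^sub>Q)\<^bsup>q/p\<^esup>\<close>, since \<open>\<alpha> q / n = q / p - 1\<close>.
  Again by \<open>A\<^sub>1\<close>, \<open>c\<^sub>Q\<close> is at most a constant times \<open>\<Phi> = g\<^sup>p \<omega>\<^sup>p\<close> almost everywhere on \<open>Q\<close>, hence also at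
  most a constant times \<open>H / \<bar>Q\<bar>\<close> with \<open>H = \<integral>\<Phi>\<close>.  At a given point the first bound is the better one at
  small cells and the second one at large cells; both give geometric series, and their sum is at most
  a constant times \<open>\<Phi> H\<^bsup>q/p - 1\<^esup>\<close> (\<open>scale_sum_bound\<close>, an argument of Hedberg).  Integration gives
  \<open>H\<^bsup>q/p\<^esup>\<close> (\<open>cellwise_embedding\<close>), which is the \<open>q\<close>-th power of the norm of \<open>f\<close>.\<close>

section \<open>Smooth functions and test functions\<close>

lemma pderiv_dir_eqI:
  assumes "(f has_derivative D) (at x)"
  shows "pderiv_dir i f x = D (axis i 1)"
  using frechet_derivative_at[OF assms] by (simp add: pderiv_dir_def)

lemma has_derivative_partials:
  fixes f :: "real^'n::finite \<Rightarrow> complex"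
  assumes "f differentiable (at x)"
  shows "(f has_derivative (\<lambda>v. \<Sum>i\<in>UNIV. v $ i *\<^sub>R pderiv_dir i f x)) (at x)"
proof -
  let ?D = "frechet_derivative f (at x)"
  have D: "(f has_derivative ?D) (at x)"
    using assms frechet_derivative_works by blast
  have lin: "linear ?D"
    using D has_derivative_linear by blast
  have "?D v = (\<Sum>i\<in>UNIV. v $ i *\<^sub>R pderiv_dir i f x)" for v
  proof -
    have "v = (\<Sum>i\<in>UNIV. v $ i *\<^sub>R axis i 1)"
      using basis_expansion[of v] by (simp add: scalar_mult_eq_scaleR)
    then have "?D v = ?D (\<Sum>i\<in>UNIV. v $ i *\<^sub>R axis i 1)" by simp
    also have "\<dots> = (\<Sum>i\<in>UNIV. v $ i *\<^sub>R ?D (axis i 1))"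
      using lin by (simp add: linear_sum linear_cmul)
    finally show ?thesis by (simp add: pderiv_dir_def)
  qed
  with D show ?thesis by (metis (no_types, lifting) ext)
qed

lemma iter_pderiv_Nil [simp]: "iter_pderiv [] f = f"
  by (simp add: iter_pderiv_def fun_eq_iff)

lemma iter_pderiv_Cons: "iter_pderiv (i # is) f = pderiv_dir i (iter_pderiv is f)"
  by (simp add: iter_pderiv_def fun_eq_iff)

lemma iter_pderiv_append: "iter_pderiv (is @ js) f = iter_pderiv is (iter_pderiv js f)"
  by (simp add: iter_pderiv_def fun_eq_iff)

lemma smooth_differentiable: "smooth f \<Longrightarrow> f differentiable (at x)"
  unfolding smooth_def by (metis iter_pderiv_Nil)

lemma smooth_iter_pderiv: "smooth f \<Longrightarrow> smooth (iter_pderiv is f)"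
  unfolding smooth_def by (metis iter_pderiv_append)

lemma smooth_pderiv_dir: "smooth f \<Longrightarrow> smooth (pderiv_dir i f)"
  using smooth_iter_pderiv[of f "[i]"] by (simp add: iter_pderiv_Cons)

text \<open>Closing \<open>S\<close> under finite sums yields a set of differentiable functions that contains its partial
  derivatives.  So a rule of differentiation that leads from \<open>S\<close> to sums of two members of \<open>S\<close>, like
  the product rule, settles the smoothness of all orders at once.\<close>

lemma smooth_coinduct:
  fixes S :: "(real^'n::finite \<Rightarrow> complex) set"
  assumes diff: "\<And>f x. f \<in> S \<Longrightarrow> f differentiable (at x)"
    and step: "\<And>f i. f \<in> S \<Longrightarrow> \<exists>g\<in>S. \<exists>h\<in>S. pderiv_dir i f = (\<lambda>x. g x + h x)"
    and "f \<in> S"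
  shows "smooth f"
proof -
  define lsum where "lsum gs = (\<lambda>x. \<Sum>g\<leftarrow>gs. g x)" for gs :: "(real^'n \<Rightarrow> complex) list"
  have lsum_diff: "lsum gs differentiable (at x)" if "set gs \<subseteq> S" for gs x
    using that
  proof (induction gs)
    case Nil then show ?case by (simp add: lsum_def)
  next
    case (Cons g gs)
    then have "(\<lambda>y. g y + lsum gs y) differentiable (at x)"
      by (intro differentiable_add) (auto intro: diff)
    then show ?case by (simp add: lsum_def)
  qed
  have lsum_pderiv: "\<exists>hs. set hs \<subseteq> S \<and> pderiv_dir i (lsum gs) = lsum hs" if "set gs \<subseteq> S" for gs i
    using that
  proof (induction gs)
    case Nil
    have "pderiv_dir i (\<lambda>x. 0 :: complex) = (\<lambda>x. 0)"
      by (rule ext) (rule pderiv_dir_eqI, rule has_derivative_const)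
    then show ?case by (intro exI[of _ "[]"]) (auto simp: lsum_def)
  next
    case (Cons g gs)
    then obtain hs where hs: "set hs \<subseteq> S" "pderiv_dir i (lsum gs) = lsum hs" by auto
    obtain a b where ab: "a \<in> S" "b \<in> S" "pderiv_dir i g = (\<lambda>x. a x + b x)"
      using step[of g i] Cons by auto
    have "pderiv_dir i (lsum (g # gs)) x = lsum (a # b # hs) x" for x
    proof -
      have "(g has_derivative frechet_derivative g (at x)) (at x)"
           "(lsum gs has_derivative frechet_derivative (lsum gs) (at x)) (at x)"
        using diff[of g x] lsum_diff[of gs x] Cons frechet_derivative_works by auto
      from has_derivative_add[OF this] have
        "(lsum (g # gs) has_derivative (\<lambda>v. frechet_derivative g (at x) v + frechet_derivative (lsum gs) (at x) v)) (at x)"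
        by (simp add: lsum_def)
      from pderiv_dir_eqI[OF this, of i] show ?thesis
        using hs ab by (simp add: lsum_def pderiv_dir_def fun_eq_iff)
    qed
    then show ?case using hs ab by (intro exI[of _ "a # b # hs"]) auto
  qed
  have "\<exists>gs. set gs \<subseteq> S \<and> iter_pderiv is f = lsum gs" for "is"
  proof (induction "is")
    case Nil then show ?case using assms(3) by (intro exI[of _ "[f]"]) (auto simp: lsum_def)
  next
    case (Cons i "is")
    then show ?case using lsum_pderiv by (metis iter_pderiv_Cons)
  qed
  then show ?thesis unfolding smooth_def using lsum_diff by metis
qed

lemma pderiv_dir_zero: "pderiv_dir i (\<lambda>x::real^'n::finite. 0 :: complex) = (\<lambda>x. 0)"
  by (rule ext) (rule pderiv_dir_eqI, rule has_derivative_const)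

lemma smooth_zero: "smooth (\<lambda>x::real^'n::finite. 0)"
  by (rule smooth_coinduct[of "{\<lambda>x. 0}"]) (auto simp: pderiv_dir_zero)

lemma pderiv_dir_add:
  fixes f g :: "real^'n::finite \<Rightarrow> complex"
  assumes "f differentiable (at x)" "g differentiable (at x)"
  shows "pderiv_dir i (\<lambda>x. f x + g x) x = pderiv_dir i f x + pderiv_dir i g x"
  using pderiv_dir_eqI[OF has_derivative_add[OF has_derivative_partials[OF assms(1)] has_derivative_partials[OF assms(2)]], of i]
  by (simp add: axis_def if_distrib[of "\<lambda>c. c *\<^sub>R _"] cong: if_cong)

lemma pderiv_dir_cmult:
  fixes f :: "real^'n::finite \<Rightarrow> complex"
  assumes "f differentiable (at x)"
  shows "pderiv_dir i (\<lambda>x. c * f x) x = c * pderiv_dir i f x"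
  using pderiv_dir_eqI[OF has_derivative_mult_right[OF has_derivative_partials[OF assms]], of i c]
  by (simp add: axis_def if_distrib[of "\<lambda>c. c *\<^sub>R _"] cong: if_cong)

lemma iter_pderiv_linear:
  fixes f g :: "real^'n::finite \<Rightarrow> complex"
  assumes "smooth f" "smooth g"
  shows "iter_pderiv is (\<lambda>x. a * f x + b * g x) = (\<lambda>x. a * iter_pderiv is f x + b * iter_pderiv is g x)"
proof (induction "is")
  case (Cons i "is")
  have d: "iter_pderiv is f differentiable (at x)" "iter_pderiv is g differentiable (at x)" for x
    using assms by (auto simp: smooth_def)
  show ?case
    by (rule ext) (simp add: iter_pderiv_Cons Cons pderiv_dir_add pderiv_dir_cmult d differentiable_mult)
qed simp

lemma smooth_linear:
  fixes f g :: "real^'n::finite \<Rightarrow> complex"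
  assumes "smooth f" "smooth g"
  shows "smooth (\<lambda>x. a * f x + b * g x)"
  using assms unfolding smooth_def iter_pderiv_linear[OF assms]
  by (intro allI differentiable_add differentiable_mult) auto

lemma smooth_mult:
  fixes f g :: "real^'n::finite \<Rightarrow> complex"
  assumes "smooth f" "smooth g"
  shows "smooth (\<lambda>x. f x * g x)"
proof (rule smooth_coinduct[of "{\<lambda>x. f x * g x | f g. smooth f \<and> smooth g}"])
  fix h i assume "h \<in> {\<lambda>x. f x * g x | f g. smooth f \<and> smooth (g :: real^'n \<Rightarrow> complex)}"
  then obtain f g where h: "h = (\<lambda>x. f x * g x)" "smooth f" "smooth (g :: real^'n \<Rightarrow> complex)" by blast
  have "pderiv_dir i h x = pderiv_dir i f x * g x + f x * pderiv_dir i g x" for x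
    unfolding h
    using pderiv_dir_eqI[OF has_derivative_mult[OF has_derivative_partials[OF smooth_differentiable[OF h(2)]]
          has_derivative_partials[OF smooth_differentiable[OF h(3)]]], of i x]
    by (simp add: axis_def if_distrib[of "\<lambda>c. c *\<^sub>R _"] cong: if_cong)
  then show "\<exists>g\<in>{\<lambda>x. f x * g x | f g. smooth f \<and> smooth g}. \<exists>ha\<in>{\<lambda>x. f x * g x | f g. smooth f \<and> smooth g}.
      pderiv_dir i h = (\<lambda>x. g x + ha x)"
    using h(2,3) smooth_pderiv_dir[OF h(2)] smooth_pderiv_dir[OF h(3)]
    by (intro bexI[of _ "\<lambda>x. pderiv_dir i f x * g x"] bexI[of _ "\<lambda>x. f x * pderiv_dir i g x"])
       (simp add: fun_eq_iff, blast+)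
next
  show "h differentiable at x"
    if "h \<in> {\<lambda>x. f x * g x | f g. smooth f \<and> smooth g}" for h and x :: "real^'n"
    using that differentiable_mult[OF smooth_differentiable smooth_differentiable] by blast
qed (use assms in blast)

lemma pderiv_dir_affine:
  fixes f :: "real^'n::finite \<Rightarrow> complex"
  assumes "\<And>x. f differentiable (at x)"
  shows "(\<lambda>y. f (c *\<^sub>R y + b)) differentiable (at x)"
    and "pderiv_dir i (\<lambda>y. f (c *\<^sub>R y + b)) = (\<lambda>y. c *\<^sub>R pderiv_dir i f (c *\<^sub>R y + b))"
proof -
  have "((\<lambda>y. f (c *\<^sub>R y + b)) has_derivative
      (\<lambda>v. \<Sum>i\<in>UNIV. (c *\<^sub>R v) $ i *\<^sub>R pderiv_dir i f (c *\<^sub>R x + b))) (at x)" for x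
  proof (rule has_derivative_compose[of "\<lambda>y. c *\<^sub>R y + b" "\<lambda>v. c *\<^sub>R v" x UNIV f, simplified])
    show "((\<lambda>y. c *\<^sub>R y + b) has_derivative (*\<^sub>R) c) (at x)"
      by (auto intro!: derivative_eq_intros)
    show "(f has_derivative (\<lambda>v. \<Sum>i\<in>UNIV. v $ i *\<^sub>R pderiv_dir i f (c *\<^sub>R x + b))) (at (c *\<^sub>R x + b))"
      by (rule has_derivative_partials[OF assms])
  qed
  note * = this
  show "(\<lambda>y. f (c *\<^sub>R y + b)) differentiable (at x)"
    using * differentiable_def by blast
  show "pderiv_dir i (\<lambda>y. f (c *\<^sub>R y + b)) = (\<lambda>y. c *\<^sub>R pderiv_dir i f (c *\<^sub>R y + b))"
    by (rule ext, subst pderiv_dir_eqI[OF *])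
       (simp add: axis_def if_distrib[of "\<lambda>x. _ * x"] if_distrib[of "\<lambda>c. c *\<^sub>R _"] cong: if_cong)
qed

lemma iter_pderiv_affine:
  fixes f :: "real^'n::finite \<Rightarrow> complex"
  assumes "smooth f"
  shows "iter_pderiv is (\<lambda>y. f (c *\<^sub>R y + b)) = (\<lambda>y. of_real (c ^ length is) * iter_pderiv is f (c *\<^sub>R y + b))"
proof (induction "is")
  case (Cons i "is")
  have d: "iter_pderiv is f differentiable (at x)" for x
    using assms by (auto simp: smooth_def)
  show ?case
    unfolding iter_pderiv_Cons Cons
    by (rule ext, subst pderiv_dir_cmult)
       (simp_all add: pderiv_dir_affine[of "iter_pderiv is f", OF d] iter_pderiv_Cons scaleR_conv_of_real[where 'a=complex])
qed simp

lemma smooth_affine: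
  fixes f :: "real^'n::finite \<Rightarrow> complex"
  assumes "smooth f"
  shows "smooth (\<lambda>y. f (c *\<^sub>R y + b))"
proof -
  have d: "iter_pderiv is f differentiable (at x)" for "is" x
    using assms by (auto simp: smooth_def)
  show ?thesis
    unfolding smooth_def iter_pderiv_affine[OF assms]
    by (intro allI differentiable_mult differentiable_const pderiv_dir_affine(1) d)
qed

lemma smooth_continuous_on: "smooth f \<Longrightarrow> continuous_on A f"
  using smooth_differentiable differentiable_imp_continuous_within
  by (metis continuous_at_imp_continuous_on)

lemma smooth_borel: "smooth f \<Longrightarrow> f \<in> borel_measurable borel"
  using smooth_continuous_on borel_measurable_continuous_onI by blast

lemma supp_bounded:
  fixes f :: "real^'n::finite \<Rightarrow> complex"
  shows "compact (supp f) \<longleftrightarrow> (\<exists>r. \<forall>x. r < norm x \<longrightarrow> f x = 0)"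
proof
  assume "compact (supp f)"
  then obtain r where "\<forall>x\<in>supp f. norm x \<le> r"
    using compact_imp_bounded bounded_iff by metis
  then show "\<exists>r. \<forall>x. r < norm x \<longrightarrow> f x = 0"
    unfolding supp_def using closure_subset[of "{x. f x \<noteq> 0}"]
    by (intro exI[of _ r]) (metis (mono_tags, lifting) mem_Collect_eq not_le subset_iff)
next
  assume "\<exists>r. \<forall>x. r < norm x \<longrightarrow> f x = 0"
  then obtain r where "{x. f x \<noteq> 0} \<subseteq> cball 0 r" by (force simp: not_less)
  then have "bounded {x. f x \<noteq> 0}" using bounded_subset bounded_cball by blast
  then show "compact (supp f)" by (simp add: supp_def compact_closure)
qed

lemma test_functions_iff:
  "\<phi> \<in> test_functions \<longleftrightarrow> smooth \<phi> \<and> (\<exists>r. \<forall>x. r < norm x \<longrightarrow> \<phi> x = 0)"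
  by (simp add: test_functions_def supp_bounded)

lemma supp_zero: "x \<notin> supp f \<Longrightarrow> f x = 0"
  unfolding supp_def using closure_subset[of "{x. f x \<noteq> 0}"] by blast

lemma iter_pderiv_outside_supp:
  fixes f :: "real^'n::finite \<Rightarrow> complex"
  assumes "open U" "\<And>x. x \<in> U \<Longrightarrow> f x = 0"
  shows "x \<in> U \<Longrightarrow> iter_pderiv is f x = 0"
proof (induction "is" arbitrary: x)
  case (Cons i "is")
  have "(iter_pderiv is f has_derivative (\<lambda>v. 0)) (at x)"
    by (rule has_derivative_transform_within_open[OF _ assms(1) Cons.prems])
       (use Cons.IH in auto)
  then show ?case by (simp add: iter_pderiv_Cons pderiv_dir_eqI)
qed (use assms in simp)

lemma test_measurable: "\<phi> \<in> test_functions \<Longrightarrow> \<phi> \<in> borel_measurable borel"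
  by (simp add: test_functions_def smooth_borel)

lemma test_iter_pderiv:
  assumes "\<phi> \<in> test_functions"
  shows "iter_pderiv is \<phi> \<in> test_functions"
proof -
  obtain r where r: "\<forall>x. r < norm x \<longrightarrow> \<phi> x = 0" using assms by (auto simp: test_functions_iff)
  have "iter_pderiv is \<phi> x = 0" if "r < norm x" for x
    by (rule iter_pderiv_outside_supp[of "{x. r < norm x}"])
       (use r that in \<open>auto intro: open_Collect_less continuous_intros\<close>)
  then show ?thesis using assms by (auto simp: test_functions_iff smooth_iter_pderiv)
qed

lemma test_bounded:
  assumes "\<phi> \<in> test_functions"
  shows "\<exists>M. \<forall>x. cmod (\<phi> x) \<le> M"
proof -
  have "compact (\<phi> ` supp \<phi>)"
    using assms by (intro compact_continuous_image smooth_continuous_on) (auto simp: test_functions_def)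
  then obtain M where M: "\<forall>z\<in>\<phi> ` supp \<phi>. cmod z \<le> M"
    using compact_imp_bounded bounded_iff by metis
  have "cmod (\<phi> x) \<le> max M 0" for x
    using M supp_zero[of x \<phi>] by (cases "x \<in> supp \<phi>") force+
  then show ?thesis by blast
qed

lemma test_derivs_bounded:
  fixes \<phi> :: "real^'n::finite \<Rightarrow> complex"
  assumes "\<phi> \<in> test_functions"
  shows "\<exists>M>0. derivs_bounded N \<phi> M"
proof -
  have fin: "finite {is :: 'n list. length is \<le> N}"
    using finite_lists_length_le[of "UNIV :: 'n set" N] by simp
  obtain M where M: "\<And>is x. cmod (iter_pderiv is \<phi> x) \<le> M is"
    using test_bounded[OF test_iter_pderiv[OF assms]] by metis
  have "cmod (iter_pderiv is \<phi> x) \<le> 1 + (\<Sum>is | length is \<le> N. \<bar>M is\<bar>)" if "length is \<le> N" for "is" x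
  proof -
    have "\<bar>M is\<bar> \<le> (\<Sum>is | length is \<le> N. \<bar>M is\<bar>)"
      using that by (intro member_le_sum[OF _ _ fin]) auto
    with M[of "is" x] show ?thesis by simp
  qed
  moreover have "0 < 1 + (\<Sum>is :: 'n list | length is \<le> N. \<bar>M is\<bar>)"
    by (smt (verit) sum_nonneg)
  ultimately show ?thesis unfolding derivs_bounded_def by blast
qed

lemma test_linear:
  fixes f g :: "real^'n::finite \<Rightarrow> complex"
  assumes "f \<in> test_functions" "g \<in> test_functions"
  shows "(\<lambda>x. a * f x + b * g x) \<in> test_functions"
proof -
  obtain r s where rs: "\<forall>x. r < norm x \<longrightarrow> f x = 0" "\<forall>x. s < norm x \<longrightarrow> g x = 0"
    using assms by (auto simp: test_functions_iff)
  have "\<forall>x. max r s < norm x \<longrightarrow> a * f x + b * g x = 0" using rs by simp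
  moreover have "smooth (\<lambda>x. a * f x + b * g x)"
    using assms by (intro smooth_linear) (auto simp: test_functions_iff)
  ultimately show ?thesis unfolding test_functions_iff by blast
qed

lemma test_affine:
  fixes f :: "real^'n::finite \<Rightarrow> complex"
  assumes "f \<in> test_functions" "c \<noteq> 0"
  shows "(\<lambda>y. f (c *\<^sub>R y + b)) \<in> test_functions"
proof -
  obtain r where r: "\<And>x. r < norm x \<Longrightarrow> f x = 0" using assms by (auto simp: test_functions_iff)
  have "f (c *\<^sub>R y + b) = 0" if "(r + norm b) / \<bar>c\<bar> < norm y" for y
  proof (rule r)
    have "r + norm b < \<bar>c\<bar> * norm y" using that assms(2) by (simp add: field_simps)
    also have "\<dots> = norm (c *\<^sub>R y)" by simp
    also have "\<dots> \<le> norm (c *\<^sub>R y + b) + norm b" by (metis add_diff_cancel norm_triangle_ineq4)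
    finally show "r < norm (c *\<^sub>R y + b)" by simp
  qed
  then show ?thesis using assms smooth_affine by (auto simp: test_functions_iff)
qed

lemma test_zero: "(\<lambda>x. 0) \<in> test_functions"
  by (simp add: test_functions_iff smooth_zero)

lemma test_cmult: "f \<in> test_functions \<Longrightarrow> (\<lambda>x. c * f x) \<in> test_functions"
  using test_linear[of f f c 0] by simp

lemma test_add: "f \<in> test_functions \<Longrightarrow> g \<in> test_functions \<Longrightarrow> (\<lambda>x. f x + g x) \<in> test_functions"
  using test_linear[of f g 1 1] by simp

lemma test_diff: "f \<in> test_functions \<Longrightarrow> g \<in> test_functions \<Longrightarrow> (\<lambda>x. f x - g x) \<in> test_functions"
  using test_linear[of f g 1 "-1"] by simp

lemma test_sum:
  "finite I \<Longrightarrow> (\<And>i. i \<in> I \<Longrightarrow> f i \<in> test_functions) \<Longrightarrow> (\<lambda>x. \<Sum>i\<in>I. f i x) \<in> test_functions"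
  by (induction I rule: finite_induct) (auto simp: test_zero intro!: test_add)

text \<open>A partial derivative of the product is a sum of two products of the same kind, with the
  exponents \<open>a - 2\<close> and \<open>a\<close>; their smooth factors vanish near the origin again.\<close>

lemma smooth_norm_powr_mult:
  fixes \<delta> :: "real^'n::finite \<Rightarrow> complex"
  assumes "smooth \<delta>" "0 < e" "\<And>x. norm x < e \<Longrightarrow> \<delta> x = 0"
  shows "smooth (\<lambda>x. of_real (norm x powr a) * \<delta> x)"
proof -
  define Z :: "(real^'n \<Rightarrow> complex) set" where "Z = {\<delta>. smooth \<delta> \<and> (\<forall>x. norm x < e \<longrightarrow> \<delta> x = 0)}"
  define S where "S = {(\<lambda>x. of_real (norm x powr a) * \<delta> x) | a \<delta>. \<delta> \<in> Z}"
  have SI: "(\<lambda>x. of_real (norm x powr a) * \<delta> x) \<in> S" if "\<delta> \<in> Z" for a \<delta>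
    using that unfolding S_def by blast
  have der: "((\<lambda>x. of_real (norm x powr a) * \<delta> x) has_derivative
      (\<lambda>v. of_real (norm x powr (a - 2)) * (of_real (a * (x \<bullet> v)) * \<delta> x)
         + of_real (norm x powr a) * (\<Sum>i\<in>UNIV. v $ i *\<^sub>R pderiv_dir i \<delta> x))) (at x)"
    if "\<delta> \<in> Z" for a \<delta> x
  proof (cases "norm x < e")
    case True
    have op: "open (ball (0 :: real^'n) e)" by simp
    have "pderiv_dir i \<delta> x = 0" for i
      using iter_pderiv_outside_supp[OF op, of \<delta> x "[i]"] that True by (auto simp: Z_def iter_pderiv_Cons)
    moreover have "((\<lambda>x. of_real (norm x powr a) * \<delta> x) has_derivative (\<lambda>v. 0)) (at x)"
      by (rule has_derivative_transform_within_open[OF has_derivative_const[of 0] op])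
         (use that True in \<open>auto simp: Z_def\<close>)
    ultimately show ?thesis using that True by (auto simp: Z_def)
  next
    case False
    then have x: "x \<noteq> 0" "norm x > 0" using assms(2) by auto
    have n: "((\<lambda>x. norm x) has_derivative (\<lambda>v. x \<bullet> v / norm x)) (at x)"
      by (rule has_derivative_eq_rhs, rule has_derivative_norm[OF x(1)])
         (auto simp: sgn_div_norm fun_eq_iff inner_commute divide_inverse)
    have "((\<lambda>x. norm x powr a) has_derivative (\<lambda>v. norm x powr (a - 2) * (a * (x \<bullet> v)))) (at x)"
      by (rule has_derivative_eq_rhs, rule has_derivative_powr[OF n has_derivative_const x(2)])
         (use x in \<open>auto simp: fun_eq_iff powr_diff power2_eq_square field_simps\<close>)
    then have "((\<lambda>x. complex_of_real (norm x powr a)) has_derivative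
        (\<lambda>v. complex_of_real (norm x powr (a - 2) * (a * (x \<bullet> v))))) (at x)"
      by (rule has_derivative_of_real)
    from has_derivative_mult[OF this has_derivative_partials[OF smooth_differentiable, of \<delta>]] that
    show ?thesis by (auto simp: Z_def algebra_simps elim!: has_derivative_eq_rhs)
  qed
  have smooth_coord: "smooth (\<lambda>x::real^'n. complex_of_real (a * (x $ i)))" for a i
  proof (rule smooth_coinduct[of "{\<lambda>x. complex_of_real (a * (x $ i)) | a i. True} \<union> {\<lambda>x. c | c. True}"])
    have d: "((\<lambda>x::real^'n. complex_of_real (a * (x $ i))) has_derivative (\<lambda>v. complex_of_real (a * (v $ i)))) (at x)" for a x i
      by (rule bounded_linear_imp_has_derivative, rule bounded_linear_compose[OF bounded_linear_of_real],
          rule bounded_linear_compose[OF bounded_linear_mult_right bounded_linear_vec_nth])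
    show "f differentiable at x"
      if "f \<in> {\<lambda>x. complex_of_real (a * (x $ i)) | a i. True} \<union> {\<lambda>x. c | c. True}" for f and x :: "real^'n"
      using that
    proof
      assume "f \<in> {\<lambda>x::real^'n. complex_of_real (a * (x $ i)) | a i. True}"
      then obtain a i where "f = (\<lambda>x. complex_of_real (a * (x $ i)))" by blast
      then show ?thesis using d[of a i x] unfolding differentiable_def by blast
    next
      assume "f \<in> {\<lambda>x. c | c. True}"
      then show ?thesis by auto
    qed
    fix f k assume "f \<in> {\<lambda>x::real^'n. complex_of_real (a * (x $ i)) | a i. True} \<union> {\<lambda>x. c | c. True}"
    then consider a i where "f = (\<lambda>x::real^'n. complex_of_real (a * (x $ i)))" | c where "f = (\<lambda>x. c)"
      by blast
    then have "\<exists>c. pderiv_dir k f = (\<lambda>x. c)"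
    proof cases
      case (1 a i)
      then have "pderiv_dir k f = (\<lambda>x. complex_of_real (a * (axis k 1 :: real^'n) $ i))"
        using pderiv_dir_eqI[OF d] by (intro ext) blast
      then show ?thesis by blast
    next
      case (2 c)
      then have "pderiv_dir k f = (\<lambda>x. 0)"
        using pderiv_dir_eqI[OF has_derivative_const] by (intro ext) blast
      then show ?thesis by blast
    qed
    then obtain c where "pderiv_dir k f = (\<lambda>x. c)" ..
    then show "\<exists>g\<in>{\<lambda>x. complex_of_real (a * (x $ i)) | a i. True} \<union> {\<lambda>x. c | c. True}.
        \<exists>h\<in>{\<lambda>x. complex_of_real (a * (x $ i)) | a i. True} \<union> {\<lambda>x. c | c. True}.
        pderiv_dir k f = (\<lambda>x. g x + h x)"
      by (intro bexI[of _ "\<lambda>x. c"] bexI[of _ "\<lambda>x. 0"]) (simp, blast+)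
  qed blast
  show ?thesis
  proof (rule smooth_coinduct[of S])
    show "f differentiable (at x)" if fS: "f \<in> S" for f x
    proof -
      obtain a \<delta> where "f = (\<lambda>x. of_real (norm x powr a) * \<delta> x)" "\<delta> \<in> Z"
        using fS unfolding S_def by blast
      then show ?thesis using der[of \<delta> a x] unfolding differentiable_def by blast
    qed
    fix f i assume "f \<in> S"
    then obtain a \<delta> where f: "f = (\<lambda>x. of_real (norm x powr a) * \<delta> x)" and \<delta>: "\<delta> \<in> Z"
      by (auto simp: S_def)
    have "pderiv_dir i f = (\<lambda>x. of_real (norm x powr (a - 2)) * (of_real (a * (x $ i)) * \<delta> x)
        + of_real (norm x powr a) * pderiv_dir i \<delta> x)"
      unfolding f
      by (rule ext, subst pderiv_dir_eqI[OF der[OF \<delta>]])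
         (simp only: inner_axis, simp add: axis_def if_distrib[of "\<lambda>c. c *\<^sub>R _"] cong: if_cong)
    moreover have "(\<lambda>x. of_real (a * (x $ i)) * \<delta> x) \<in> Z"
      using \<delta> smooth_mult[OF smooth_coord] by (auto simp: Z_def)
    moreover have "pderiv_dir i \<delta> \<in> Z"
      using \<delta> smooth_pderiv_dir iter_pderiv_outside_supp[of "ball 0 e" \<delta> _ "[i]"]
      by (auto simp: Z_def iter_pderiv_Cons)
    ultimately show "\<exists>g\<in>S. \<exists>h\<in>S. pderiv_dir i f = (\<lambda>x. g x + h x)"
      using SI by (intro bexI[of _ "\<lambda>x. of_real (norm x powr (a - 2)) * (of_real (a * (x $ i)) * \<delta> x)"]
        bexI[of _ "\<lambda>x. of_real (norm x powr a) * pderiv_dir i \<delta> x"])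
  next
    show "(\<lambda>x. of_real (norm x powr a) * \<delta> x) \<in> S"
      using assms by (intro SI) (simp add: Z_def)
  qed
qed

section \<open>Convolution with integrable kernels\<close>

abbreviation L1_norm :: "(real^'n::finite \<Rightarrow> complex) \<Rightarrow> real" where
  "L1_norm a \<equiv> (\<integral>y. cmod (a y) \<partial>lborel)"

definition convol :: "(real^'n::finite \<Rightarrow> complex) \<Rightarrow> (real^'n \<Rightarrow> complex) \<Rightarrow> real^'n \<Rightarrow> complex" where
  "convol a b x = (\<integral>y. a y * b (x - y) \<partial>lborel)"

lemma lborel_distr_reflect: "distr lborel borel (\<lambda>y. x - y) = (lborel :: (real^'n::finite) measure)"
proof -
  have "lborel = density (distr lborel borel (\<lambda>y::real^'n. x + (-1) *\<^sub>R y)) (\<lambda>_. \<bar>-1::real\<bar> ^ DIM(real^'n))"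
    by (rule lborel_affine) simp
  then show ?thesis by (simp add: density_1)
qed

lemma integral_reflect:
  fixes f :: "real^'n::finite \<Rightarrow> 'b::{banach, second_countable_topology}"
  assumes [measurable]: "f \<in> borel_measurable borel"
  shows "(\<integral>y. f (x - y) \<partial>lborel) = (\<integral>y. f y \<partial>lborel)"
  by (subst (2) lborel_distr_reflect[of x, symmetric]) (simp add: integral_distr)

lemma convol_commute:
  assumes [measurable]: "a \<in> borel_measurable borel" "b \<in> borel_measurable borel"
  shows "convol a b = convol b a"
  by (rule ext) (auto simp: convol_def integral_reflect[of "\<lambda>y. b y * a (x - y)" x for x, symmetric] mult.commute)

lemma convol_integrable:
  fixes a b :: "real^'n::finite \<Rightarrow> complex"
  assumes a: "integrable lborel a" and [measurable]: "b \<in> borel_measurable borel"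
    and B: "\<And>x. cmod (b x) \<le> B"
  shows "integrable lborel (\<lambda>y. a y * b (x - y))"
proof (rule Bochner_Integration.integrable_bound)
  show "integrable lborel (\<lambda>y. B * cmod (a y))" using a by simp
  have [measurable]: "a \<in> borel_measurable borel" using a by auto
  show "(\<lambda>y. a y * b (x - y)) \<in> borel_measurable lborel" by measurable
  show "AE y in lborel. norm (a y * b (x - y)) \<le> norm (B * cmod (a y))"
  proof (intro AE_I2)
    fix y
    have "0 \<le> B" using B[of 0] norm_ge_zero order_trans by blast
    then show "norm (a y * b (x - y)) \<le> norm (B * cmod (a y))"
      using B[of "x - y"] by (simp add: norm_mult mult.commute[of B] mult_left_mono)
  qed
qed

lemma convol_bound:
  fixes a b :: "real^'n::finite \<Rightarrow> complex"
  assumes a: "integrable lborel a" and [measurable]: "b \<in> borel_measurable borel"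
    and B: "\<And>x. cmod (b x) \<le> B"
  shows "cmod (convol a b x) \<le> L1_norm a * B"
proof -
  have "cmod (convol a b x) \<le> (\<integral>y. cmod (a y * b (x - y)) \<partial>lborel)"
    unfolding convol_def by (rule integral_norm_bound)
  also have "\<dots> \<le> (\<integral>y. cmod (a y) * B \<partial>lborel)"
    using a B
    by (intro integral_mono integrable_norm[OF convol_integrable[OF assms]]) (auto simp: norm_mult mult_left_mono)
  finally show ?thesis by simp
qed

lemma convol_linear_right:
  fixes a b c :: "real^'n::finite \<Rightarrow> complex"
  assumes a: "integrable lborel a"
    and b: "b \<in> borel_measurable borel" "\<And>x. cmod (b x) \<le> B"
    and c: "c \<in> borel_measurable borel" "\<And>x. cmod (c x) \<le> C"
  shows "convol a (\<lambda>y. s * b y + t * c y) x = s * convol a b x + t * convol a c x"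
proof -
  have "convol a (\<lambda>y. s * b y + t * c y) x = (\<integral>y. s * (a y * b (x - y)) + t * (a y * c (x - y)) \<partial>lborel)"
    unfolding convol_def by (rule Bochner_Integration.integral_cong) (auto simp: algebra_simps)
  also have "\<dots> = s * convol a b x + t * convol a c x"
    unfolding convol_def using convol_integrable[OF a b] convol_integrable[OF a c]
    by (subst Bochner_Integration.integral_add) auto
  finally show ?thesis .
qed

lemma convol_linear_left:
  fixes a b c :: "real^'n::finite \<Rightarrow> complex"
  assumes a: "integrable lborel a" and c: "integrable lborel c"
    and b: "b \<in> borel_measurable borel" "\<And>x. cmod (b x) \<le> B"
  shows "convol (\<lambda>y. s * a y + t * c y) b x = s * convol a b x + t * convol c b x"
proof -
  have "convol (\<lambda>y. s * a y + t * c y) b x = (\<integral>y. s * (a y * b (x - y)) + t * (c y * b (x - y)) \<partial>lborel)"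
    unfolding convol_def by (rule Bochner_Integration.integral_cong) (auto simp: algebra_simps)
  also have "\<dots> = s * convol a b x + t * convol c b x"
    unfolding convol_def using convol_integrable[OF a b] convol_integrable[OF c b]
    by (subst Bochner_Integration.integral_add) auto
  finally show ?thesis .
qed

lemma convol_left_commute:
  fixes a b f :: "real^'n::finite \<Rightarrow> complex"
  assumes a: "integrable lborel a" and b: "integrable lborel b"
    and [measurable]: "f \<in> borel_measurable borel" and B: "\<And>x. cmod (f x) \<le> B"
  shows "convol a (convol b f) = convol b (convol a f)"
proof
  fix x
  have [measurable]: "a \<in> borel_measurable borel" "b \<in> borel_measurable borel" using a b by auto
  let ?F = "\<lambda>(y, z). a y * (b z * f (x - y - z))"
  have int: "integrable (lborel \<Otimes>\<^sub>M lborel) ?F"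
  proof (rule lborel_pair.Fubini_integrable)
    show "?F \<in> borel_measurable (lborel \<Otimes>\<^sub>M lborel)" by measurable
    have inner: "integrable lborel (\<lambda>z. b z * f (x - y - z))" for y
      by (rule convol_integrable[OF b _ B]) simp
    show "AE y in lborel. integrable lborel (\<lambda>z. ?F (y, z))"
      using inner by auto
    let ?J = "\<lambda>y. \<integral>z. norm (?F (y, z)) \<partial>lborel"
    have J: "norm (?J y) \<le> norm (cmod (a y) * ((\<integral>z. cmod (b z) \<partial>lborel) * B))" for y
    proof -
      have "?J y = cmod (a y) * (\<integral>z. cmod (b z * f (x - y - z)) \<partial>lborel)"
        by (simp add: norm_mult)
      also have "(\<integral>z. cmod (b z * f (x - y - z)) \<partial>lborel) \<le> (\<integral>z. cmod (b z) * B \<partial>lborel)"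
        using b B by (intro integral_mono integrable_norm[OF inner]) (auto simp: norm_mult mult_left_mono)
      finally have "?J y \<le> cmod (a y) * ((\<integral>z. cmod (b z) \<partial>lborel) * B)"
        by (simp add: mult_left_mono)
      moreover have "0 \<le> ?J y" by (intro integral_nonneg_AE) auto
      ultimately show ?thesis unfolding real_norm_def by linarith
    qed
    show "integrable lborel ?J"
      by (rule Bochner_Integration.integrable_bound[of lborel "\<lambda>y. cmod (a y) * ((\<integral>z. cmod (b z) \<partial>lborel) * B)"])
         (use a J in auto)
  qed
  have "convol a (convol b f) x = (\<integral>y. \<integral>z. a y * (b z * f (x - y - z)) \<partial>lborel \<partial>lborel)"
    by (simp add: convol_def)
  also have "\<dots> = (\<integral>z. \<integral>y. a y * (b z * f (x - y - z)) \<partial>lborel \<partial>lborel)"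
    using lborel_pair.Fubini_integral[of "\<lambda>y z. a y * (b z * f (x - y - z))"] int by simp
  also have "\<dots> = (\<integral>z. \<integral>y. b z * (a y * f (x - z - y)) \<partial>lborel \<partial>lborel)"
    by (simp add: algebra_simps)
  also have "\<dots> = convol b (convol a f) x"
    by (simp add: convol_def)
  finally show "convol a (convol b f) x = convol b (convol a f) x" .
qed

lemma partials_norm_bound:
  fixes c :: "'n::finite \<Rightarrow> complex"
  assumes "\<And>i. cmod (c i) \<le> B"
  shows "cmod (\<Sum>i\<in>UNIV. (v :: real^'n) $ i *\<^sub>R c i) \<le> real CARD('n) * B * norm v"
proof -
  have "0 \<le> B" using assms norm_ge_zero order_trans by blast
  have "cmod (\<Sum>i\<in>UNIV. v $ i *\<^sub>R c i) \<le> (\<Sum>i\<in>(UNIV::'n set). norm v * B)"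
  proof (rule sum_norm_le)
    fix i
    show "cmod (v $ i *\<^sub>R c i) \<le> norm v * B"
      using assms[of i] component_le_norm_cart[of v i] \<open>0 \<le> B\<close> by (auto intro: mult_mono)
  qed
  then show ?thesis by (simp add: algebra_simps)
qed

lemma partials_lipschitz:
  fixes b :: "real^'n::finite \<Rightarrow> complex"
  assumes b: "\<And>x. x \<in> S \<Longrightarrow> b differentiable (at x)" and S: "convex S"
    and B: "\<And>i x. x \<in> S \<Longrightarrow> cmod (pderiv_dir i b x) \<le> B" and "x \<in> S" "y \<in> S"
  shows "cmod (b x - b y) \<le> real CARD('n) * B * norm (x - y)"
proof (rule differentiable_bound[OF S _ _ assms(4,5)])
  show "(b has_derivative (\<lambda>v. \<Sum>i\<in>UNIV. v $ i *\<^sub>R pderiv_dir i b x)) (at x within S)" if "x \<in> S" for x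
    using has_derivative_partials[OF b[OF that]] has_derivative_at_withinI by blast
  show "onorm (\<lambda>v. \<Sum>i\<in>UNIV. v $ i *\<^sub>R pderiv_dir i b x) \<le> real CARD('n) * B" if "x \<in> S" for x
    by (rule onorm_le) (rule partials_norm_bound, rule B[OF that])
qed

text \<open>The bound is uniform in \<open>w\<close>, so integrating it against an integrable kernel differentiates a
  convolution under the integral.\<close>

lemma test_taylor:
  fixes b :: "real^'n::finite \<Rightarrow> complex"
  assumes "b \<in> test_functions"
  shows "\<exists>M. \<forall>w v. cmod (b (w + v) - b w - (\<Sum>i\<in>UNIV. v $ i *\<^sub>R pderiv_dir i b w)) \<le> M * norm v * norm v"
proof -
  obtain L where L: "0 < L" "derivs_bounded 2 b L" using test_derivs_bounded[OF assms] by blast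
  have sm: "smooth b" using assms by (simp add: test_functions_def)
  have d1: "b differentiable (at x)" for x using smooth_differentiable[OF sm] .
  have d2: "pderiv_dir i b differentiable (at x)" for i x
    using smooth_differentiable[OF smooth_pderiv_dir[OF sm]] .
  have L2: "cmod (pderiv_dir j (pderiv_dir i b) x) \<le> L" for i j x
    using L(2)[unfolded derivs_bounded_def, rule_format, of "[j, i]" x] by (simp add: iter_pderiv_Cons)
  have lip: "cmod (pderiv_dir i b x - pderiv_dir i b y) \<le> real CARD('n) * L * norm (x - y)" for i x y
    by (rule partials_lipschitz[of UNIV]) (auto simp: d2 L2)
  have "cmod (b (w + v) - b w - (\<Sum>i\<in>UNIV. v $ i *\<^sub>R pderiv_dir i b w))
      \<le> (real CARD('n) * (real CARD('n) * L)) * norm v * norm v" for w v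
  proof -
    define g where "g u = b u - (\<Sum>i\<in>UNIV. (u - w) $ i *\<^sub>R pderiv_dir i b w)" for u
    have gd: "(g has_derivative (\<lambda>v. \<Sum>i\<in>UNIV. v $ i *\<^sub>R (pderiv_dir i b u - pderiv_dir i b w))) (at u)" for u
    proof -
      have "((\<lambda>u. \<Sum>i\<in>UNIV. (u - w) $ i *\<^sub>R pderiv_dir i b w) has_derivative
          (\<lambda>v. \<Sum>i\<in>UNIV. v $ i *\<^sub>R pderiv_dir i b w)) (at u)"
        by (auto intro!: derivative_eq_intros bounded_linear_imp_has_derivative bounded_linear_vec_nth
             has_derivative_sum bounded_linear.has_derivative[OF bounded_linear_vec_nth])
      from has_derivative_diff[OF has_derivative_partials[OF d1] this]
      show ?thesis by (simp add: g_def[abs_def] scaleR_diff_right sum_subtractf)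
    qed
    have gp: "pderiv_dir i g u = pderiv_dir i b u - pderiv_dir i b w" for i u
      using pderiv_dir_eqI[OF gd, of i u]
      by (simp add: axis_def if_distrib[of "\<lambda>c. c *\<^sub>R _"] cong: if_cong)
    have "cmod (g (w + v) - g w) \<le> real CARD('n) * (real CARD('n) * L * norm v) * norm ((w + v) - w)"
    proof (rule partials_lipschitz[of "cball w (norm v)"])
      show "g differentiable (at u)" for u using gd differentiable_def by blast
      fix i u assume "u \<in> cball w (norm v)"
      then have "norm (u - w) \<le> norm v" by (simp add: dist_norm norm_minus_commute)
      then have "real CARD('n) * L * norm (u - w) \<le> real CARD('n) * L * norm v"
        using L(1) by (intro mult_left_mono) auto
      then show "cmod (pderiv_dir i g u) \<le> real CARD('n) * L * norm v"
        using lip[of i u w] unfolding gp by linarith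
    qed (auto simp: dist_norm)
    then show ?thesis by (simp add: g_def algebra_simps)
  qed
  then show ?thesis by blast
qed

lemma convol_has_derivative:
  fixes a b :: "real^'n::finite \<Rightarrow> complex"
  assumes a: "integrable lborel a" and b: "b \<in> test_functions"
  shows "(convol a b has_derivative (\<lambda>v. \<Sum>i\<in>UNIV. v $ i *\<^sub>R convol a (pderiv_dir i b) x)) (at x)"
proof -
  let ?D = "\<lambda>v. \<Sum>i\<in>UNIV. v $ i *\<^sub>R convol a (pderiv_dir i b) x"
  obtain M where M: "\<And>w v. cmod (b (w + v) - b w - (\<Sum>i\<in>UNIV. v $ i *\<^sub>R pderiv_dir i b w)) \<le> M * norm v * norm v"
    using test_taylor[OF b] by blast
  have int: "integrable lborel (\<lambda>y. a y * c (x - y))" if "c \<in> test_functions" for c x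
    using test_bounded[OF that] that convol_integrable[OF a smooth_borel] by (auto simp: test_functions_def)
  have b1: "pderiv_dir i b \<in> test_functions" for i
    using test_iter_pderiv[OF b, of "[i]"] by (simp add: iter_pderiv_Cons)
  define K where "K = L1_norm a * M"
  have rem: "cmod (convol a b (x + v) - convol a b x - ?D v) \<le> K * norm v * norm v" for v
  proof -
    let ?r = "\<lambda>y. b (x + v - y) - b (x - y) - (\<Sum>i\<in>UNIV. v $ i *\<^sub>R pderiv_dir i b (x - y))"
    have r: "cmod (?r y) \<le> M * norm v * norm v" for y
      using M[of "x - y" v] by (simp add: algebra_simps)
    have e: "(\<lambda>y. a y * ?r y) = (\<lambda>y. a y * b (x + v - y) - a y * b (x - y) - (\<Sum>i\<in>UNIV. v $ i *\<^sub>R (a y * pderiv_dir i b (x - y))))"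
      by (auto simp: algebra_simps sum_distrib_left)
    have ir: "integrable lborel (\<lambda>y. a y * ?r y)"
      unfolding e by (intro Bochner_Integration.integrable_diff int b Bochner_Integration.integrable_sum integrable_scaleR_right b1)
    have "convol a b (x + v) - convol a b x - ?D v = (\<integral>y. a y * ?r y \<partial>lborel)" (is "?L = ?I")
      unfolding e convol_def
      by (subst Bochner_Integration.integral_diff,
          intro Bochner_Integration.integrable_diff int b,
          intro Bochner_Integration.integrable_sum integrable_scaleR_right int b1,
          subst Bochner_Integration.integral_diff, rule int[OF b], rule int[OF b],
          subst Bochner_Integration.integral_sum, intro integrable_scaleR_right int b1, simp)
    then have "cmod ?L = cmod ?I" by simp
    also have "cmod ?I \<le> (\<integral>y. cmod (a y * ?r y) \<partial>lborel)" by (rule integral_norm_bound)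
    also have "\<dots> \<le> (\<integral>y. cmod (a y) * (M * norm v * norm v) \<partial>lborel)"
      using r a ir by (intro integral_mono integrable_norm integrable_mult_left) (auto simp: norm_mult mult_left_mono)
    finally show ?thesis by (simp add: K_def mult.assoc)
  qed
  have "((\<lambda>h. norm (convol a b (x + h) - convol a b x - ?D h) / norm h) \<longlongrightarrow> 0) (at 0)"
  proof (rule Lim_null_comparison)
    show "\<forall>\<^sub>F h in at 0. norm (norm (convol a b (x + h) - convol a b x - ?D h) / norm h) \<le> K * norm h"
      using rem by (auto simp: eventually_at_filter divide_le_eq mult.assoc)
    show "((\<lambda>h. K * norm h) \<longlongrightarrow> 0) (at 0)"
      by (rule tendsto_eq_intros tendsto_norm_zero tendsto_ident_at refl)+ simp
  qed
  moreover have "bounded_linear ?D"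
    by (intro bounded_linear_sum bounded_linear_compose[OF bounded_linear_scaleR_left bounded_linear_vec_nth])
  ultimately show ?thesis by (simp add: has_derivative_at)
qed

lemma convol_test:
  fixes a b :: "real^'n::finite \<Rightarrow> complex"
  assumes a: "integrable lborel a" and b: "b \<in> test_functions"
  shows "smooth (convol a b)" "iter_pderiv is (convol a b) = convol a (iter_pderiv is b)"
proof -
  have *: "iter_pderiv is (convol a b) = convol a (iter_pderiv is b)" for "is"
  proof (induction "is")
    case (Cons i "is")
    have "pderiv_dir i (convol a (iter_pderiv is b)) x = convol a (pderiv_dir i (iter_pderiv is b)) x" for x
      using pderiv_dir_eqI[OF convol_has_derivative[OF a test_iter_pderiv[OF b]], of i "is" x]
      by (simp add: axis_def if_distrib[of "\<lambda>c. c *\<^sub>R _"] cong: if_cong)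
    then show ?case by (simp add: iter_pderiv_Cons Cons fun_eq_iff)
  qed simp
  then show "iter_pderiv is (convol a b) = convol a (iter_pderiv is b)" .
  show "smooth (convol a b)"
    unfolding smooth_def * using convol_has_derivative[OF a test_iter_pderiv[OF b]] differentiable_def by blast
qed

lemma convol_outside:
  fixes a b :: "real^'n::finite \<Rightarrow> complex"
  assumes "\<And>y. r < norm (y - u) \<Longrightarrow> a y = 0" "\<And>y. s < norm (y - v) \<Longrightarrow> b y = 0" "r + s < norm (x - (u + v))"
  shows "convol a b x = 0"
proof -
  have "a y * b (x - y) = 0" for y
  proof (cases "r < norm (y - u)")
    case False
    have "norm (x - (u + v)) \<le> norm (x - y - v) + norm (y - u)"
      using norm_triangle_ineq[of "x - y - v" "y - u"] by (simp add: algebra_simps)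
    with False assms(3) have "s < norm (x - y - v)" by linarith
    then show ?thesis using assms(2) by simp
  qed (use assms(1) in simp)
  then have "(\<lambda>y. a y * b (x - y)) = (\<lambda>y. 0)" by (rule ext)
  then show ?thesis unfolding convol_def by simp
qed

lemma convol_test_function:
  fixes a b :: "real^'n::finite \<Rightarrow> complex"
  assumes a: "integrable lborel a" "\<And>y. r < norm (y - u) \<Longrightarrow> a y = 0" and b: "b \<in> test_functions"
  shows "convol a b \<in> test_functions"
proof -
  obtain s where s: "\<And>y. s < norm y \<Longrightarrow> b y = 0" using b by (auto simp: test_functions_iff)
  have "convol a b x = 0" if "r + s + norm u < norm x" for x
    by (rule convol_outside[where r = r and s = s and u = u and v = 0])
       (use a s that norm_triangle_ineq2[of x u] in auto)
  then show ?thesis using convol_test(1)[OF a(1) b] by (auto simp: test_functions_iff)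
qed

lemma convol_test_sup_bound:
  fixes a b :: "real^'n::finite \<Rightarrow> complex"
  assumes a: "integrable lborel a" and b: "b \<in> test_functions" and B: "\<And>x. cmod (iter_pderiv is b x) \<le> B"
  shows "cmod (iter_pderiv is (convol a b) x) \<le> L1_norm a * B"
  unfolding convol_test(2)[OF a b]
  using test_iter_pderiv[OF b, of "is"] by (intro convol_bound[OF a _ B] smooth_borel) (auto simp: test_functions_def)

lemma test_integrable:
  fixes a :: "real^'n::finite \<Rightarrow> complex"
  assumes "a \<in> test_functions"
  shows "integrable lborel a"
proof -
  have *: "continuous_on (supp a) a" "compact (supp a)" using assms by (auto simp: test_functions_def smooth_continuous_on)
  have "integrable lborel (\<lambda>x. indicator (supp a) x *\<^sub>R a x)"
    by (rule borel_integrable_compact[OF *(2,1)])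
  moreover have "(\<lambda>x. indicator (supp a) x *\<^sub>R a x) = a"
    by (auto simp: fun_eq_iff indicator_def supp_zero)
  ultimately show ?thesis by simp
qed

section \<open>Powers of extended nonnegative numbers\<close>

lemma epowr_ennreal: "0 < a \<Longrightarrow> 0 \<le> x \<Longrightarrow> epowr (ennreal x) a = ennreal (x powr a)"
  by (auto simp: epowr_def)

lemma epowr_top [simp]: "0 < a \<Longrightarrow> epowr top a = top"
  by (auto simp: epowr_def)

lemma epowr_zero [simp]: "0 < a \<Longrightarrow> epowr 0 a = 0"
  by (auto simp: epowr_def)

lemma epowr_mult: "0 < a \<Longrightarrow> epowr (x * y) a = epowr x a * epowr y a"
proof (cases x; cases y)
  fix r s :: real assume "0 < a" "0 \<le> r" "x = ennreal r" "0 \<le> s" "y = ennreal s"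
  then show ?thesis by (simp add: ennreal_mult'[symmetric] epowr_ennreal powr_mult)
next
  fix r :: real assume "0 < a" "0 \<le> r" "x = ennreal r" "y = top"
  then show ?thesis by (cases "r = 0") (auto simp: epowr_ennreal ennreal_mult_top)
next
  fix r :: real assume "0 < a" "0 \<le> r" "y = ennreal r" "x = top"
  then show ?thesis by (cases "r = 0") (auto simp: epowr_ennreal ennreal_top_mult)
qed (auto simp: ennreal_top_mult)

lemma epowr_epowr: "0 < a \<Longrightarrow> 0 < b \<Longrightarrow> epowr (epowr x a) b = epowr x (a * b)"
  by (cases x) (auto simp: epowr_ennreal powr_powr)

lemma epowr_one [simp]: "epowr x 1 = x"
  by (cases x) (auto simp: epowr_ennreal)

lemma epowr_mono: "0 < a \<Longrightarrow> x \<le> y \<Longrightarrow> epowr x a \<le> epowr y a"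
proof (cases x; cases y)
  fix r s :: real assume "0 < a" "x \<le> y" "0 \<le> r" "x = ennreal r" "0 \<le> s" "y = ennreal s"
  then show ?thesis by (auto simp: epowr_ennreal intro!: ennreal_leI powr_mono2)
qed (auto simp: top_unique)

text \<open>Powers with positive exponent are order isomorphisms, so bounds for powers of suprema and of
  infinite sums reduce to the single terms and to the partial sums.\<close>

lemma epowr_le_iff: "0 < a \<Longrightarrow> epowr x a \<le> y \<longleftrightarrow> x \<le> epowr y (1 / a)"
  using epowr_mono[of a x "epowr y (1 / a)"] epowr_mono[of "1 / a" "epowr x a" y]
  by (auto simp: epowr_epowr)

lemma epowr_add_le:
  assumes "0 < a" "a \<le> 1"
  shows "epowr (x + y) a \<le> epowr x a + epowr y a"
proof (cases x; cases y)
  fix r s :: real assume *: "0 \<le> r" "x = ennreal r" "0 \<le> s" "y = ennreal s"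
  have "(r + s) powr a \<le> r powr a + s powr a"
  proof (cases "r + s = 0")
    case False
    then have p: "0 < r + s" using * by linarith
    have "u \<le> u powr a" if "0 \<le> u" "u \<le> 1" for u :: real
      using powr_mono'[of a 1 u] that assms by (cases "u = 0") auto
    then have "r / (r + s) \<le> (r / (r + s)) powr a" "s / (r + s) \<le> (s / (r + s)) powr a"
      using p * by auto
    then have "r / (r + s) + s / (r + s) \<le> (r / (r + s)) powr a + (s / (r + s)) powr a" by linarith
    moreover have "r / (r + s) + s / (r + s) = 1" using p by (simp add: add_divide_distrib[symmetric])
    ultimately have "1 \<le> (r powr a + s powr a) / (r + s) powr a"
      using * p by (simp add: powr_divide add_divide_distrib)
    then show ?thesis using p by (simp add: le_divide_eq)
  qed (use * assms in auto)
  then show ?thesis using * assms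
    by (simp add: epowr_ennreal ennreal_plus[symmetric] ennreal_leI del: ennreal_plus)
qed (use assms in auto)

lemma epowr_sum_le:
  assumes "0 < a" "a \<le> 1" "finite I"
  shows "epowr (\<Sum>i\<in>I. f i) a \<le> (\<Sum>i\<in>I. epowr (f i) a)"
  using assms(3)
proof (induction I rule: finite_induct)
  case (insert i I)
  have "epowr (f i + (\<Sum>i\<in>I. f i)) a \<le> epowr (f i) a + epowr (\<Sum>i\<in>I. f i) a"
    by (rule epowr_add_le[OF assms(1,2)])
  also have "\<dots> \<le> epowr (f i) a + (\<Sum>i\<in>I. epowr (f i) a)"
    by (intro add_left_mono insert)
  finally show ?case using insert by simp
qed (use assms in simp)

lemma epowr_suminf_le:
  fixes f :: "nat \<Rightarrow> ennreal"
  assumes "0 < a" "a \<le> 1"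
  shows "epowr (\<Sum>i. f i) a \<le> (\<Sum>i. epowr (f i) a)"
proof -
  have "sum f {..<n} \<le> epowr (\<Sum>i. epowr (f i) a) (1 / a)" for n
  proof (subst epowr_le_iff[symmetric])
    have "epowr (sum f {..<n}) a \<le> (\<Sum>i<n. epowr (f i) a)"
      using assms by (intro epowr_sum_le) auto
    also have "\<dots> \<le> (\<Sum>i. epowr (f i) a)" by (rule sum_le_suminf) auto
    finally show "epowr (sum f {..<n}) a \<le> (\<Sum>i. epowr (f i) a)" .
  qed (use assms in auto)
  then have "suminf f \<le> epowr (\<Sum>i. epowr (f i) a) (1 / a)"
    by (intro suminf_le_const) auto
  then show ?thesis using assms by (simp add: epowr_le_iff)
qed

lemma measurable_epowr [measurable]:
  assumes "0 < a"
  shows "(\<lambda>x. epowr x a) \<in> borel_measurable borel"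
proof -
  have "(\<lambda>x. epowr x a) = (\<lambda>x. if x = top then top else ennreal (enn2real x powr a))"
    using assms by (auto simp: epowr_def fun_eq_iff)
  then show ?thesis by simp
qed

section \<open>Dyadic cells\<close>

definition cell_of :: "nat \<Rightarrow> real^'n::finite \<Rightarrow> int^'n" where
  "cell_of j y = (\<chi> i. \<lfloor>2 ^ j * y $ i\<rfloor>)"

definition cell :: "nat \<Rightarrow> int^'n::finite \<Rightarrow> (real^'n) set" where
  "cell j z = {y. cell_of j y = z}"

lemma borel_vec_nth [measurable]: "(\<lambda>y::real^'n::finite. y $ i) \<in> borel_measurable borel"
  by (rule borel_measurable_continuous_onI) (intro continuous_intros)

lemma cell_borel [measurable]: "cell j z \<in> sets borel"
proof -
  have "cell j z = {y \<in> space borel. \<forall>i. \<lfloor>2 ^ j * y $ i\<rfloor> = z $ i}"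
    by (auto simp: cell_def cell_of_def vec_eq_iff)
  also have "\<dots> \<in> sets borel" by measurable
  finally show ?thesis .
qed

lemma cell_of_measurable [measurable]: "cell_of j \<in> measurable borel (count_space UNIV)"
  by (rule measurable_count_space_eq2_countable[THEN iffD2])
     (auto simp: cell_borel[unfolded cell_def] vimage_def)

lemma cell_coord:
  assumes "y \<in> cell j z"
  shows "of_int (z $ i) / 2 ^ j \<le> y $ i" "y $ i < (of_int (z $ i) + 1) / 2 ^ j"
  using assms by (auto simp: cell_def cell_of_def divide_le_eq less_divide_eq mult.commute)

lemma cell_close:
  assumes "y \<in> cell j z" "y' \<in> cell j z"
  shows "\<bar>y $ i - y' $ i\<bar> \<le> 1 / 2 ^ j"
  using cell_coord[OF assms(1), of i] cell_coord[OF assms(2), of i]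
  by (auto simp: add_divide_distrib)

lemma norm_coord_bound:
  fixes v :: "real^'n::finite"
  assumes "\<And>i. \<bar>v $ i\<bar> \<le> d"
  shows "norm v \<le> real CARD('n) * d"
  using norm_le_l1_cart[of v] sum_mono[of UNIV "\<lambda>i. \<bar>v $ i\<bar>" "\<lambda>_. d"] assms by simp

lemma cube_cbox: "cube x t = cbox (\<chi> i. x $ i - t / 2) (\<chi> i. x $ i + t / 2)"
  unfolding set_eq_iff cube_def mem_Collect_eq mem_box_cart abs_diff_le_iff by simp

lemma cube_borel [measurable]: "cube x t \<in> sets borel"
  by (simp add: cube_cbox)

lemma emeasure_cube:
  assumes "0 \<le> t"
  shows "emeasure lborel (cube (x :: real^'n::finite) t) = ennreal (t ^ CARD('n))"
proof -
  have "cube x t \<noteq> {}" using assms by (auto simp: cube_def intro!: exI[of _ x])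
  then have "measure lborel (cube x t) = t ^ CARD('n)"
    unfolding cube_cbox by (subst content_cbox_cart) auto
  then show ?thesis
    unfolding cube_cbox by (subst emeasure_eq_ennreal_measure) (auto simp: emeasure_lborel_cbox_eq)
qed

lemma emeasure_cell:
  "emeasure lborel (cell j (z :: int^'n::finite)) = ennreal ((1 / 2 ^ j) ^ CARD('n))"
proof -
  define a :: "real^'n" where "a = (\<chi> i. of_int (z $ i) / 2 ^ j)"
  define b :: "real^'n" where "b = (\<chi> i. (of_int (z $ i) + 1) / 2 ^ j)"
  note a_b_def = a_def b_def
  have ab: "a $ i \<le> b $ i" for i by (simp add: a_b_def divide_right_mono)
  have ne: "cbox a b \<noteq> {}" using ab by (simp add: interval_ne_empty_cart)
  have "measure lborel (cbox a b) = (1 / 2 ^ j) ^ CARD('n)"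
    using ne by (subst content_cbox_cart) (auto simp: a_b_def add_divide_distrib)
  then have c: "emeasure lborel (cbox a b) = ennreal ((1 / 2 ^ j) ^ CARD('n))"
    by (subst emeasure_eq_ennreal_measure) (auto simp: emeasure_lborel_cbox_eq)
  have "emeasure lborel (box a b) = emeasure lborel (cbox a b)"
    by (simp add: emeasure_lborel_cbox_eq emeasure_lborel_box_eq)
  moreover have "box a b \<subseteq> cell j z"
    by (auto simp: mem_box_cart cell_def cell_of_def vec_eq_iff a_b_def floor_eq_iff divide_less_eq less_divide_eq mult.commute
        less_imp_le)
  moreover have "cell j z \<subseteq> cbox a b"
    using cell_coord by (fastforce simp: mem_box_cart a_b_def intro: less_imp_le)
  moreover have "emeasure lborel (box a b) \<le> emeasure lborel (cell j z)" 
    by (intro emeasure_mono) (use calculation in auto)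
  moreover have "emeasure lborel (cell j z) \<le> emeasure lborel (cbox a b)" 
    by (intro emeasure_mono) (use calculation in auto)
  ultimately show ?thesis using c by auto
qed

lemma cell_integral_bound:
  fixes h :: "real^'n::finite \<Rightarrow> complex"
  assumes h: "integrable lborel h" and H: "\<And>y. cmod (h y) \<le> H"
  shows "(\<integral>y. indicator (cell j z) y * cmod (h y) \<partial>lborel) \<le> H * (1 / 2 ^ j) ^ CARD('n)"
proof -
  have fin: "emeasure lborel (cell j z) < \<infinity>" unfolding emeasure_cell by simp
  have "(\<integral>y. indicator (cell j z) y * cmod (h y) \<partial>lborel) \<le> (\<integral>y. indicator (cell j z) y * H \<partial>lborel)"
  proof (rule integral_mono)
    show "integrable lborel (\<lambda>y. indicator (cell j z) y * cmod (h y))"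
      using integrable_mult_indicator[of "cell j z" lborel "\<lambda>y. cmod (h y)"] h by simp
    show "integrable lborel (\<lambda>y. indicator (cell j z) y * H)"
      using fin by (intro integrable_mult_left integrable_real_indicator) auto
    show "indicator (cell j z) y * cmod (h y) \<le> indicator (cell j z) y * H" for y
      by (intro mult_left_mono H) auto
  qed
  also have "\<dots> = H * measure lborel (cell j z)"
    by (simp add: mult.commute)
  also have "measure lborel (cell j z) = (1 / 2 ^ j) ^ CARD('n)"
    unfolding measure_def emeasure_cell by simp
  finally show ?thesis .
qed

lemma outside_cube:
  fixes h :: "real^'n::finite \<Rightarrow> complex"
  assumes "\<And>y. d < norm (y - x) \<Longrightarrow> h y = 0" "y \<notin> cube x (2 * d)"
  shows "h y = 0"
proof (rule assms(1), rule ccontr)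
  assume "\<not> d < norm (y - x)"
  then have "\<bar>y $ i - x $ i\<bar> \<le> d" for i
    using component_le_norm_cart[of "y - x" i] by simp
  with assms(2) show False by (auto simp: cube_def)
qed

definition cell_min :: "nat \<Rightarrow> (real^'n::finite \<Rightarrow> ennreal) \<Rightarrow> real^'n \<Rightarrow> ennreal" where
  "cell_min j g y = (INF y'\<in>cell j (cell_of j y). g y')"

lemma cell_min_measurable [measurable]: "cell_min j g \<in> borel_measurable borel"
proof -
  have "cell_min j g = (\<lambda>z. INF y'\<in>cell j z. g y') \<circ> cell_of j" by (auto simp: cell_min_def)
  also have "\<dots> \<in> borel_measurable borel"
    by (rule measurable_comp[OF cell_of_measurable]) simp
  finally show ?thesis .
qed

lemma mem_cell_of: "y \<in> cell j (cell_of j y)" by (simp add: cell_def)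

lemma cell_min_le: "cell_min j g y \<le> g y"
  unfolding cell_min_def by (rule INF_lower) (rule mem_cell_of)

lemma finite_cells_meeting_cube: "finite (cell_of j ` cube (x :: real^'n::finite) D)"
proof -
  let ?F = "\<lambda>i. {\<lfloor>2 ^ j * (x $ i - D / 2)\<rfloor>..\<lfloor>2 ^ j * (x $ i + D / 2)\<rfloor>}"
  have "cell_of j ` cube x D \<subseteq> vec_lambda ` (PiE UNIV ?F)"
  proof
    fix z assume "z \<in> cell_of j ` cube x D"
    then obtain y where y: "y \<in> cube x D" "z = cell_of j y" by auto
    have "z $ i \<in> ?F i" for i
    proof -
      have "x $ i - D / 2 \<le> y $ i" "y $ i \<le> x $ i + D / 2"
        using y(1) by (auto simp: cube_cbox mem_box_cart)
      then show ?thesis unfolding y(2) cell_of_def by (simp add: floor_mono)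
    qed
    then show "z \<in> vec_lambda ` (PiE UNIV ?F)"
      by (intro image_eqI[of _ _ "vec_nth z"]) (simp_all only: vec_nth_inverse PiE_UNIV_domain, blast)
  qed
  moreover have "finite (PiE (UNIV :: 'n set) ?F)" by (intro finite_PiE) auto
  ultimately show ?thesis using finite_subset by blast
qed

section \<open>Distributions and dilations\<close>

lemma distribution_linear:
  assumes "f \<in> distributions" "\<phi> \<in> test_functions" "\<psi> \<in> test_functions"
  shows "f (\<lambda>x. a * \<phi> x + b * \<psi> x) = a * f \<phi> + b * f \<psi>"
  using assms by (simp add: distributions_def)

lemma distribution_cmult:
  assumes "f \<in> distributions" "\<phi> \<in> test_functions"
  shows "f (\<lambda>x. a * \<phi> x) = a * f \<phi>"
  using distribution_linear[OF assms assms(2), of a 0] by simp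

lemma distribution_add:
  assumes "f \<in> distributions" "\<phi> \<in> test_functions" "\<psi> \<in> test_functions"
  shows "f (\<lambda>x. \<phi> x + \<psi> x) = f \<phi> + f \<psi>"
  using distribution_linear[OF assms, of 1 1] by simp

lemma distribution_zero: "f \<in> distributions \<Longrightarrow> f (\<lambda>x. 0) = 0"
  using distribution_cmult[OF _ test_zero, of f 0] by simp

lemma distribution_sum:
  assumes f: "f \<in> distributions" and "finite I" "\<And>i. i \<in> I \<Longrightarrow> \<phi> i \<in> test_functions"
  shows "f (\<lambda>x. \<Sum>i\<in>I. \<phi> i x) = (\<Sum>i\<in>I. f (\<phi> i))"
  using assms(2,3)
  by (induction I rule: finite_induct) (simp_all add: distribution_zero[OF f] distribution_add[OF f] test_sum)

lemma nn_integral_scale: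
  assumes [measurable]: "f \<in> borel_measurable borel" and c: "0 < c"
  shows "(\<integral>\<^sup>+y. f y \<partial>lborel) = ennreal (c ^ CARD('n)) * (\<integral>\<^sup>+y. f (c *\<^sub>R (y :: real^'n::finite)) \<partial>lborel)"
proof -
  have "lborel = density (distr lborel borel (\<lambda>y::real^'n. 0 + c *\<^sub>R y)) (\<lambda>_. \<bar>c\<bar> ^ DIM(real^'n))"
    by (rule lborel_affine) (use c in simp)
  then have l: "lborel = density (distr lborel borel (\<lambda>y::real^'n. c *\<^sub>R y)) (\<lambda>_. ennreal (c ^ CARD('n)))"
    using c by simp
  show ?thesis
    by (subst l) (simp add: nn_integral_density nn_integral_distr nn_integral_cmult)
qed

lemma integral_scale:
  fixes f :: "real^'n::finite \<Rightarrow> 'b::{banach, second_countable_topology}"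
  assumes [measurable]: "f \<in> borel_measurable borel" and c: "0 < c"
  shows "(\<integral>y. f y \<partial>lborel) = c ^ CARD('n) *\<^sub>R (\<integral>y. f (c *\<^sub>R y) \<partial>lborel)"
proof -
  have "lborel = density (distr lborel borel (\<lambda>y::real^'n. 0 + c *\<^sub>R y)) (\<lambda>_. \<bar>c\<bar> ^ DIM(real^'n))"
    by (rule lborel_affine) (use c in simp)
  then have l: "lborel = density (distr lborel borel (\<lambda>y::real^'n. c *\<^sub>R y)) (\<lambda>_. ennreal (c ^ CARD('n)))"
    using c by simp
  show ?thesis
    by (subst l, subst integral_density) (use c in \<open>auto simp: integral_distr\<close>)
qed

lemma dyadic_integral:
  fixes a :: "real^'n::finite \<Rightarrow> complex"
  assumes a: "integrable lborel a"
  shows "integrable lborel (dyadic a j)" "(\<integral>y. dyadic a j y \<partial>lborel) = (\<integral>y. a y \<partial>lborel)"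
    "L1_norm (dyadic a j) = L1_norm a"
proof -
  have m [measurable]: "a \<in> borel_measurable borel" using a by auto
  have n: "(\<integral>\<^sup>+y. ennreal (cmod (dyadic a j y)) \<partial>lborel) = (\<integral>\<^sup>+y. ennreal (cmod (a y)) \<partial>lborel)"
    by (subst (2) nn_integral_scale[of _ "2 ^ j"])
       (auto simp: dyadic_def norm_mult norm_power ennreal_mult' nn_integral_cmult power_mult)
  show "integrable lborel (dyadic a j)"
    using a unfolding integrable_iff_bounded n by (auto simp: dyadic_def[abs_def])
  show "(\<integral>y. dyadic a j y \<partial>lborel) = (\<integral>y. a y \<partial>lborel)"
    using integral_scale[OF m, of "2 ^ j"]
    by (simp add: dyadic_def[abs_def] scaleR_conv_of_real[where 'a=complex] power_mult)
  show "L1_norm (dyadic a j) = L1_norm a"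
    by (subst (2) integral_scale[of _ "2 ^ j"]) (auto simp: dyadic_def norm_mult norm_power power_mult)
qed

lemma dyadic_dyadic: "dyadic (dyadic a 1) i = dyadic a (Suc i)"
  by (auto simp: dyadic_def fun_eq_iff power_add)

lemma dyadic_outside:
  assumes "\<And>y. r < norm y \<Longrightarrow> a y = 0" "r / 2 ^ j < norm y"
  shows "dyadic a j y = 0"
  using assms by (auto simp: dyadic_def divide_less_eq mult.commute)

lemma dyadic_test:
  assumes "\<rho> \<in> test_functions"
  shows "dyadic \<rho> j \<in> test_functions"
  using test_cmult[OF test_affine[OF assms, of "2 ^ j" 0], of "2 ^ (j * CARD('n))"]
  by (simp add: dyadic_def[abs_def])

lemma iter_pderiv_cmult:
  assumes "smooth f"
  shows "iter_pderiv is (\<lambda>x. a * f x) = (\<lambda>x. a * iter_pderiv is f x)"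
  using iter_pderiv_linear[OF assms assms, of "is" a 0] by simp

lemma iter_pderiv_dyadic:
  fixes \<rho> :: "real^'n::finite \<Rightarrow> complex"
  assumes "smooth \<rho>"
  shows "iter_pderiv is (dyadic \<rho> j) x = 2 ^ (j * (CARD('n) + length is)) * iter_pderiv is \<rho> (2 ^ j *\<^sub>R x)"
  using smooth_affine[OF assms, of "2 ^ j" 0] iter_pderiv_affine[OF assms, of "is" "2 ^ j" 0]
  by (simp add: dyadic_def[abs_def] iter_pderiv_cmult power_mult power_add distrib_left power_mult_distrib)

lemma grand_maximal_upper:
  fixes \<psi> :: "real^'n::finite \<Rightarrow> complex"
  assumes "0 < t" "t < 1" "\<psi> \<in> test_functions" "supp \<psi> \<subseteq> ball 0 (2 ^ (3 * (10 + CARD('n))))" "derivs_bounded N \<psi> 1"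
  shows "ennreal (cmod (conv (dilate t \<psi>) f x)) \<le> grand_maximal N f x"
  unfolding grand_maximal_def
  by (rule SUP_upper2[of "(t, \<psi>)"]) (use assms in auto)

section \<open>Distributions on bumps\<close>

text \<open>Up to the factor \<open>C L\<close> the convolution is, seen from any point \<open>x'\<close> of the cell, a function that
  the grand maximal function at \<open>x'\<close> tests.\<close>

lemma bump_estimate:
  fixes \<rho> :: "real^'n::finite \<Rightarrow> complex"
  assumes \<rho>: "\<rho> \<in> test_functions" "\<And>y. real CARD('n) < norm y \<Longrightarrow> \<rho> y = 0"
  obtains C where "0 < C" "\<And>f j z h L x'. f \<in> distributions \<Longrightarrow> integrable lborel h \<Longrightarrow> (\<And>y. y \<notin> cell j z \<Longrightarrow> h y = 0)
    \<Longrightarrow> L1_norm h \<le> L \<Longrightarrow> 0 < L \<Longrightarrow> x' \<in> cell j z \<Longrightarrow>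
    ennreal (cmod (f (convol h (dyadic \<rho> j))) / (C * L)) \<le> grand_maximal N f x'"
proof -
  obtain M where M: "0 < M" "derivs_bounded N \<rho> M" using test_derivs_bounded[OF \<rho>(1)] by blast
  show thesis
  proof (rule that[of M])
    fix f :: "'n functional" and j z and h :: "real^'n \<Rightarrow> complex" and L x'
    assume f: "f \<in> distributions" and h: "integrable lborel h" "\<And>y. y \<notin> cell j z \<Longrightarrow> h y = 0"
      and L: "L1_norm h \<le> L" "0 < L" and x': "x' \<in> cell j z"
    \<comment> \<open>Admissible scales are less than 1 and cells of level 0 have side 1; half the side is admissible
        at every level.\<close>
    define t where "t = (1 / 2 :: real) ^ Suc j"
    have t: "0 < t" "t < 1" unfolding t_def by (simp, rule power_Suc_less_one) auto
    have t2: "t * 2 ^ j = 1 / 2" by (simp add: t_def power_divide)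
    define b where "b = convol h (dyadic \<rho> j)"
    define \<psi> where "\<psi> w = of_real (t ^ CARD('n) / (M * L)) * b ((- t) *\<^sub>R w + x')" for w
    have hout: "h y = 0" if "real CARD('n) / 2 ^ j < norm (y - x')" for y
    proof -
      have "y \<notin> cell j z"
        using that norm_coord_bound[of "y - x'" "1 / 2 ^ j"] cell_close[OF _ x', of y] by force
      then show ?thesis using h by simp
    qed
    have b: "b \<in> test_functions"
      unfolding b_def by (rule convol_test_function[OF h(1) hout dyadic_test[OF \<rho>(1)]])
    have bs: "smooth b" using b by (simp add: test_functions_def)
    have bout: "b y = 0" if "2 * real CARD('n) / 2 ^ j < norm (y - x')" for y
      unfolding b_def
    proof (rule convol_outside[where u = x' and v = 0, OF hout])
      show "dyadic \<rho> j y = 0" if "real CARD('n) / 2 ^ j < norm (y - 0)" for y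
        using that by (auto simp: dyadic_def divide_less_eq mult.commute intro!: \<rho>(2))
    qed (use that in auto)
    have bd: "cmod (iter_pderiv is b x) \<le> L * (2 ^ (j * (CARD('n) + length is)) * M)" if "length is \<le> N" for "is" x
    proof -
      have "cmod (iter_pderiv is b x) \<le> L1_norm h * (2 ^ (j * (CARD('n) + length is)) * M)"
        unfolding b_def
      proof (rule convol_test_sup_bound[OF h(1) dyadic_test[OF \<rho>(1)]])
        fix x
        have "cmod (iter_pderiv is \<rho> (2 ^ j *\<^sub>R x)) \<le> M" using M that by (auto simp: derivs_bounded_def)
        then show "cmod (iter_pderiv is (dyadic \<rho> j) x) \<le> 2 ^ (j * (CARD('n) + length is)) * M"
          using \<rho>(1) by (simp add: iter_pderiv_dyadic test_functions_def norm_mult norm_power)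
      qed
      also have "\<dots> \<le> L * (2 ^ (j * (CARD('n) + length is)) * M)"
        using L M(1) by (intro mult_right_mono) auto
      finally show ?thesis .
    qed
    have \<psi>: "\<psi> \<in> test_functions"
      unfolding \<psi>_def[abs_def] using t by (intro test_cmult test_affine b) auto
    \<comment> \<open>At scale \<open>t\<close> the bump has distance at most \<open>4 n\<close> from \<open>x'\<close>; the radius in the definition of
        the grand maximal function is larger.\<close>
    have "supp \<psi> \<subseteq> cball 0 (4 * real CARD('n))"
      unfolding supp_def
    proof (rule closure_minimal, safe)
      fix w assume "\<psi> w \<noteq> 0"
      then have "b ((- t) *\<^sub>R w + x') \<noteq> 0" by (auto simp: \<psi>_def)
      then have "norm (((- t) *\<^sub>R w + x') - x') \<le> 2 * real CARD('n) / 2 ^ j" using bout by force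
      then have "t * norm w \<le> 2 * real CARD('n) / 2 ^ j" using t by simp
      then have "(t * 2 ^ j) * norm w \<le> 2 * real CARD('n)" by (simp add: field_simps)
      then show "w \<in> cball 0 (4 * real CARD('n))" by (simp add: t2)
    qed
    also have "\<dots> \<subseteq> ball 0 (2 ^ (3 * (10 + CARD('n))))"
    proof -
      have "real CARD('n) < 2 ^ CARD('n)" using less_exp[of "CARD('n)"] by (metis of_nat_less_iff of_nat_numeral of_nat_power)
      also have "(2::real) ^ CARD('n) \<le> 2 ^ (3 * CARD('n))" by (rule power_increasing) auto
      finally have A: "real CARD('n) < 2 ^ (3 * CARD('n))" .
      have "4 * a < 2 ^ 30 * b" if "a < b" "0 < b" for a b :: real using that by simp
      from this[OF A] have "4 * real CARD('n) < 2 ^ 30 * 2 ^ (3 * CARD('n))" by simp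
      also have "\<dots> = 2 ^ (3 * (10 + CARD('n)))" unfolding power_add[symmetric] by simp
      finally have A: "4 * real CARD('n) < 2 ^ (3 * (10 + CARD('n)))" .
      show ?thesis
      proof
        fix w :: "real^'n" assume "w \<in> cball 0 (4 * real CARD('n))"
        then have "norm w \<le> 4 * real CARD('n)" by simp
        from le_less_trans[OF this A] show "w \<in> ball 0 (2 ^ (3 * (10 + CARD('n))))"
          unfolding mem_ball dist_0_norm .
      qed
    qed
    finally have sp: "supp \<psi> \<subseteq> ball 0 (2 ^ (3 * (10 + CARD('n))))" .
    have "derivs_bounded N \<psi> 1"
      unfolding derivs_bounded_def
    proof (intro allI impI)
      fix "is" :: "'n list" and x assume len: "length is \<le> N"
      have "iter_pderiv is \<psi> x = of_real (t ^ CARD('n) / (M * L)) * (of_real ((- t) ^ length is) * iter_pderiv is b ((- t) *\<^sub>R x + x'))"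
        unfolding \<psi>_def[abs_def] by (subst iter_pderiv_cmult, rule smooth_affine[OF bs], subst iter_pderiv_affine[OF bs]) simp
      then have "cmod (iter_pderiv is \<psi> x) = t ^ CARD('n) / (M * L) * (t ^ length is * cmod (iter_pderiv is b ((- t) *\<^sub>R x + x')))"
        using t M(1) L(2) by (simp add: norm_mult norm_power norm_divide)
      also have "\<dots> \<le> t ^ CARD('n) / (M * L) * (t ^ length is * (L * (2 ^ (j * (CARD('n) + length is)) * M)))"
        using t M(1) L(2) by (intro mult_left_mono bd len) auto
      also have "\<dots> = (t * 2 ^ j) ^ (CARD('n) + length is)"
        using M(1) L(2) by (simp add: power_mult power_add power_mult_distrib field_simps)
      also have "\<dots> \<le> 1" unfolding t2 by (rule power_le_one) auto
      finally show "cmod (iter_pderiv is \<psi> x) \<le> 1" .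
    qed
    from grand_maximal_upper[OF t \<psi> sp this, of f x']
    have "ennreal (cmod (conv (dilate t \<psi>) f x')) \<le> grand_maximal N f x'" .
    moreover have "(\<lambda>y. dilate t \<psi> (x' - y)) = (\<lambda>y. of_real (1 / (M * L)) * b y)"
      using t by (auto simp: dilate_def \<psi>_def fun_eq_iff scaleR_diff_right)
    then have "conv (dilate t \<psi>) f x' = of_real (1 / (M * L)) * f b"
      unfolding conv_def by (simp only: distribution_cmult[OF f b])
    then have "cmod (conv (dilate t \<psi>) f x') = cmod (f b) / (M * L)"
      using M(1) L(2) by (simp add: norm_mult norm_divide)
    ultimately show "ennreal (cmod (f (convol h (dyadic \<rho> j))) / (M * L)) \<le> grand_maximal N f x'"
      by (simp add: b_def)
  qed (rule M(1))
qed

lemma convol_restrict_cells: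
  fixes h b :: "real^'n::finite \<Rightarrow> complex"
  assumes h: "integrable lborel h" "\<And>y. y \<notin> cube x D \<Longrightarrow> h y = 0" and b: "b \<in> test_functions"
  shows "convol h b = (\<lambda>u. \<Sum>z\<in>cell_of j ` cube x D. convol (\<lambda>y. indicator (cell j z) y *\<^sub>R h y) b u)"
proof
  fix u
  have int: "integrable lborel (\<lambda>y. indicator (cell j z) y *\<^sub>R h y)" for z
    by (rule integrable_mult_indicator) (use h in auto)
  have eq: "h y = (\<Sum>z\<in>cell_of j ` cube x D. indicator (cell j z) y *\<^sub>R h y)" for y
  proof (cases "y \<in> cube x D")
    case True
    have "(\<Sum>z\<in>cell_of j ` cube x D. indicator (cell j z) y *\<^sub>R h y) = (\<Sum>z\<in>{cell_of j y}. indicator (cell j z) y *\<^sub>R h y)"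
      by (rule sum.mono_neutral_right[OF finite_cells_meeting_cube]) (use True in \<open>auto simp: cell_def indicator_def\<close>)
    then show ?thesis by (simp add: cell_def)
  qed (simp add: h)
  obtain B where B: "\<And>x. cmod (b x) \<le> B" using test_bounded[OF b] by blast
  have "convol h b u = (\<integral>y. (\<Sum>z\<in>cell_of j ` cube x D. indicator (cell j z) y *\<^sub>R h y) * b (u - y) \<partial>lborel)"
    unfolding convol_def eq[symmetric] ..
  also have "\<dots> = (\<integral>y. (\<Sum>z\<in>cell_of j ` cube x D. (indicator (cell j z) y *\<^sub>R h y) * b (u - y)) \<partial>lborel)"
    by (simp add: sum_distrib_right)
  also have "\<dots> = (\<Sum>z\<in>cell_of j ` cube x D. convol (\<lambda>y. indicator (cell j z) y *\<^sub>R h y) b u)"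
    unfolding convol_def
    by (rule Bochner_Integration.integral_sum, rule convol_integrable[OF int _ B])
       (use b in \<open>auto simp: test_functions_def intro: smooth_borel\<close>)
  finally show "convol h b u = (\<Sum>z\<in>cell_of j ` cube x D. convol (\<lambda>y. indicator (cell j z) y *\<^sub>R h y) b u)" .
qed

text \<open>The integral is the sum of the \<open>q\<close>-th powers of the minima of \<open>g\<close> over the cells of level
  \<open>j\<close> in the cube, cells cut by its boundary being counted in part.  Unlike the sum over cells it
  can be integrated against a weight by Tonelli's theorem.\<close>

definition cell_sum ::
    "real \<Rightarrow> (real^'n::finite \<Rightarrow> ennreal) \<Rightarrow> nat \<Rightarrow> real^'n \<Rightarrow> real \<Rightarrow> ennreal" where
  "cell_sum q g j x t =
     ennreal (2 ^ (j * CARD('n))) * (\<integral>\<^sup>+y\<in>cube x t. epowr (cell_min j g y) q \<partial>lborel)"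

lemma sum_cell_min:
  fixes g :: "real^'n::finite \<Rightarrow> ennreal"
  assumes "0 < q"
  shows "(\<Sum>z\<in>cell_of j ` cube x D. epowr (INF y\<in>cell j z. g y) q)
    \<le> cell_sum q g j x (D + 2 / 2 ^ j)"
proof -
  have m [measurable]: "(\<lambda>y. epowr (cell_min j g y) q) \<in> borel_measurable borel"
    using measurable_comp[OF cell_min_measurable measurable_epowr[OF assms]] by (simp add: comp_def)
  have one: "ennreal (2 ^ (j * CARD('n))) * emeasure lborel (cell j (z :: int^'n)) = 1" for z
    unfolding emeasure_cell by (simp add: ennreal_mult'[symmetric] power_mult power_divide)
  have "epowr (INF y\<in>cell j z. g y) q = ennreal (2 ^ (j * CARD('n))) *
      (\<integral>\<^sup>+y. epowr (cell_min j g y) q * indicator (cell j z) y \<partial>lborel)" for z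
  proof -
    have "(\<integral>\<^sup>+y. epowr (cell_min j g y) q * indicator (cell j z) y \<partial>lborel)
        = (\<integral>\<^sup>+y. epowr (INF y\<in>cell j z. g y) q * indicator (cell j z) y \<partial>lborel)"
      by (intro nn_integral_cong) (auto simp: cell_min_def cell_def split: split_indicator)
    also have "\<dots> = epowr (INF y\<in>cell j z. g y) q * emeasure lborel (cell j z)"
      by (rule nn_integral_cmult_indicator) simp
    finally show ?thesis
      by (simp only: mult.left_commute[of "ennreal _"] one mult_1_right)
  qed
  then have "(\<Sum>z\<in>cell_of j ` cube x D. epowr (INF y\<in>cell j z. g y) q) =
     ennreal (2 ^ (j * CARD('n))) * (\<integral>\<^sup>+y. (\<Sum>z\<in>cell_of j ` cube x D. epowr (cell_min j g y) q * indicator (cell j z) y) \<partial>lborel)"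
    by (subst nn_integral_sum) (auto simp: sum_distrib_left)
  also have "\<dots> \<le> ennreal (2 ^ (j * CARD('n))) * (\<integral>\<^sup>+y\<in>cube x (D + 2 / 2 ^ j). epowr (cell_min j g y) q \<partial>lborel)"
  proof (intro mult_left_mono nn_integral_mono)
    fix y
    show "(\<Sum>z\<in>cell_of j ` cube x D. epowr (cell_min j g y) q * indicator (cell j z) y)
        \<le> epowr (cell_min j g y) q * indicator (cube x (D + 2 / 2 ^ j)) y"
    proof (cases "cell_of j y \<in> cell_of j ` cube x D")
      case True
      then obtain y0 where y0: "y0 \<in> cube x D" "cell_of j y0 = cell_of j y" by auto
      have "\<bar>y $ i - x $ i\<bar> \<le> (D + 2 / 2 ^ j) / 2" for i
      proof -
        have "\<bar>y $ i - y0 $ i\<bar> \<le> 1 / 2 ^ j"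
          using cell_close[of y j "cell_of j y" y0 i] y0 by (simp add: cell_def)
        moreover have "\<bar>y0 $ i - x $ i\<bar> \<le> D / 2" using y0 by (simp add: cube_def)
        moreover have E: "(D + 2 / 2 ^ j) / 2 = D / 2 + 1 / 2 ^ j" by (simp add: add_divide_distrib)
        ultimately show ?thesis unfolding E by linarith
      qed
      then have "y \<in> cube x (D + 2 / 2 ^ j)" by (simp add: cube_def)
      moreover have "indicator (cell j z) y = (0 :: ennreal)" if "z \<noteq> cell_of j y" for z
        using that by (simp add: cell_def)
      then have "(\<Sum>z\<in>cell_of j ` cube x D. epowr (cell_min j g y) q * indicator (cell j z) y)
          = (\<Sum>z\<in>{cell_of j y}. epowr (cell_min j g y) q * indicator (cell j z) y)"
        by (intro sum.mono_neutral_right[OF finite_cells_meeting_cube]) (use True in auto)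
      ultimately show ?thesis by (simp add: cell_def)
    next
      case False
      then have "(\<Sum>z\<in>cell_of j ` cube x D. epowr (cell_min j g y) q * indicator (cell j z) y) = 0"
        by (intro sum.neutral) (auto simp: cell_def indicator_def)
      then show ?thesis by simp
    qed
  qed simp
  finally show ?thesis by (simp only: cell_sum_def)
qed

text \<open>A distribution on a convolution at scale \<open>1 / 2 ^ j\<close> is controlled by the minima of its grand
  maximal function over the cells of level \<open>j\<close> near the support of \<open>h\<close>.\<close>

definition bump_bound :: "nat \<Rightarrow> real \<Rightarrow> real \<Rightarrow> (real^'n::finite \<Rightarrow> complex) \<Rightarrow> bool" where
  "bump_bound N q C \<rho> \<longleftrightarrow> (\<forall>f\<in>distributions. \<forall>h j L x D.
     integrable lborel h \<longrightarrow> (\<forall>y. y \<notin> cube x D \<longrightarrow> h y = 0) \<longrightarrow>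
     (\<forall>z. (\<integral>y. indicator (cell j z) y * cmod (h y) \<partial>lborel) \<le> L) \<longrightarrow> 0 < L \<longrightarrow>
     epowr (ennreal (cmod (f (convol h (dyadic \<rho> j))))) q
       \<le> ennreal (C * L powr q) * cell_sum q (grand_maximal N f) j x (D + 2 / 2 ^ j))"

lemma bump_boundD:
  assumes "bump_bound N q C \<rho>" "f \<in> distributions" "integrable lborel h"
    and "\<And>y. y \<notin> cube x D \<Longrightarrow> h y = 0"
    and "\<And>z. (\<integral>y. indicator (cell j z) y * cmod (h y) \<partial>lborel) \<le> L" "0 < L"
  shows "epowr (ennreal (cmod (f (convol h (dyadic \<rho> j))))) q
    \<le> ennreal (C * L powr q) * cell_sum q (grand_maximal N f) j x (D + 2 / 2 ^ j)"
  using assms unfolding bump_bound_def by blast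

lemma bump_bound_mono:
  assumes "bump_bound N q C \<rho>" "C \<le> C'"
  shows "bump_bound N q C' \<rho>"
  unfolding bump_bound_def
proof (intro ballI allI impI, elim bump_boundD[OF assms(1), THEN order_trans])
qed (auto intro!: mult_right_mono ennreal_leI assms(2))

text \<open>Cutting \<open>h\<close> along the cells leaves bumps to which \<open>bump_estimate\<close> applies; for \<open>q \<le> 1\<close> the
  \<open>q\<close>-th powers of their contributions add up.\<close>

lemma bump_bound_exists:
  fixes \<rho> :: "real^'n::finite \<Rightarrow> complex"
  assumes \<rho>: "\<rho> \<in> test_functions" "\<And>y. real CARD('n) < norm y \<Longrightarrow> \<rho> y = 0" and q: "0 < q" "q \<le> 1"
  shows "\<exists>C. bump_bound N q C \<rho>"
proof -
  obtain C where C: "0 < C" and bump: "\<And>f j z h L x'. f \<in> distributions \<Longrightarrow> integrable lborel h \<Longrightarrow> (\<And>y. y \<notin> cell j z \<Longrightarrow> h y = 0)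
    \<Longrightarrow> L1_norm h \<le> L \<Longrightarrow> 0 < L \<Longrightarrow> x' \<in> cell j z \<Longrightarrow>
    ennreal (cmod (f (convol h (dyadic \<rho> j))) / (C * L)) \<le> grand_maximal N f x'"
    by (rule bump_estimate[where N = N, OF \<rho>]) (auto intro: that)
  show ?thesis
    unfolding bump_bound_def
  proof (intro exI[of _ "C powr q"] ballI allI impI)
    fix f :: "'n functional" and h :: "real^'n \<Rightarrow> complex" and j L x D
    assume f: "f \<in> distributions" and h: "integrable lborel h" and "\<forall>y. y \<notin> cube x D \<longrightarrow> h y = 0"
      and hL: "\<forall>z. (\<integral>y. indicator (cell j z) y * cmod (h y) \<partial>lborel) \<le> L" and L: "0 < L"
    then have h: "integrable lborel h" "\<And>y. y \<notin> cube x D \<Longrightarrow> h y = 0" by auto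
    let ?Z = "cell_of j ` cube x D"
    let ?g = "grand_maximal N f"
    define hz where "hz z y = indicator (cell j z) y *\<^sub>R h y" for z y
    have int: "integrable lborel (hz z)" for z
      unfolding hz_def[abs_def] by (rule integrable_mult_indicator) (use h in auto)
    have tst: "convol (hz z) (dyadic \<rho> j) \<in> test_functions" for z
    proof (rule convol_test_function[OF int _ dyadic_test[OF \<rho>(1)]])
      fix y assume "real CARD('n) * \<bar>D / 2\<bar> < norm (y - x)"
      moreover have "norm (y - x) \<le> real CARD('n) * \<bar>D / 2\<bar>" if "y \<in> cube x D"
        by (rule norm_coord_bound, rule order_trans[OF _ abs_ge_self]) (use that in \<open>simp add: cube_def\<close>)
      ultimately show "hz z y = 0" using h by (auto simp: hz_def)
    qed
    have each: "ennreal (cmod (f (convol (hz z) (dyadic \<rho> j)))) \<le> ennreal (C * L) * (INF y\<in>cell j z. ?g y)" for z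
    proof -
      have "ennreal (cmod (f (convol (hz z) (dyadic \<rho> j))) / (C * L)) \<le> (INF y\<in>cell j z. ?g y)"
      proof (rule INF_greatest, rule bump[OF f int, where z = z])
        have "L1_norm (hz z) = (\<integral>y. indicator (cell j z) y * cmod (h y) \<partial>lborel)"
          by (simp add: hz_def)
        then show "L1_norm (hz z) \<le> L" using hL by simp
      qed (use L in \<open>auto simp: hz_def\<close>)
      then have "ennreal (C * L) * ennreal (cmod (f (convol (hz z) (dyadic \<rho> j))) / (C * L)) \<le> ennreal (C * L) * (INF y\<in>cell j z. ?g y)"
        by (rule mult_left_mono) simp
      then show ?thesis using C L by (simp add: ennreal_mult'[symmetric])
    qed
    have "f (convol h (dyadic \<rho> j)) = (\<Sum>z\<in>?Z. f (convol (hz z) (dyadic \<rho> j)))"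
      using convol_restrict_cells[OF h dyadic_test[OF \<rho>(1)], where j = j]
        distribution_sum[OF f finite_cells_meeting_cube[of j x D], of "\<lambda>z. convol (hz z) (dyadic \<rho> j)"] tst
      by (simp add: hz_def[abs_def])
    then have "cmod (f (convol h (dyadic \<rho> j))) \<le> (\<Sum>z\<in>?Z. cmod (f (convol (hz z) (dyadic \<rho> j))))"
      by (simp add: norm_sum)
    then have "ennreal (cmod (f (convol h (dyadic \<rho> j)))) \<le> (\<Sum>z\<in>?Z. ennreal (cmod (f (convol (hz z) (dyadic \<rho> j)))))"
      by (simp add: sum_ennreal ennreal_leI)
    also have "\<dots> \<le> (\<Sum>z\<in>?Z. ennreal (C * L) * (INF y\<in>cell j z. ?g y))"
      by (intro sum_mono each)
    finally have "epowr (ennreal (cmod (f (convol h (dyadic \<rho> j))))) q \<le> epowr (\<Sum>z\<in>?Z. ennreal (C * L) * (INF y\<in>cell j z. ?g y)) q"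
      by (rule epowr_mono[OF q(1)])
    also have "\<dots> \<le> (\<Sum>z\<in>?Z. epowr (ennreal (C * L) * (INF y\<in>cell j z. ?g y)) q)"
      by (rule epowr_sum_le[OF q finite_cells_meeting_cube])
    also have "\<dots> = ennreal ((C * L) powr q) * (\<Sum>z\<in>?Z. epowr (INF y\<in>cell j z. ?g y) q)"
      using C L q by (simp add: epowr_mult epowr_ennreal sum_distrib_left)
    also have "\<dots> \<le> ennreal ((C * L) powr q) * cell_sum q ?g j x (D + 2 / 2 ^ j)"
      by (intro mult_left_mono sum_cell_min q) simp
    finally show "epowr (ennreal (cmod (f (convol h (dyadic \<rho> j))))) q
        \<le> ennreal (C powr q * L powr q) * cell_sum q ?g j x (D + 2 / 2 ^ j)"
      using C L by (simp add: powr_mult)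
  qed
qed

section \<open>Decomposition into bumps of all finer scales\<close>

text \<open>The operator \<open>T\<^sub>l = I - S\<^sub>l\<close> with \<open>S\<^sub>l\<close> the smoothing at scale \<open>1 / 2 ^ l\<close>.  Its powers gain one factor
  \<open>1 / 2 ^ l\<close> for each bounded derivative, for any mollifier \<open>\<rho>\<close> of integral 1.\<close>

definition residual :: "(real^'n::finite \<Rightarrow> complex) \<Rightarrow> nat \<Rightarrow> (real^'n \<Rightarrow> complex) \<Rightarrow> real^'n \<Rightarrow> complex" where
  "residual \<rho> l \<phi> x = \<phi> x - convol (dyadic \<rho> l) \<phi> x"

text \<open>The sum of \<open>T\<^sub>l ^ (m - 1 - k) (g k)\<close> over \<open>k < m\<close>.\<close>

fun residual_sum :: "(real^'n::finite \<Rightarrow> complex) \<Rightarrow> nat \<Rightarrow> (nat \<Rightarrow> real^'n \<Rightarrow> complex) \<Rightarrow> nat \<Rightarrow> real^'n \<Rightarrow> complex" where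
  "residual_sum \<rho> l g 0 = (\<lambda>x. 0)"
| "residual_sum \<rho> l g (Suc m) = (\<lambda>x. residual \<rho> l (residual_sum \<rho> l g m) x + g m x)"

text \<open>Smoothing this function at scale \<open>1 / 2 ^ l\<close> gives \<open>\<phi> - T\<^sub>l ^ m \<phi>\<close>.\<close>

abbreviation start_bump :: "(real^'n::finite \<Rightarrow> complex) \<Rightarrow> nat \<Rightarrow> (real^'n \<Rightarrow> complex) \<Rightarrow> nat \<Rightarrow> real^'n \<Rightarrow> complex" where
  "start_bump \<rho> l \<phi> \<equiv> residual_sum \<rho> l (\<lambda>k. \<phi>)"

text \<open>The function to which \<open>S\<^sub>l\<^sub>+\<^sub>1 - S\<^sub>l\<close> has to be applied in order to get
  \<open>T\<^sub>l ^ m \<phi> - T\<^sub>l\<^sub>+\<^sub>1 ^ m \<phi>\<close>: a sum of products of \<open>m - 1\<close> residuals of \<open>\<phi>\<close>.\<close>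

abbreviation telescope_bump :: "(real^'n::finite \<Rightarrow> complex) \<Rightarrow> nat \<Rightarrow> (real^'n \<Rightarrow> complex) \<Rightarrow> nat \<Rightarrow> real^'n \<Rightarrow> complex" where
  "telescope_bump \<rho> l \<phi> \<equiv> residual_sum \<rho> l (\<lambda>k. (residual \<rho> (Suc l) ^^ k) \<phi>)"

definition order_bounded :: "nat \<Rightarrow> (real^'n::finite \<Rightarrow> complex) \<Rightarrow> real \<Rightarrow> bool" where
  "order_bounded k \<phi> B \<longleftrightarrow> (\<forall>is x. length is = k \<longrightarrow> cmod (iter_pderiv is \<phi> x) \<le> B)"

lemma order_bounded_mono: "order_bounded k \<phi> B \<Longrightarrow> B \<le> B' \<Longrightarrow> order_bounded k \<phi> B'"
  unfolding order_bounded_def by (intro allI impI, rule order_trans[of _ B]) auto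

lemma order_bounded_nonneg: "order_bounded k \<phi> B \<Longrightarrow> 0 \<le> B"
  unfolding order_bounded_def by (metis Ex_list_of_length norm_ge_zero order_trans)

context
  fixes \<rho> :: "real^'n::finite \<Rightarrow> complex"
  assumes \<rho>: "\<rho> \<in> test_functions" "(\<integral>y. \<rho> y \<partial>lborel) = 1" "\<And>y. 1 < norm y \<Longrightarrow> \<rho> y = 0"
begin

abbreviation (input) "R \<equiv> L1_norm \<rho>"

lemma dyadic_integrable: "integrable lborel (dyadic \<rho> l)"
  by (intro dyadic_integral test_integrable \<rho>)

lemma dyadic_out: "1 / 2 ^ l < norm (y - 0) \<Longrightarrow> dyadic \<rho> l y = 0"
  using dyadic_outside[of 1 \<rho> l y] \<rho>(3) by simp

lemma residual_test: "\<phi> \<in> test_functions \<Longrightarrow> residual \<rho> l \<phi> \<in> test_functions"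
  unfolding residual_def[abs_def]
  by (intro test_diff convol_test_function[OF dyadic_integrable dyadic_out])

lemma residual_pow_test: "\<phi> \<in> test_functions \<Longrightarrow> (residual \<rho> l ^^ m) \<phi> \<in> test_functions"
  by (induction m) (auto intro: residual_test)

lemma residual_sum_test: "(\<And>k. g k \<in> test_functions) \<Longrightarrow> residual_sum \<rho> l g m \<in> test_functions"
  by (induction m) (auto intro!: residual_test test_add test_zero)

lemma iter_pderiv_residual:
  assumes "\<phi> \<in> test_functions"
  shows "iter_pderiv is (residual \<rho> l \<phi>) = residual \<rho> l (iter_pderiv is \<phi>)"
proof -
  have "iter_pderiv is (\<lambda>x. 1 * \<phi> x + (-1) * convol (dyadic \<rho> l) \<phi> x) =
     (\<lambda>x. 1 * iter_pderiv is \<phi> x + (-1) * iter_pderiv is (convol (dyadic \<rho> l) \<phi>) x)"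
    using assms by (intro iter_pderiv_linear convol_test(1)[OF dyadic_integrable]) (auto simp: test_functions_def)
  then show ?thesis
    using convol_test(2)[OF dyadic_integrable assms] by (simp add: residual_def[abs_def])
qed

lemma residual_bound:
  assumes "\<phi> \<in> test_functions" "\<And>x. cmod (\<phi> x) \<le> B"
  shows "cmod (residual \<rho> l \<phi> x) \<le> (1 + R) * B"
proof -
  have "cmod (convol (dyadic \<rho> l) \<phi> x) \<le> R * B"
    using convol_bound[OF dyadic_integrable[of l] test_measurable[OF assms(1)] assms(2), of x]
      dyadic_integral(3)[OF test_integrable[OF \<rho>(1)]] by simp
  then have "cmod (\<phi> x - convol (dyadic \<rho> l) \<phi> x) \<le> B + R * B"
    using assms(2)[of x] norm_triangle_ineq4[of "\<phi> x" "convol (dyadic \<rho> l) \<phi> x"] by linarith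
  then show ?thesis by (simp add: residual_def algebra_simps)
qed

text \<open>As \<open>\<rho>\<close> has integral 1, the residual averages the differences \<open>\<phi> x - \<phi> (x - y)\<close> over
  \<open>norm y \<le> 1 / 2 ^ l\<close>.\<close>

lemma residual_gain:
  assumes \<phi>: "\<phi> \<in> test_functions" and B: "\<And>i x. cmod (pderiv_dir i \<phi> x) \<le> B"
  shows "cmod (residual \<rho> l \<phi> x) \<le> R * real CARD('n) / 2 ^ l * B"
proof -
  obtain M where M: "\<And>x. cmod (\<phi> x) \<le> M" using test_bounded[OF \<phi>] by blast
  have B0: "0 \<le> B" using B norm_ge_zero order_trans by blast
  have i1: "integrable lborel (\<lambda>y. dyadic \<rho> l y * \<phi> (x - y))"
    by (rule convol_integrable[OF dyadic_integrable test_measurable[OF \<phi>] M])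
  have i2: "integrable lborel (\<lambda>y. dyadic \<rho> l y * \<phi> x)"
    using dyadic_integrable by simp
  have "residual \<rho> l \<phi> x = (\<integral>y. dyadic \<rho> l y * \<phi> x - dyadic \<rho> l y * \<phi> (x - y) \<partial>lborel)"
    using dyadic_integrable[of l] dyadic_integral(2)[OF test_integrable[OF \<rho>(1)], of l] \<rho>(2)
    by (simp add: residual_def convol_def Bochner_Integration.integral_diff[OF i2 i1])
  then have "cmod (residual \<rho> l \<phi> x) \<le> (\<integral>y. cmod (dyadic \<rho> l y * \<phi> x - dyadic \<rho> l y * \<phi> (x - y)) \<partial>lborel)"
    by (simp add: integral_norm_bound)
  also have "\<dots> \<le> (\<integral>y. cmod (dyadic \<rho> l y) * (real CARD('n) * B / 2 ^ l) \<partial>lborel)"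
  proof (intro integral_mono integrable_norm Bochner_Integration.integrable_diff i1 i2)
    show "integrable lborel (\<lambda>y. cmod (dyadic \<rho> l y) * (real CARD('n) * B / 2 ^ l))"
      using dyadic_integrable by simp
    fix y
    show "cmod (dyadic \<rho> l y * \<phi> x - dyadic \<rho> l y * \<phi> (x - y)) \<le> cmod (dyadic \<rho> l y) * (real CARD('n) * B / 2 ^ l)"
    proof (cases "1 / 2 ^ l < norm y")
      case False
      have "cmod (\<phi> x - \<phi> (x - y)) \<le> real CARD('n) * B * norm (x - (x - y))"
        by (rule partials_lipschitz[of UNIV]) (use \<phi> B in \<open>auto simp: test_functions_def smooth_differentiable\<close>)
      also have "\<dots> \<le> real CARD('n) * B * (1 / 2 ^ l)"
        using False B0 by (intro mult_left_mono) auto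
      finally show ?thesis
        by (simp only: right_diff_distrib[symmetric] norm_mult, intro mult_left_mono) auto
    qed (use dyadic_out in simp)
  qed
  also have "\<dots> = R * real CARD('n) / 2 ^ l * B"
    using dyadic_integral(3)[OF test_integrable[OF \<rho>(1)], of l] by simp
  finally show ?thesis .
qed

lemma order_bounded_residual:
  assumes "\<phi> \<in> test_functions" "order_bounded (Suc k) \<phi> B"
  shows "order_bounded k (residual \<rho> l \<phi>) (R * real CARD('n) / 2 ^ l * B)"
  unfolding order_bounded_def iter_pderiv_residual[OF assms(1)]
proof (intro allI impI residual_gain test_iter_pderiv assms(1))
  fix "is" :: "'n list" and i x assume "length is = k"
  then show "cmod (pderiv_dir i (iter_pderiv is \<phi>) x) \<le> B"
    using assms(2)[unfolded order_bounded_def, rule_format, of "i # is"] by (simp add: iter_pderiv_Cons)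
qed

lemma R_nonneg: "0 \<le> R" by (rule integral_nonneg_AE) simp

lemma order_bounded_residual_pow:
  assumes "\<phi> \<in> test_functions" "order_bounded (k + m) \<phi> B"
  shows "order_bounded k ((residual \<rho> l ^^ m) \<phi>) ((R * real CARD('n) / 2 ^ l) ^ m * B)"
  using assms(2)
proof (induction m arbitrary: k)
  case (Suc m)
  then have "order_bounded (Suc k) ((residual \<rho> l ^^ m) \<phi>) ((R * real CARD('n) / 2 ^ l) ^ m * B)" by simp
  from order_bounded_residual[OF residual_pow_test[OF assms(1)] this] show ?case
    by (simp add: mult.assoc)
qed simp

lemma order_bounded_add:
  assumes "\<phi> \<in> test_functions" "\<psi> \<in> test_functions" "order_bounded k \<phi> B" "order_bounded k \<psi> B'"
  shows "order_bounded k (\<lambda>x. \<phi> x + \<psi> x) (B + B')"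
proof -
  have "iter_pderiv is (\<lambda>x. 1 * \<phi> x + 1 * \<psi> x) = (\<lambda>x. 1 * iter_pderiv is \<phi> x + 1 * iter_pderiv is \<psi> x)" for "is"
    using assms by (intro iter_pderiv_linear) (auto simp: test_functions_def)
  then show ?thesis using assms(3,4) unfolding order_bounded_def
    by (auto intro!: norm_triangle_le add_mono)
qed

text \<open>In each of the \<open>m + 1\<close> summands \<open>m\<close> residuals use up one derivative each and gain the factor
  \<open>1 / 2 ^ l\<close>.\<close>

lemma order_bounded_telescope:
  assumes "\<phi> \<in> test_functions" "order_bounded (k + m) \<phi> B"
  shows "order_bounded k (telescope_bump \<rho> l \<phi> (Suc m)) (real (Suc m) * (R * real CARD('n) / 2 ^ l) ^ m * B)"
  using assms(2)
proof (induction m arbitrary: k)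
  case 0
  have "residual \<rho> l (\<lambda>x. 0) = (\<lambda>x. 0)" by (simp add: residual_def convol_def fun_eq_iff)
  then show ?case using 0 by simp
next
  case (Suc m)
  let ?c = "R * real CARD('n) / 2 ^ l"
  have c: "0 \<le> ?c" using R_nonneg by simp
  have B: "0 \<le> B" using Suc.prems order_bounded_nonneg by blast
  have "order_bounded (Suc k) (telescope_bump \<rho> l \<phi> (Suc m)) (real (Suc m) * ?c ^ m * B)"
    by (rule Suc.IH) (use Suc.prems in simp)
  from order_bounded_residual[OF residual_sum_test[OF residual_pow_test[OF assms(1)]] this, of l]
  have 1: "order_bounded k (residual \<rho> l (telescope_bump \<rho> l \<phi> (Suc m))) (?c * (real (Suc m) * ?c ^ m * B))" .
  have "R * real CARD('n) / 2 ^ Suc l \<le> ?c" using R_nonneg by (intro divide_left_mono) auto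
  then have "(R * real CARD('n) / 2 ^ Suc l) ^ Suc m * B \<le> ?c ^ Suc m * B"
    using B R_nonneg by (intro mult_right_mono power_mono) auto
  from order_bounded_mono[OF order_bounded_residual_pow[OF assms(1) Suc.prems] this]
  have 2: "order_bounded k ((residual \<rho> (Suc l) ^^ Suc m) \<phi>) (?c ^ Suc m * B)" .
  have eq: "c * (real (Suc m) * c ^ m * B) + c ^ Suc m * B = real (Suc (Suc m)) * c ^ Suc m * B" for c
    by (simp add: algebra_simps)
  show ?case
    using order_bounded_add[OF residual_test[OF residual_sum_test[OF residual_pow_test[OF assms(1)]]] residual_pow_test[OF assms(1)] 1 2]
    unfolding eq by simp
qed

lemma start_bump_bound:
  assumes "\<phi> \<in> test_functions" "\<And>x. cmod (\<phi> x) \<le> B"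
  shows "cmod (start_bump \<rho> l \<phi> m x) \<le> (\<Sum>k<m. (1 + R) ^ k) * B"
proof (induction m arbitrary: x)
  case (Suc m)
  have "cmod (start_bump \<rho> l \<phi> (Suc m) x) \<le> (1 + R) * ((\<Sum>k<m. (1 + R) ^ k) * B) + B"
    using residual_bound[OF residual_sum_test[OF assms(1)] Suc] assms(2)
    by (auto intro!: norm_triangle_le add_mono)
  also have "\<dots> = (\<Sum>k<Suc m. (1 + R) ^ k) * B"
    by (subst sum.lessThan_Suc_shift) (simp add: algebra_simps sum_distrib_left)
  finally show ?case .
qed simp

lemma residual_out:
  assumes "\<And>y. d < norm (y - u) \<Longrightarrow> \<phi> y = 0" "d + 1 / 2 ^ l < norm (x - u)"
  shows "residual \<rho> l \<phi> x = 0"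
proof -
  have "0 < 1 / (2::real) ^ l" by simp
  then have "\<phi> x = 0" using assms by (intro assms(1)) linarith
  moreover have "convol (dyadic \<rho> l) \<phi> x = 0"
    by (rule convol_outside[where r = "1 / 2 ^ l" and u = 0 and s = d and v = u]) (use assms dyadic_out in auto)
  ultimately show ?thesis by (simp add: residual_def)
qed

lemma residual_pow_out:
  assumes "\<And>y. d < norm (y - u) \<Longrightarrow> \<phi> y = 0" "d + real m / 2 ^ l < norm (x - u)"
  shows "(residual \<rho> l ^^ m) \<phi> x = 0"
  using assms(2)
proof (induction m arbitrary: x)
  case (Suc m)
  have "d + real (Suc m) / 2 ^ l = (d + real m / 2 ^ l) + 1 / 2 ^ l" by (simp add: add_divide_distrib)
  with Suc show ?case
    by (auto simp del: of_nat_Suc intro!: residual_out[where d = "d + real m / 2 ^ l" and u = u])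
qed (use assms in simp)

lemma residual_sum_out:
  assumes g: "\<And>k y. d + real k / 2 ^ l < norm (y - u) \<Longrightarrow> g k y = 0" and x: "d + real m / 2 ^ l < norm (x - u)"
  shows "residual_sum \<rho> l g m x = 0"
  using x
proof (induction m arbitrary: x)
  case (Suc m)
  have e: "d + real (Suc m) / 2 ^ l = (d + real m / 2 ^ l) + 1 / 2 ^ l" by (simp add: add_divide_distrib)
  have "residual \<rho> l (residual_sum \<rho> l g m) x = 0"
    using Suc e by (intro residual_out[where d = "d + real m / 2 ^ l" and u = u]) auto
  moreover have "0 < 1 / (2::real) ^ l" by simp
  then have "g m x = 0" using Suc.prems e by (intro g) linarith
  ultimately show ?case by simp
qed simp

lemma start_bump_out:
  assumes "\<And>y. d < norm (y - u) \<Longrightarrow> \<phi> y = 0" "d + real m / 2 ^ l < norm (x - u)"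
  shows "start_bump \<rho> l \<phi> m x = 0"
proof (rule residual_sum_out[OF _ assms(2)])
  fix k y assume "d + real k / 2 ^ l < norm (y - u)"
  moreover have "0 \<le> real k / (2::real) ^ l" by simp
  ultimately show "\<phi> y = 0" by (intro assms(1)) linarith
qed

lemma telescope_bump_out:
  assumes "\<And>y. d < norm (y - u) \<Longrightarrow> \<phi> y = 0" "d + real m / 2 ^ l < norm (x - u)"
  shows "telescope_bump \<rho> l \<phi> m x = 0"
proof (rule residual_sum_out[OF _ assms(2)])
  fix k y assume "d + real k / 2 ^ l < norm (y - u)"
  moreover have "real k / 2 ^ Suc l \<le> real k / 2 ^ l" by (auto intro: divide_left_mono)
  ultimately have "d + real k / 2 ^ Suc l < norm (y - u)" by linarith
  then show "(residual \<rho> (Suc l) ^^ k) \<phi> y = 0" using assms(1) by (intro residual_pow_out[where d = d and u = u]) auto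
qed

lemma residual_convol:
  assumes a: "integrable lborel a" "\<And>y. r < norm (y - u) \<Longrightarrow> a y = 0" and \<phi>: "\<phi> \<in> test_functions"
  shows "residual \<rho> l (convol a \<phi>) = convol a (residual \<rho> l \<phi>)"
proof
  fix x
  obtain B where B: "\<And>x. cmod (\<phi> x) \<le> B" using test_bounded[OF \<phi>] by blast
  have t: "convol (dyadic \<rho> l) \<phi> \<in> test_functions"
    by (rule convol_test_function[OF dyadic_integrable dyadic_out \<phi>])
  obtain C where C: "\<And>x. cmod (convol (dyadic \<rho> l) \<phi> x) \<le> C" using test_bounded[OF t] by blast
  have "convol a (residual \<rho> l \<phi>) x = convol a (\<lambda>x. 1 * \<phi> x + (-1) * convol (dyadic \<rho> l) \<phi> x) x"
    by (simp add: residual_def[abs_def])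
  also have "\<dots> = 1 * convol a \<phi> x + (-1) * convol a (convol (dyadic \<rho> l) \<phi>) x"
    by (rule convol_linear_right[OF a(1) test_measurable[OF \<phi>] B test_measurable[OF t] C])
  also have "convol a (convol (dyadic \<rho> l) \<phi>) = convol (dyadic \<rho> l) (convol a \<phi>)"
    by (rule convol_left_commute[OF a(1) dyadic_integrable test_measurable[OF \<phi>] B])
  finally show "residual \<rho> l (convol a \<phi>) x = convol a (residual \<rho> l \<phi>) x"
    by (simp add: residual_def[of \<rho> l "convol a \<phi>" x])
qed

text \<open>The kernel of \<open>S\<^sub>1 - S\<^sub>0\<close>; its dilates are the kernels of \<open>S\<^sub>l\<^sub>+\<^sub>1 - S\<^sub>l\<close>.\<close>

definition step_kernel :: "real^'n \<Rightarrow> complex" where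
  "step_kernel = (\<lambda>x. dyadic \<rho> 1 x - \<rho> x)"

lemma step_kernel_test: "step_kernel \<in> test_functions"
  unfolding step_kernel_def by (intro test_diff dyadic_test \<rho>)

lemma step_kernel_out: "1 < norm y \<Longrightarrow> step_kernel y = 0"
  using dyadic_out[of 1 y] \<rho>(3)[of y] by (simp add: step_kernel_def)

lemma dyadic_step_kernel: "dyadic step_kernel l = (\<lambda>x. dyadic \<rho> (Suc l) x - dyadic \<rho> l x)"
  by (auto simp: dyadic_def step_kernel_def fun_eq_iff algebra_simps power_add)

lemma residual_linear:
  assumes "\<phi> \<in> test_functions" "\<psi> \<in> test_functions"
  shows "residual \<rho> l (\<lambda>x. a * \<phi> x + b * \<psi> x) x = a * residual \<rho> l \<phi> x + b * residual \<rho> l \<psi> x"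
proof -
  obtain B C where B: "\<And>x. cmod (\<phi> x) \<le> B" and C: "\<And>x. cmod (\<psi> x) \<le> C"
    using test_bounded assms by metis
  show ?thesis unfolding residual_def
    by (subst convol_linear_right[OF dyadic_integrable test_measurable[OF assms(1)] B test_measurable[OF assms(2)] C])
       (simp add: algebra_simps)
qed

lemma dyadic_step_integrable: "integrable lborel (dyadic step_kernel l)"
  by (intro dyadic_integral test_integrable step_kernel_test)

lemma dyadic_step_out: "1 / 2 ^ l < norm (y - 0) \<Longrightarrow> dyadic step_kernel l y = 0"
  using dyadic_outside[of 1 step_kernel l y] step_kernel_out by simp

lemma residual_diff:
  assumes "\<phi> \<in> test_functions"
  shows "residual \<rho> l \<phi> x - residual \<rho> (Suc l) \<phi> x = convol (dyadic step_kernel l) \<phi> x"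
proof -
  obtain B where B: "\<And>x. cmod (\<phi> x) \<le> B" using test_bounded[OF assms] by blast
  have "dyadic step_kernel l = (\<lambda>x. 1 * dyadic \<rho> (Suc l) x + (-1) * dyadic \<rho> l x)"
    by (simp add: dyadic_step_kernel)
  then show ?thesis
    by (simp only: convol_linear_left[OF dyadic_integrable dyadic_integrable test_measurable[OF assms] B])
       (simp add: residual_def)
qed

lemma convol_add_right:
  assumes "integrable lborel a" "\<phi> \<in> test_functions" "\<psi> \<in> test_functions"
  shows "convol a (\<lambda>x. \<phi> x + \<psi> x) x = convol a \<phi> x + convol a \<psi> x"
proof -
  obtain B C where B: "\<And>x. cmod (\<phi> x) \<le> B" and C: "\<And>x. cmod (\<psi> x) \<le> C"
    using test_bounded assms by metis
  show ?thesis
    using convol_linear_right[OF assms(1) test_measurable[OF assms(2)] B test_measurable[OF assms(3)] C, of 1 1 x] by simp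
qed

text \<open>Residuals commute with convolutions, so convolution with \<open>K\<close> turns the recursion of
  \<open>residual_sum\<close> into that of \<open>a\<close>.\<close>

lemma residual_sum_identity:
  assumes K: "integrable lborel K" "\<And>y. r < norm (y - u) \<Longrightarrow> K y = 0" and g: "\<And>k. g k \<in> test_functions"
    and a0: "a 0 = (\<lambda>x. 0)" and step: "\<And>k x. a (Suc k) x = residual \<rho> l (a k) x + convol K (g k) x"
  shows "a m = convol K (residual_sum \<rho> l g m)"
proof (induction m)
  case (Suc m)
  have t: "residual_sum \<rho> l g m \<in> test_functions" by (rule residual_sum_test[OF g])
  show ?case
    by (rule ext) (simp add: step Suc residual_convol[OF K t] convol_add_right[OF K(1) residual_test[OF t] g])
qed (simp add: a0 convol_def fun_eq_iff)

lemma telescope_identity: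
  assumes \<phi>: "\<phi> \<in> test_functions"
  shows "(\<lambda>x. (residual \<rho> l ^^ m) \<phi> x - (residual \<rho> (Suc l) ^^ m) \<phi> x) = convol (dyadic step_kernel l) (telescope_bump \<rho> l \<phi> m)"
proof (rule residual_sum_identity[OF dyadic_step_integrable _ residual_pow_test[OF \<phi>],
      where r = "1 / 2 ^ l" and u = 0 and a = "\<lambda>m x. (residual \<rho> l ^^ m) \<phi> x - (residual \<rho> (Suc l) ^^ m) \<phi> x"])
  fix k x
  let ?A = "(residual \<rho> l ^^ k) \<phi>" and ?B = "(residual \<rho> (Suc l) ^^ k) \<phi>"
  have t: "?A \<in> test_functions" "?B \<in> test_functions" using residual_pow_test \<phi> by auto
  show "(residual \<rho> l ^^ Suc k) \<phi> x - (residual \<rho> (Suc l) ^^ Suc k) \<phi> x =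
      residual \<rho> l (\<lambda>x. ?A x - ?B x) x + convol (dyadic step_kernel l) ?B x"
    using residual_linear[OF t, of l 1 "-1" x] by (simp add: residual_diff[OF t(2), symmetric])
qed (simp_all add: dyadic_step_out)

lemma start_identity:
  assumes \<phi>: "\<phi> \<in> test_functions"
  shows "(\<lambda>x. \<phi> x - (residual \<rho> l ^^ m) \<phi> x) = convol (dyadic \<rho> l) (start_bump \<rho> l \<phi> m)"
proof (rule residual_sum_identity[OF dyadic_integrable _ \<phi>,
      where r = "1 / 2 ^ l" and u = 0 and a = "\<lambda>m x. \<phi> x - (residual \<rho> l ^^ m) \<phi> x"])
  fix k x
  let ?A = "(residual \<rho> l ^^ k) \<phi>"
  show "\<phi> x - (residual \<rho> l ^^ Suc k) \<phi> x = residual \<rho> l (\<lambda>x. \<phi> x - ?A x) x + convol (dyadic \<rho> l) \<phi> x"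
    using residual_linear[OF \<phi> residual_pow_test[OF \<phi>, where l = l and m = k], of l 1 "-1" x] by (simp add: residual_def[of \<rho> l \<phi> x])
qed (simp_all add: dyadic_out)

text \<open>One residual gains the factor \<open>1 / 2 ^ l\<close> and the others are bounded operators.\<close>

lemma residual_pow_derivs:
  assumes \<phi>: "\<phi> \<in> test_functions" and B: "derivs_bounded (Suc K) \<phi> B"
  shows "derivs_bounded K ((residual \<rho> l ^^ Suc m) \<phi>) ((1 + R) ^ m * (R * real CARD('n) / 2 ^ l * B))"
proof -
  have 1: "derivs_bounded K (residual \<rho> l \<phi>) (R * real CARD('n) / 2 ^ l * B)"
    unfolding derivs_bounded_def iter_pderiv_residual[OF \<phi>]
  proof (intro allI impI residual_gain test_iter_pderiv \<phi>)
    fix "is" :: "'n list" and i x assume "length is \<le> K"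
    then show "cmod (pderiv_dir i (iter_pderiv is \<phi>) x) \<le> B"
      using B[unfolded derivs_bounded_def, rule_format, of "i # is"] by (simp add: iter_pderiv_Cons)
  qed
  have "derivs_bounded K ((residual \<rho> l ^^ m) (residual \<rho> l \<phi>)) ((1 + R) ^ m * (R * real CARD('n) / 2 ^ l * B))"
  proof (induction m)
    case (Suc m)
    let ?a = "(residual \<rho> l ^^ m) (residual \<rho> l \<phi>)"
    have t: "?a \<in> test_functions" by (intro residual_pow_test residual_test \<phi>)
    have "cmod (residual \<rho> l (iter_pderiv is ?a) x) \<le> (1 + R) * ((1 + R) ^ m * (R * real CARD('n) / 2 ^ l * B))"
      if "length is \<le> K" for "is" x
      using Suc that by (intro residual_bound test_iter_pderiv[OF t]) (auto simp: derivs_bounded_def)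
    then show ?case
      by (simp add: derivs_bounded_def iter_pderiv_residual[OF t] mult.assoc)
  qed (use 1 in simp)
  then show ?thesis by (simp add: funpow_swap1)
qed

text \<open>The powers of the residuals of \<open>\<phi>\<close> tend to 0 in the space of test functions.\<close>

lemma distribution_residual_pow_tendsto:
  assumes f: "f \<in> distributions" and \<phi>: "\<phi> \<in> test_functions"
  shows "(\<lambda>l. f ((residual \<rho> l ^^ Suc m) \<phi>)) \<longlonglongrightarrow> 0"
proof -
  obtain d where d: "\<And>y. d < norm (y - 0) \<Longrightarrow> \<phi> y = 0" using \<phi> by (auto simp: test_functions_iff)
  obtain C K where C: "\<And>\<psi> M. \<psi> \<in> test_functions \<Longrightarrow> supp \<psi> \<subseteq> cball 0 (d + real (Suc m)) \<Longrightarrow> derivs_bounded K \<psi> M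
      \<Longrightarrow> cmod (f \<psi>) \<le> C * M"
  proof -
    have "\<forall>K. compact K \<longrightarrow> (\<exists>C N. \<forall>\<phi>\<in>test_functions. \<forall>M. supp \<phi> \<subseteq> K \<longrightarrow> derivs_bounded N \<phi> M \<longrightarrow> cmod (f \<phi>) \<le> C * M)"
      using f unfolding distributions_def by (elim CollectE conjE)
    from this[rule_format, OF compact_cball[of 0 "d + real (Suc m)"]] that show ?thesis by metis
  qed
  obtain B where B: "derivs_bounded (Suc K) \<phi> B" using test_derivs_bounded[OF \<phi>] by blast
  have bnd: "cmod (f ((residual \<rho> l ^^ Suc m) \<phi>)) \<le> (C * ((1 + R) ^ m * (R * real CARD('n) * B))) * (1 / 2) ^ l" for l
  proof -
    have "supp ((residual \<rho> l ^^ Suc m) \<phi>) \<subseteq> cball 0 (d + real (Suc m))"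
      unfolding supp_def
    proof (rule closure_minimal, safe)
      fix x assume x: "(residual \<rho> l ^^ Suc m) \<phi> x \<noteq> 0"
      have "norm (x - 0) \<le> d + real (Suc m) / 2 ^ l"
      proof (rule ccontr)
        assume "\<not> norm (x - 0) \<le> d + real (Suc m) / 2 ^ l"
        then have "d + real (Suc m) / 2 ^ l < norm (x - 0)" by simp
        from residual_pow_out[OF d this] x show False by contradiction
      qed
      also have "real (Suc m) / 2 ^ l \<le> real (Suc m)" by (simp add: divide_le_eq mult_le_cancel_left1)
      finally show "x \<in> cball 0 (d + real (Suc m))" by simp
    qed
    from C[OF residual_pow_test[OF \<phi>] this residual_pow_derivs[OF \<phi> B]]
    have "cmod (f ((residual \<rho> l ^^ Suc m) \<phi>)) \<le> C * ((1 + R) ^ m * (R * real CARD('n) / 2 ^ l * B))" .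
    moreover have "c * (a * (b / 2 ^ l * d)) = c * (a * (b * d)) * (1 / 2) ^ l" for a b c d :: real
      by (simp add: power_divide)
    ultimately show ?thesis by (simp only:)
  qed
  show ?thesis
  proof (rule Lim_null_comparison)
    show "\<forall>\<^sub>F l in sequentially. cmod (f ((residual \<rho> l ^^ Suc m) \<phi>)) \<le> (C * ((1 + R) ^ m * (R * real CARD('n) * B))) * (1 / 2) ^ l"
      using bnd by simp
    show "(\<lambda>l. (C * ((1 + R) ^ m * (R * real CARD('n) * B))) * (1 / 2) ^ l) \<longlonglongrightarrow> 0"
      by (intro tendsto_mult_right_zero LIMSEQ_power_zero) simp
  qed
qed

text \<open>The first term is \<open>\<phi> - T\<^sub>i ^ (m + 1) \<phi>\<close>, and the series telescopes to \<open>T\<^sub>i ^ (m + 1) \<phi>\<close>.\<close>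

lemma distribution_telescope:
  assumes f: "f \<in> distributions" and \<phi>: "\<phi> \<in> test_functions"
  shows "ennreal (cmod (f \<phi>)) \<le> ennreal (cmod (f (convol (dyadic \<rho> i) (start_bump \<rho> i \<phi> (Suc m)))))
    + (\<Sum>k. ennreal (cmod (f (convol (dyadic step_kernel (i + k)) (telescope_bump \<rho> (i + k) \<phi> (Suc m))))))"
proof -
  let ?a = "\<lambda>l. (residual \<rho> l ^^ Suc m) \<phi>"
  let ?s = "convol (dyadic \<rho> i) (start_bump \<rho> i \<phi> (Suc m))"
  let ?b = "\<lambda>k. convol (dyadic step_kernel (i + k)) (telescope_bump \<rho> (i + k) \<phi> (Suc m))"
  have ts: "?s \<in> test_functions"
    by (intro convol_test_function[OF dyadic_integrable dyadic_out] residual_sum_test \<phi>)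
  have tb: "?b k \<in> test_functions" for k
    by (intro convol_test_function[OF dyadic_step_integrable dyadic_step_out] residual_sum_test residual_pow_test \<phi>)
  have ta: "?a l \<in> test_functions" for l by (rule residual_pow_test[OF \<phi>])
  have "?s x = \<phi> x - ?a i x" for x
    using fun_cong[OF start_identity[OF \<phi>, where l = i and m = "Suc m"]] by (rule sym)
  then have "\<phi> = (\<lambda>x. ?s x + ?a i x)" by (simp only: diff_add_cancel)
  then have fs: "f \<phi> = f ?s + f (?a i)"
    by (rule arg_cong[where f = f, THEN trans]) (rule distribution_add[OF f ts ta])
  have "?b k x = ?a (i + k) x - ?a (Suc (i + k)) x" for k x
    using fun_cong[OF telescope_identity[OF \<phi>, where l = "i + k" and m = "Suc m"]] by (rule sym)
  then have "?a (i + k) = (\<lambda>x. ?b k x + ?a (i + Suc k) x)" for k by (simp only: diff_add_cancel add_Suc_right)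
  then have fb: "f (?a (i + k)) = f (?b k) + f (?a (i + Suc k))" for k
    by (rule arg_cong[where f = f, THEN trans]) (rule distribution_add[OF f tb ta])
  have fL: "f \<phi> = f ?s + (\<Sum>k<L. f (?b k)) + f (?a (i + L))" for L
  proof (induction L)
    case (Suc L) then show ?case using fb[of L] by simp
  qed (simp add: fs)
  have le: "ennreal (cmod (f \<phi>)) \<le> ennreal (cmod (f ?s)) + (\<Sum>k. ennreal (cmod (f (?b k)))) + ennreal (cmod (f (?a (i + L))))" for L
  proof -
    have "cmod (f \<phi>) \<le> cmod (f ?s) + (\<Sum>k<L. cmod (f (?b k))) + cmod (f (?a (i + L)))"
      unfolding fL[of L] by (intro norm_triangle_le add_mono norm_sum order_refl)
    then have 1: "ennreal (cmod (f \<phi>)) \<le> ennreal (cmod (f ?s)) + (\<Sum>k<L. ennreal (cmod (f (?b k)))) + ennreal (cmod (f (?a (i + L))))"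
      by (simp add: sum_ennreal ennreal_plus[symmetric] sum_nonneg ennreal_leI del: ennreal_plus)
    have 2: "(\<Sum>k<L. ennreal (cmod (f (?b k)))) \<le> (\<Sum>k. ennreal (cmod (f (?b k))))"
      by (rule sum_le_suminf) auto
    show ?thesis by (rule order_trans[OF 1 add_mono[OF add_mono[OF order_refl 2] order_refl]])
  qed
  show ?thesis
  proof (rule ennreal_le_epsilon)
    fix e :: real assume "0 < e"
    moreover have "(\<lambda>L. f (?a (i + L))) \<longlonglongrightarrow> 0"
      using LIMSEQ_ignore_initial_segment[OF distribution_residual_pow_tendsto[OF f \<phi>, of m], of i] by (simp add: add.commute)
    ultimately obtain L where "cmod (f (?a (i + L))) < e"
      using LIMSEQ_D[of "\<lambda>L. f (?a (i + L))" 0 e] by auto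
    then have "ennreal (cmod (f (?a (i + L)))) \<le> ennreal e" by (intro ennreal_leI) simp
    then show "ennreal (cmod (f \<phi>)) \<le> ennreal (cmod (f ?s)) + (\<Sum>k. ennreal (cmod (f (?b k)))) + ennreal e"
      by (rule order_trans[OF le[of L] add_left_mono])
  qed
qed

end

section \<open>The fractional integral kernel\<close>

text \<open>The kernel is reflected because the fractional integral of a distribution is defined by
  transposing the convolution onto the test function.\<close>

definition frac_kernel :: "(real^'n::finite \<Rightarrow> complex) \<Rightarrow> real \<Rightarrow> real^'n \<Rightarrow> complex" where
  "frac_kernel \<phi>0 \<alpha> y = of_real (norm y powr (\<alpha> - real CARD('n))) * \<phi>0 (- y)"

text \<open>The part of the kernel between two consecutive cutoffs; it vanishes near the origin, and its
  dilates are the dyadic pieces of the kernel.\<close>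

definition frac_piece :: "(real^'n::finite \<Rightarrow> complex) \<Rightarrow> real \<Rightarrow> real^'n \<Rightarrow> complex" where
  "frac_piece \<phi>0 \<alpha> y = of_real (norm y powr (\<alpha> - real CARD('n))) * (\<phi>0 (- y) - \<phi>0 (- (2 *\<^sub>R y)))"

lemma loc_frac_int_convol:
  fixes \<phi>0 \<phi> :: "real^'n::finite \<Rightarrow> complex"
  assumes \<phi>0: "\<phi>0 \<in> test_functions" and \<phi>: "\<phi> \<in> test_functions"
  shows "loc_frac_int \<phi>0 \<alpha> f \<phi> = f (convol (frac_kernel \<phi>0 \<alpha>) \<phi>)"
proof -
  have [measurable]: "\<phi>0 \<in> borel_measurable borel" "\<phi> \<in> borel_measurable borel"
    using assms by (auto intro: test_measurable)
  have "(\<integral>y. \<phi>0 y / of_real (norm y powr (real CARD('n) - \<alpha>)) * \<phi> (x + y) \<partial>lborel) = convol (frac_kernel \<phi>0 \<alpha>) \<phi> x" for x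
  proof -
    have "(\<integral>y. \<phi>0 y / of_real (norm y powr (real CARD('n) - \<alpha>)) * \<phi> (x + y) \<partial>lborel)
        = (\<integral>y. \<phi>0 (0 - y) / of_real (norm (0 - y) powr (real CARD('n) - \<alpha>)) * \<phi> (x + (0 - y)) \<partial>lborel)"
      by (rule integral_reflect[symmetric]) measurable
    also have "\<dots> = convol (frac_kernel \<phi>0 \<alpha>) \<phi> x"
      unfolding convol_def frac_kernel_def
      by (rule Bochner_Integration.integral_cong)
         (auto simp: powr_minus_divide[of _ "real CARD('n) - \<alpha>", simplified] field_simps)
    finally show ?thesis .
  qed
  then show ?thesis by (simp add: loc_frac_int_def)
qed

context
  fixes \<phi>0 :: "real^'n::finite \<Rightarrow> complex" and \<alpha> :: real
  assumes \<phi>0: "\<phi>0 \<in> test_functions" "\<forall>x\<in>cube 0 1. \<phi>0 x = 1" "supp \<phi>0 \<subseteq> cube 0 2"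
    and \<alpha>: "0 < \<alpha>"
begin

lemma cutoff_out: "real CARD('n) < norm y \<Longrightarrow> \<phi>0 (- y) = 0"
proof -
  assume y: "real CARD('n) < norm y"
  have "- y \<notin> cube 0 2"
  proof
    assume "- y \<in> cube 0 2"
    then have "norm y \<le> real CARD('n) * 1" by (intro norm_coord_bound) (auto simp: cube_def)
    with y show False by simp
  qed
  then show "\<phi>0 (- y) = 0" using \<phi>0(3) supp_zero by blast
qed

lemma frac_kernel_out: "real CARD('n) < norm y \<Longrightarrow> frac_kernel \<phi>0 \<alpha> y = 0"
  by (simp add: frac_kernel_def cutoff_out)

lemma frac_piece_out: "real CARD('n) < norm y \<Longrightarrow> frac_piece \<phi>0 \<alpha> y = 0"
  using cutoff_out[of y] cutoff_out[of "2 *\<^sub>R y"] by (simp add: frac_piece_def)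

lemma frac_piece_test: "frac_piece \<phi>0 \<alpha> \<in> test_functions"
proof -
  let ?\<delta> = "\<lambda>y. \<phi>0 (- y) - \<phi>0 (- (2 *\<^sub>R y))"
  have "(\<lambda>y. \<phi>0 ((-1) *\<^sub>R y + 0)) \<in> test_functions" "(\<lambda>y. \<phi>0 ((-2) *\<^sub>R y + 0)) \<in> test_functions"
    by (intro test_affine \<phi>0; simp)+
  then have "?\<delta> \<in> test_functions" using test_diff by fastforce
  moreover have "?\<delta> y = 0" if "norm y < 1 / 4" for y
  proof -
    have c: "\<bar>y $ i\<bar> \<le> 1 / 4" for i using component_le_norm_cart[of y i] that by simp
    have "\<bar>(- y) $ i - 0 $ i\<bar> \<le> 1 / 2" "\<bar>(- (2 *\<^sub>R y)) $ i - 0 $ i\<bar> \<le> 1 / 2" for i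
      using c[of i] by (simp_all add: abs_mult)
    then have "- y \<in> cube 0 1" "- (2 *\<^sub>R y) \<in> cube 0 1"
      unfolding cube_def mem_Collect_eq by blast+
    then show ?thesis using \<phi>0(2) by simp
  qed
  ultimately have "smooth (frac_piece \<phi>0 \<alpha>)"
    unfolding frac_piece_def[abs_def]
    by (intro smooth_norm_powr_mult[of _ "1 / 4"]) (auto simp: test_functions_def)
  then show ?thesis using frac_piece_out unfolding test_functions_iff by blast
qed

lemma frac_kernel_measurable [measurable]: "frac_kernel \<phi>0 \<alpha> \<in> borel_measurable borel"
proof -
  have [measurable]: "\<phi>0 \<in> borel_measurable borel" using \<phi>0 by (auto intro: test_measurable)
  show ?thesis unfolding frac_kernel_def[abs_def] by measurable
qed

text \<open>This is the homogeneity of degree \<open>\<alpha> - n\<close> of the power.\<close>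

lemma frac_kernel_step:
  "frac_kernel \<phi>0 \<alpha> y = frac_piece \<phi>0 \<alpha> y + of_real (2 powr (- \<alpha>)) * dyadic (frac_kernel \<phi>0 \<alpha>) 1 y"
proof -
  have "(2::real) powr (- \<alpha>) * (2 ^ CARD('n) * (2 * norm y) powr (\<alpha> - real CARD('n))) = norm y powr (\<alpha> - real CARD('n))"
    by (simp add: powr_mult powr_diff powr_minus powr_realpow)
  then have "of_real (2 powr (- \<alpha>)) * (2 ^ CARD('n) * (of_real ((2 * norm y) powr (\<alpha> - real CARD('n))))) = complex_of_real (norm y powr (\<alpha> - real CARD('n)))"
    by (metis (no_types, lifting) of_real_mult of_real_numeral of_real_power)
  then show ?thesis
    by (simp add: frac_kernel_def frac_piece_def dyadic_def algebra_simps)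
qed

lemma frac_kernel_decomposition:
  "frac_kernel \<phi>0 \<alpha> y = (\<Sum>j<i. of_real (2 powr (- real j * \<alpha>)) * dyadic (frac_piece \<phi>0 \<alpha>) j y)
    + of_real (2 powr (- real i * \<alpha>)) * dyadic (frac_kernel \<phi>0 \<alpha>) i y"
proof (induction i)
  case 0 show ?case by (simp add: dyadic_def)
next
  case (Suc i)
  have "dyadic (frac_kernel \<phi>0 \<alpha>) i y = 2 ^ (i * CARD('n)) * frac_kernel \<phi>0 \<alpha> (2 ^ i *\<^sub>R y)"
    by (simp add: dyadic_def)
  also have "\<dots> = dyadic (frac_piece \<phi>0 \<alpha>) i y + of_real (2 powr (- \<alpha>)) * dyadic (dyadic (frac_kernel \<phi>0 \<alpha>) 1) i y"
    by (subst frac_kernel_step) (simp add: dyadic_def algebra_simps)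
  finally have "dyadic (frac_kernel \<phi>0 \<alpha>) i y = dyadic (frac_piece \<phi>0 \<alpha>) i y + of_real (2 powr (- \<alpha>)) * dyadic (frac_kernel \<phi>0 \<alpha>) (Suc i) y"
    unfolding dyadic_dyadic .
  moreover have "2 powr (- real i * \<alpha>) * 2 powr (- \<alpha>) = 2 powr (- real (Suc i) * \<alpha>)"
    by (simp add: powr_add[symmetric] algebra_simps)
  then have "of_real (2 powr (- real i * \<alpha>)) * of_real (2 powr (- \<alpha>)) = complex_of_real (2 powr (- real (Suc i) * \<alpha>))"
    by (metis of_real_mult)
  ultimately show ?case using Suc by (simp add: algebra_simps)
qed

text \<open>Away from the origin the kernel is the sum of its pieces; these have one and the same \<open>L\<^sup>1\<close> norm up
  to the coefficients \<open>2 powr (- j \<alpha>)\<close>, which form a geometric series.\<close>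

lemma frac_kernel_integrable: "integrable lborel (frac_kernel \<phi>0 \<alpha>)"
proof -
  let ?r = "2 powr (- \<alpha>) :: real"
  let ?\<eta> = "frac_piece \<phi>0 \<alpha>"
  have r: "0 < ?r" "?r < 1" using \<alpha> powr_less_one[of 2 "- \<alpha>"] by auto
  have rj: "2 powr (- real j * \<alpha>) = ?r ^ j" for j
    by (simp add: powr_realpow[symmetric] powr_powr mult.commute)
  have \<eta>i: "integrable lborel ?\<eta>" by (rule test_integrable[OF frac_piece_test])
  have [measurable]: "?\<eta> \<in> borel_measurable borel" using \<eta>i by auto
  have [measurable]: "dyadic ?\<eta> j \<in> borel_measurable borel" for j unfolding dyadic_def[abs_def] by measurable
  have le: "ennreal (cmod (frac_kernel \<phi>0 \<alpha> y)) \<le> (\<Sum>j. ennreal (?r ^ j * cmod (dyadic ?\<eta> j y)))" for y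
  proof (cases "y = 0")
    case False
    obtain i where i: "real CARD('n) / norm y < 2 ^ i" using real_arch_pow[of 2] by auto
    have "0 < norm y" using False by simp
    then have "real CARD('n) / 2 ^ i < norm y"
      using i by (simp add: pos_divide_less_eq mult.commute)
    then have "dyadic (frac_kernel \<phi>0 \<alpha>) i y = 0"
      by (intro dyadic_outside[OF frac_kernel_out])
    then have "cmod (frac_kernel \<phi>0 \<alpha> y) \<le> (\<Sum>j<i. ?r ^ j * cmod (dyadic ?\<eta> j y))"
      by (subst frac_kernel_decomposition[of _ i]) (auto intro!: sum_norm_le simp: norm_mult rj[simplified] norm_power)
    then have "ennreal (cmod (frac_kernel \<phi>0 \<alpha> y)) \<le> (\<Sum>j<i. ennreal (?r ^ j * cmod (dyadic ?\<eta> j y)))"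
      by (simp add: sum_ennreal ennreal_leI)
    also have "\<dots> \<le> (\<Sum>j. ennreal (?r ^ j * cmod (dyadic ?\<eta> j y)))"
      by (rule sum_le_suminf) auto
    finally show ?thesis .
  qed (simp add: frac_kernel_def)
  have "(\<integral>\<^sup>+y. ennreal (cmod (frac_kernel \<phi>0 \<alpha> y)) \<partial>lborel) \<le> (\<integral>\<^sup>+y. (\<Sum>j. ennreal (?r ^ j * cmod (dyadic ?\<eta> j y))) \<partial>lborel)"
    by (intro nn_integral_mono le)
  also have "\<dots> = (\<Sum>j. \<integral>\<^sup>+y. ennreal (?r ^ j * cmod (dyadic ?\<eta> j y)) \<partial>lborel)"
    by (rule nn_integral_suminf) measurable
  also have "\<dots> = (\<Sum>j. ennreal (?r ^ j * L1_norm ?\<eta>))"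
  proof (intro suminf_cong)
    fix j
    have "(\<integral>\<^sup>+y. ennreal (?r ^ j * cmod (dyadic ?\<eta> j y)) \<partial>lborel) = ennreal (\<integral>y. ?r ^ j * cmod (dyadic ?\<eta> j y) \<partial>lborel)"
      by (rule nn_integral_eq_integral) (use dyadic_integral(1)[OF \<eta>i] in auto)
    then show "(\<integral>\<^sup>+y. ennreal (?r ^ j * cmod (dyadic ?\<eta> j y)) \<partial>lborel) = ennreal (?r ^ j * L1_norm ?\<eta>)"
      using dyadic_integral(3)[OF \<eta>i, of j] by simp
  qed
  also have "\<dots> = ennreal (\<Sum>j. ?r ^ j * L1_norm ?\<eta>)"
    using r by (intro suminf_ennreal2 summable_mult2 summable_geometric mult_nonneg_nonneg integral_nonneg_AE) auto
  also have "\<dots> < \<infinity>" by simp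
  finally show ?thesis unfolding integrable_iff_bounded by simp
qed

lemma loc_frac_int_distribution:
  assumes f: "f \<in> distributions"
  shows "loc_frac_int \<phi>0 \<alpha> f \<in> distributions"
proof -
  let ?\<kappa> = "frac_kernel \<phi>0 \<alpha>"
  have out: "real CARD('n) < norm (y - 0) \<Longrightarrow> ?\<kappa> y = 0" for y using frac_kernel_out[of y] by simp
  have t: "convol ?\<kappa> \<phi> \<in> test_functions" if "\<phi> \<in> test_functions" for \<phi>
    by (rule convol_test_function[OF frac_kernel_integrable out that])
  show ?thesis
    unfolding distributions_def
  proof (intro CollectI conjI ballI allI impI)
    fix \<phi> \<psi> :: "real^'n \<Rightarrow> complex" and a b assume *: "\<phi> \<in> test_functions" "\<psi> \<in> test_functions"
    obtain B C where B: "\<And>x. cmod (\<phi> x) \<le> B" and C: "\<And>x. cmod (\<psi> x) \<le> C"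
      using test_bounded * by metis
    have m: "\<phi> \<in> borel_measurable borel" "\<psi> \<in> borel_measurable borel"
      using * by (auto intro: test_measurable)
    have "convol ?\<kappa> (\<lambda>x. a * \<phi> x + b * \<psi> x) = (\<lambda>x. a * convol ?\<kappa> \<phi> x + b * convol ?\<kappa> \<psi> x)"
      by (rule ext) (rule convol_linear_right[OF frac_kernel_integrable m(1) B m(2) C])
    then show "loc_frac_int \<phi>0 \<alpha> f (\<lambda>x. a * \<phi> x + b * \<psi> x) = a * loc_frac_int \<phi>0 \<alpha> f \<phi> + b * loc_frac_int \<phi>0 \<alpha> f \<psi>"
      using * by (simp add: loc_frac_int_convol[OF \<phi>0(1)] test_linear distribution_linear[OF f] t)
  next
    fix K :: "(real^'n) set" assume "compact K"
    then obtain r where r: "\<And>x. x \<in> K \<Longrightarrow> norm x \<le> r" using compact_imp_bounded bounded_iff by metis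
    have "\<forall>K. compact K \<longrightarrow> (\<exists>C N. \<forall>\<phi>\<in>test_functions. \<forall>M. supp \<phi> \<subseteq> K \<longrightarrow> derivs_bounded N \<phi> M \<longrightarrow> cmod (f \<phi>) \<le> C * M)"
      using f unfolding distributions_def by (elim CollectE conjE)
    from this[rule_format, OF compact_cball[of 0 "real CARD('n) + r"]] obtain C N
      where CN: "\<And>\<phi> M. \<phi> \<in> test_functions \<Longrightarrow> supp \<phi> \<subseteq> cball 0 (real CARD('n) + r) \<Longrightarrow> derivs_bounded N \<phi> M \<Longrightarrow> cmod (f \<phi>) \<le> C * M"
      by metis
    let ?I = "\<integral>y. cmod (?\<kappa> y) \<partial>lborel"
    have "cmod (loc_frac_int \<phi>0 \<alpha> f \<phi>) \<le> (C * ?I) * M"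
      if \<phi>: "\<phi> \<in> test_functions" and s: "supp \<phi> \<subseteq> K" and M: "derivs_bounded N \<phi> M" for \<phi> M
    proof -
      have "supp (convol ?\<kappa> \<phi>) \<subseteq> cball 0 (real CARD('n) + r)"
        unfolding supp_def
      proof (rule closure_minimal, safe)
        fix x assume x: "convol ?\<kappa> \<phi> x \<noteq> 0"
        have \<phi>out: "\<phi> y = 0" if "r < norm (y - 0)" for y
          using that s r[of y] supp_zero[of y \<phi>] by fastforce
        show "x \<in> cball 0 (real CARD('n) + r)"
        proof (rule ccontr)
          assume "x \<notin> cball 0 (real CARD('n) + r)"
          then have "real CARD('n) + r < norm (x - (0 + 0))" by simp
          from convol_outside[OF out \<phi>out this] x show False by contradiction
        qed
      qed
      moreover have "derivs_bounded N (convol ?\<kappa> \<phi>) (?I * M)"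
        using M unfolding derivs_bounded_def
        by (intro allI impI convol_test_sup_bound[OF frac_kernel_integrable \<phi>]) auto
      ultimately show ?thesis
        using CN[OF t[OF \<phi>]] \<phi> by (simp add: loc_frac_int_convol[OF \<phi>0(1)] mult.assoc)
    qed
    then show "\<exists>C N. \<forall>\<phi>\<in>test_functions. \<forall>M. supp \<phi> \<subseteq> K \<longrightarrow> derivs_bounded N \<phi> M \<longrightarrow> cmod (loc_frac_int \<phi>0 \<alpha> f \<phi>) \<le> C * M"
      by blast
  qed
qed


end

section \<open>The pointwise estimate\<close>

lemma cube_mono: "a \<le> b \<Longrightarrow> cube x a \<subseteq> cube x b"
proof -
  assume "a \<le> b"
  then have "a / 2 \<le> b / 2" by simp
  then show ?thesis unfolding cube_def by (blast intro: order_trans)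
qed

lemma cell_sum_mono: "s \<le> t \<Longrightarrow> cell_sum q g j x s \<le> cell_sum q g j x t"
  unfolding cell_sum_def
  by (intro mult_left_mono nn_integral_mono) (auto dest!: cube_mono[of s t x] split: split_indicator)

lemma dilate_reflect:
  fixes \<psi> P :: "real^'n::finite \<Rightarrow> complex" and x :: "real^'n"
  assumes t: "0 < t" and \<psi>: "\<psi> \<in> test_functions" "supp \<psi> \<subseteq> ball 0 r" "derivs_bounded N \<psi> 1"
    and P_def: "P = (\<lambda>y. dilate t \<psi> (x - y))"
  shows "P \<in> test_functions"
    and "\<And>is y. length is \<le> N \<Longrightarrow> cmod (iter_pderiv is P y) \<le> (1 / t) ^ (CARD('n) + length is)"
    and "\<And>y. r * t < norm (y - x) \<Longrightarrow> P y = 0"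
    and "L1_norm P = L1_norm \<psi>"
proof -
  have sm: "smooth \<psi>" using \<psi>(1) by (simp add: test_functions_def)
  have [measurable]: "\<psi> \<in> borel_measurable borel" using smooth_borel[OF sm] .
  have P: "P = (\<lambda>y. of_real ((1 / t) ^ CARD('n)) * \<psi> ((- (1 / t)) *\<^sub>R y + (1 / t) *\<^sub>R x))"
    by (auto simp: P_def dilate_def fun_eq_iff scaleR_diff_right power_divide divide_inverse power_inverse)
  show "P \<in> test_functions"
    unfolding P using t by (intro test_cmult test_affine \<psi>) auto
  show "cmod (iter_pderiv is P y) \<le> (1 / t) ^ (CARD('n) + length is)" if "length is \<le> N" for "is" y
  proof -
    have "iter_pderiv is P y = of_real ((1 / t) ^ CARD('n)) * (of_real ((- (1 / t)) ^ length is) *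
        iter_pderiv is \<psi> ((- (1 / t)) *\<^sub>R y + (1 / t) *\<^sub>R x))"
      unfolding P by (subst iter_pderiv_cmult, rule smooth_affine[OF sm], subst iter_pderiv_affine[OF sm]) simp
    then have "cmod (iter_pderiv is P y) = (1 / t) ^ (CARD('n) + length is) * cmod (iter_pderiv is \<psi> ((- (1 / t)) *\<^sub>R y + (1 / t) *\<^sub>R x))"
      using t by (simp add: norm_mult norm_power norm_divide power_add)
    also have "\<dots> \<le> (1 / t) ^ (CARD('n) + length is) * 1"
      using \<psi>(3) that t by (intro mult_left_mono) (auto simp: derivs_bounded_def)
    finally show ?thesis by simp
  qed
  show "P y = 0" if "r * t < norm (y - x)" for y
  proof -
    have "(- (1 / t)) *\<^sub>R y + (1 / t) *\<^sub>R x = (- (1 / t)) *\<^sub>R (y - x)" by (simp add: scaleR_diff_right)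
    then have "norm ((- (1 / t)) *\<^sub>R y + (1 / t) *\<^sub>R x) = norm (y - x) / t" using t by simp
    also have "\<dots> > r" using that t by (simp add: less_divide_eq)
    finally have "(- (1 / t)) *\<^sub>R y + (1 / t) *\<^sub>R x \<notin> ball 0 r" by simp
    then have "\<psi> ((- (1 / t)) *\<^sub>R y + (1 / t) *\<^sub>R x) = 0" using \<psi>(2) supp_zero by blast
    then show ?thesis by (simp add: P)
  qed
  have "L1_norm P = L1_norm (dilate t \<psi>)"
    unfolding P_def by (rule integral_reflect) (simp add: dilate_def[abs_def])
  also have "\<dots> = L1_norm \<psi>"
    by (subst (2) integral_scale[of _ "inverse t"])
       (use t in \<open>auto simp: dilate_def norm_mult norm_power norm_inverse power_inverse\<close>)
  finally show "L1_norm P = L1_norm \<psi>" .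
qed

lemma test_integral_le:
  fixes \<psi> :: "real^'n::finite \<Rightarrow> complex"
  assumes "\<psi> \<in> test_functions" "supp \<psi> \<subseteq> ball 0 r" "derivs_bounded N \<psi> 1" "0 < r"
  shows "L1_norm \<psi> \<le> (2 * r) ^ CARD('n)"
proof -
  have "L1_norm \<psi> \<le> (\<integral>y. indicator (cube 0 (2 * r)) (y :: real^'n) \<partial>lborel)"
  proof (rule integral_mono)
    show "integrable lborel (\<lambda>y. cmod (\<psi> y))" using test_integrable[OF assms(1)] by simp
    show "integrable lborel (indicator (cube 0 (2 * r)) :: real^'n \<Rightarrow> real)"
      using emeasure_cube[of "2 * r" "0 :: real^'n"] assms(4) by (intro integrable_real_indicator) auto
    fix y
    show "cmod (\<psi> y) \<le> indicator (cube 0 (2 * r)) y"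
    proof (cases "y \<in> cube 0 (2 * r)")
      case True
      then show ?thesis using assms(3)[unfolded derivs_bounded_def, rule_format, of "[]" y] by simp
    next
      case False
      have "\<psi> u = 0" if "r < norm (u - 0)" for u
        using that assms(2) supp_zero[of u \<psi>] by fastforce
      then have "\<psi> y = 0" by (rule outside_cube[of r 0 \<psi> y]) (use False in auto)
      then show ?thesis by simp
    qed
  qed
  also have "\<dots> = (2 * r) ^ CARD('n)"
    using emeasure_cube[of "2 * r" "0 :: real^'n"] assms(4) by (simp add: measure_def)
  finally show ?thesis .
qed

lemma dyadic_scale_exists:
  assumes "0 < t" "t < (1::real)"
  shows "\<exists>i. 1 / 2 ^ Suc i \<le> t \<and> t \<le> 1 / 2 ^ i"
proof -
  obtain k where k: "1 / t < 2 ^ k" using real_arch_pow[of 2] by auto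
  define P where "P k \<longleftrightarrow> 1 / t \<le> 2 ^ k" for k :: nat
  have ex: "P k" using k by (simp add: P_def)
  define m where "m = (LEAST k. P k)"
  have m: "P m" unfolding m_def by (rule LeastI[of P, OF ex])
  have "m \<noteq> 0" using m assms by (cases m) (auto simp: P_def divide_le_eq)
  then obtain i where i: "m = Suc i" using not0_implies_Suc by blast
  have "\<not> P i" using not_less_Least[of i P] i by (simp add: m_def)
  then show ?thesis using m assms unfolding P_def i
    by (intro exI[of _ i]) (auto simp: field_simps)
qed

lemma bump_bound_sup:
  fixes \<rho> h :: "real^'n::finite \<Rightarrow> complex"
  assumes \<rho>: "bump_bound N q C \<rho>" "\<rho> \<in> test_functions" and f: "f \<in> distributions" and h: "h \<in> test_functions"
    and H: "\<And>y. cmod (h y) \<le> H" "H * (1 / 2 ^ j) ^ CARD('n) \<le> L" "0 < L"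
    and out: "\<And>y. d < norm (y - x) \<Longrightarrow> h y = 0" "2 * d + 2 / 2 ^ j \<le> t"
  shows "epowr (ennreal (cmod (f (convol (dyadic \<rho> j) h)))) q
    \<le> ennreal (C * L powr q) * cell_sum q (grand_maximal N f) j x t"
proof -
  have "epowr (ennreal (cmod (f (convol h (dyadic \<rho> j))))) q
      \<le> ennreal (C * L powr q) * cell_sum q (grand_maximal N f) j x (2 * d + 2 / 2 ^ j)"
  proof (rule bump_boundD[OF \<rho>(1) f test_integrable[OF h] _ _ H(3)])
    show "h y = 0" if "y \<notin> cube x (2 * d)" for y
      using outside_cube[of d x h y] out(1) that by blast
    show "(\<integral>y. indicator (cell j z) y * cmod (h y) \<partial>lborel) \<le> L" for z
      by (rule order_trans[OF cell_integral_bound[OF test_integrable[OF h] H(1)] H(2)])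
  qed
  also have "\<dots> \<le> ennreal (C * L powr q) * cell_sum q (grand_maximal N f) j x t"
    by (intro mult_left_mono cell_sum_mono out) simp
  also have "convol h (dyadic \<rho> j) = convol (dyadic \<rho> j) h"
    by (rule convol_commute) (use h dyadic_test[OF \<rho>(2)] in \<open>auto intro: test_measurable\<close>)
  finally show ?thesis .
qed

text \<open>The telescoping sum turns a function with derivatives up to order \<open>m\<close> at scale \<open>1 / 2 ^ i\<close> into
  bumps of all scales \<open>1 / 2 ^ (i + k)\<close>.  At scale \<open>i + k\<close> the \<open>m\<close> residuals contribute
  \<open>2 powr (- k m)\<close> to the size of the bump and its cell \<open>2 powr (- k n)\<close> to its integral.\<close>

lemma fine_scale_estimate:
  fixes \<rho> :: "real^'n::finite \<Rightarrow> complex"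
  assumes \<rho>: "\<rho> \<in> test_functions" "(\<integral>y. \<rho> y \<partial>lborel) = 1" "\<And>y. 1 < norm y \<Longrightarrow> \<rho> y = 0"
    and q: "0 < q" "q \<le> 1" and I: "0 < I"
  obtains C where "0 < C" "\<And>(f :: 'n functional) \<Psi> i x. f \<in> distributions \<Longrightarrow> \<Psi> \<in> test_functions \<Longrightarrow>
    (\<And>y. cmod (\<Psi> y) \<le> I * (2 ^ i) ^ CARD('n)) \<Longrightarrow> order_bounded m \<Psi> (I * (2 ^ i) ^ (CARD('n) + m)) \<Longrightarrow>
    (\<And>y. d / 2 ^ i < norm (y - x) \<Longrightarrow> \<Psi> y = 0) \<Longrightarrow>
    epowr (ennreal (cmod (f \<Psi>))) q \<le> ennreal C * (\<Sum>k. ennreal (2 powr (- real k * (real (CARD('n) + m) * q)))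
      * cell_sum q (grand_maximal N f) (i + k) x ((2 * (d + real (Suc m)) + 2) / 2 ^ i))"
proof -
  let ?n = "CARD('n)"
  let ?sk = "step_kernel \<rho>"
  let ?R = "L1_norm \<rho>"
  define K where "K = 2 * (d + real (Suc m)) + 2"
  have out1: "\<rho> y = 0" "?sk y = 0" if "real ?n < norm y" for y
  proof -
    have "1 \<le> real ?n" by (simp add: Suc_le_eq)
    then show "\<rho> y = 0" "?sk y = 0" using that \<rho>(3)[of y] step_kernel_out[OF \<rho>, of y] by linarith+
  qed
  have sk: "?sk \<in> test_functions" by (rule step_kernel_test[OF \<rho>])
  obtain C1 C2 where b: "bump_bound N q C1 \<rho>" "bump_bound N q C2 ?sk"
    using bump_bound_exists[OF \<rho>(1) out1(1) q, of N] bump_bound_exists[OF sk out1(2) q, of N] by blast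
  define B where "B = max 1 (max C1 C2)"
  have B: "1 \<le> B" "bump_bound N q B \<rho>" "bump_bound N q B ?sk"
    by (auto simp: B_def intro: bump_bound_mono[OF b(1)] bump_bound_mono[OF b(2)])
  have R: "0 \<le> ?R" by (rule integral_nonneg_AE) simp
  have R1: "0 < 1 + ?R" using R by linarith
  have R2: "0 < ?R * real ?n + 1" using R by (intro add_nonneg_pos mult_nonneg_nonneg) auto
  define L1 where "L1 = (\<Sum>k<Suc m. (1 + ?R) ^ k) * I"
  have L1: "0 < L1" unfolding L1_def using I R1 by (intro mult_pos_pos sum_pos zero_less_power) auto
  define L2 where "L2 = real (Suc m) * (?R * real ?n + 1) ^ m * I"
  have L2: "0 < L2" unfolding L2_def using I R2 by (intro mult_pos_pos zero_less_power) auto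
  define C where "C = B * L1 powr q + B * L2 powr q"
  have C: "0 < C" using B L1 L2 by (simp add: C_def add_pos_pos)
  have claim: "epowr (ennreal (cmod (f \<Psi>))) q \<le> ennreal C * (\<Sum>k. ennreal (2 powr (- real k * (real (?n + m) * q)))
      * cell_sum q (grand_maximal N f) (i + k) x (K / 2 ^ i))"
    if f: "f \<in> distributions" and \<Psi>: "\<Psi> \<in> test_functions" "\<And>y. cmod (\<Psi> y) \<le> I * (2 ^ i) ^ ?n"
      "order_bounded m \<Psi> (I * (2 ^ i) ^ (?n + m))" "\<And>y. d / 2 ^ i < norm (y - x) \<Longrightarrow> \<Psi> y = 0"
    for f :: "'n functional" and \<Psi> i x
  proof -
    let ?G = "\<lambda>k. cell_sum q (grand_maximal N f) (i + k) x (K / 2 ^ i)"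
    let ?w = "\<lambda>k. 2 powr (- real k * (real (?n + m) * q))"
    let ?s = "start_bump \<rho> i \<Psi> (Suc m)"
    let ?h = "\<lambda>k. telescope_bump \<rho> (i + k) \<Psi> (Suc m)"
    let ?S = "\<Sum>k. ennreal (?w k) * ?G k"
    have lk: "1 / 2 ^ (i + k) \<le> (1 / 2 ^ i :: real)" for k
      by (intro divide_left_mono power_increasing) auto
    have start: "epowr (ennreal (cmod (f (convol (dyadic \<rho> i) ?s)))) q \<le> ennreal (B * L1 powr q) * ?G 0"
      unfolding add_0_right
    proof (rule bump_bound_sup[OF B(2) \<rho>(1) f])
      show "?s \<in> test_functions" by (rule residual_sum_test[OF \<rho> \<Psi>(1)])
      show "cmod (?s y) \<le> (\<Sum>k<Suc m. (1 + ?R) ^ k) * (I * (2 ^ i) ^ ?n)" for y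
        by (rule start_bump_bound[OF \<rho> \<Psi>(1,2)])
      show "(\<Sum>k<Suc m. (1 + ?R) ^ k) * (I * (2 ^ i) ^ ?n) * (1 / 2 ^ i) ^ ?n \<le> L1"
        by (simp add: L1_def power_divide)
      show "?s y = 0" if "(d + real (Suc m)) / 2 ^ i < norm (y - x)" for y
        by (rule start_bump_out[OF \<rho> \<Psi>(4)]) (use that in \<open>simp_all add: add_divide_distrib\<close>)
      show "2 * ((d + real (Suc m)) / 2 ^ i) + 2 / 2 ^ i \<le> K / 2 ^ i"
        by (simp add: K_def add_divide_distrib)
    qed (rule L1)
    have fine: "epowr (ennreal (cmod (f (convol (dyadic ?sk (i + k)) (?h k))))) q \<le> ennreal (B * L2 powr q) * (ennreal (?w k) * ?G k)" for k
    proof -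
      define L where "L = L2 * 2 powr (- real k * real (?n + m))"
      have "epowr (ennreal (cmod (f (convol (dyadic ?sk (i + k)) (?h k))))) q \<le> ennreal (B * L powr q) * ?G k"
      proof (rule bump_bound_sup[OF B(3) sk f])
        show "?h k \<in> test_functions" by (rule residual_sum_test[OF \<rho> residual_pow_test[OF \<rho> \<Psi>(1)]])
        show "cmod (?h k y) \<le> real (Suc m) * (?R * real ?n / 2 ^ (i + k)) ^ m * (I * (2 ^ i) ^ (?n + m))" for y
          using order_bounded_telescope[OF \<rho> \<Psi>(1), of 0] \<Psi>(3) unfolding order_bounded_def by force
        have "real (Suc m) * (?R * real ?n / 2 ^ (i + k)) ^ m * (I * (2 ^ i) ^ (?n + m)) * (1 / 2 ^ (i + k)) ^ ?n
            = (real (Suc m) * (?R * real ?n) ^ m * I) * (2 ^ i / 2 ^ (i + k)) ^ (?n + m)"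
          by (simp add: power_mult_distrib power_divide power_add mult_ac)
        also have "(2::real) ^ i / 2 ^ (i + k) = 2 powr (- real k)"
          by (simp add: power_add powr_minus powr_realpow divide_inverse)
        also have "(2 powr (- real k)) ^ (?n + m) = 2 powr (- real k * real (?n + m))"
          by (simp add: powr_realpow[symmetric] powr_powr)
        also have "(real (Suc m) * (?R * real ?n) ^ m * I) * 2 powr (- real k * real (?n + m)) \<le> L"
          unfolding L_def L2_def using R I by (intro mult_right_mono mult_left_mono power_mono) auto
        finally show "real (Suc m) * (?R * real ?n / 2 ^ (i + k)) ^ m * (I * (2 ^ i) ^ (?n + m)) * (1 / 2 ^ (i + k)) ^ ?n \<le> L" .
        show "0 < L" using L2 by (simp add: L_def)
        show "?h k y = 0" if y: "(d + real (Suc m)) / 2 ^ i < norm (y - x)" for y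
        proof (rule telescope_bump_out[OF \<rho> \<Psi>(4)])
          have "d / 2 ^ i + real (Suc m) / 2 ^ (i + k) \<le> d / 2 ^ i + real (Suc m) / 2 ^ i"
            by (intro add_left_mono divide_left_mono power_increasing) auto
          also have "\<dots> = (d + real (Suc m)) / 2 ^ i" by (simp add: add_divide_distrib)
          finally show "d / 2 ^ i + real (Suc m) / 2 ^ (i + k) < norm (y - x)" using y by simp
        qed
        have "2 * ((d + real (Suc m)) / 2 ^ i) + 2 / 2 ^ (i + k) \<le> 2 * ((d + real (Suc m)) / 2 ^ i) + 2 / 2 ^ i" using lk[of k] by simp
        also have "\<dots> = K / 2 ^ i" by (simp add: K_def add_divide_distrib)
        finally show "2 * ((d + real (Suc m)) / 2 ^ i) + 2 / 2 ^ (i + k) \<le> K / 2 ^ i" .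
      qed
      also have "L powr q = L2 powr q * ?w k" using L2 by (simp add: L_def powr_mult powr_powr mult.assoc)
      also have "ennreal (B * (L2 powr q * ?w k)) * ?G k = ennreal (B * L2 powr q) * (ennreal (?w k) * ?G k)"
        using B by (simp add: ennreal_mult' mult.assoc)
      finally show ?thesis .
    qed
    have "epowr (ennreal (cmod (f \<Psi>))) q \<le> epowr (ennreal (cmod (f (convol (dyadic \<rho> i) ?s)))
        + (\<Sum>k. ennreal (cmod (f (convol (dyadic ?sk (i + k)) (?h k)))))) q"
      by (rule epowr_mono[OF q(1) distribution_telescope[OF \<rho> f \<Psi>(1)]])
    also have "\<dots> \<le> epowr (ennreal (cmod (f (convol (dyadic \<rho> i) ?s)))) q
        + (\<Sum>k. epowr (ennreal (cmod (f (convol (dyadic ?sk (i + k)) (?h k))))) q)"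
      by (rule order_trans[OF epowr_add_le[OF q] add_left_mono[OF epowr_suminf_le[OF q]]])
    also have "\<dots> \<le> ennreal (B * L1 powr q) * ?G 0 + (\<Sum>k. ennreal (B * L2 powr q) * (ennreal (?w k) * ?G k))"
      by (intro add_mono suminf_le start fine) auto
    also have "\<dots> \<le> ennreal (B * L1 powr q) * ?S + ennreal (B * L2 powr q) * ?S"
    proof -
      have "?G 0 \<le> ?S" using sum_le_suminf[of "\<lambda>k. ennreal (?w k) * ?G k" "{0}"] by simp
      then show ?thesis by (simp add: add_right_mono mult_left_mono)
    qed
    also have "\<dots> = ennreal C * ?S" using B by (simp add: C_def distrib_right)
    finally show ?thesis .
  qed
  show thesis by (rule that[OF C]) (fold K_def, rule claim, auto)
qed

text \<open>The inner sum bounds the pairings at the scale \<open>1 / 2 ^ i\<close>.  The outer sum dominates the supremum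
  over the scales; the factor \<open>2 powr (- i a)\<close>, which stems from the fractional kernel, keeps it small.\<close>

definition scale_sum :: "real \<Rightarrow> real \<Rightarrow> real \<Rightarrow> real \<Rightarrow> (real^'n::finite \<Rightarrow> ennreal) \<Rightarrow> real^'n \<Rightarrow> ennreal" where
  "scale_sum a b q K g x =
     (\<Sum>i. \<Sum>k. ennreal (2 powr (- real i * a - real k * b)) * cell_sum q g (i + k) x (K / 2 ^ i))"

text \<open>Let \<open>\<psi>\<close> be tested at scale \<open>t \<approx> 1 / 2 ^ i\<close>.  The kernel is the sum of its smooth pieces of the
  scales \<open>j < i\<close>, which only see the integral of \<open>\<psi>\<close>, and of the whole kernel shrunk to scale \<open>i\<close>.
  Convolution with the latter preserves the bounds on the \<open>N'\<close> derivatives of \<open>\<psi>\<close>, and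
  \<open>fine_scale_estimate\<close> applies.\<close>

lemma pointwise_estimate:
  fixes \<phi>0 \<rho> :: "real^'n::finite \<Rightarrow> complex"
  assumes \<phi>0: "\<phi>0 \<in> test_functions" "\<forall>x\<in>cube 0 1. \<phi>0 x = 1" "supp \<phi>0 \<subseteq> cube 0 2"
    and \<alpha>: "0 < \<alpha>" and q: "0 < q" "q \<le> 1"
    and \<rho>: "\<rho> \<in> test_functions" "(\<integral>y. \<rho> y \<partial>lborel) = 1" "\<And>y. 1 < norm y \<Longrightarrow> \<rho> y = 0"
  shows "\<exists>C K. 0 < C \<and> 0 < K \<and> (\<forall>f\<in>distributions. \<forall>x.
      epowr (grand_maximal N' (loc_frac_int \<phi>0 \<alpha> f) x) q
      \<le> ennreal C * scale_sum (\<alpha> * q) (real (CARD('n) + N') * q) q K (grand_maximal N f) x)"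
proof -
  let ?n = "CARD('n)"
  let ?\<kappa> = "frac_kernel \<phi>0 \<alpha>"
  let ?\<eta> = "frac_piece \<phi>0 \<alpha>"
  define r where "r = (2::real) ^ (3 * (10 + ?n))"
  have r: "0 < r" by (simp add: r_def)
  have \<eta>: "?\<eta> \<in> test_functions" by (rule frac_piece_test[OF \<phi>0 \<alpha>])
  obtain C0 where "bump_bound N q C0 ?\<eta>"
    using bump_bound_exists[OF \<eta> frac_piece_out[OF \<phi>0 \<alpha>] q] by blast
  then have B: "bump_bound N q (max C0 1) ?\<eta>" by (rule bump_bound_mono) simp
  define I where "I = (L1_norm ?\<kappa> + 1) * 2 ^ (?n + N')"
  have \<kappa>0: "0 \<le> L1_norm ?\<kappa>" by (rule integral_nonneg_AE) simp
  then have I: "0 < I" unfolding I_def by (intro mult_pos_pos add_nonneg_pos) auto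
  define d where "d = real ?n + r"
  define K where "K = 2 * (d + real (Suc N')) + 2"
  have K: "0 < K" using r by (simp add: K_def d_def)
  obtain C1 where C1: "0 < C1" and fine: "\<And>(f :: 'n functional) \<Psi> i x. f \<in> distributions \<Longrightarrow> \<Psi> \<in> test_functions \<Longrightarrow>
    (\<And>y. cmod (\<Psi> y) \<le> I * (2 ^ i) ^ ?n) \<Longrightarrow> order_bounded N' \<Psi> (I * (2 ^ i) ^ (?n + N')) \<Longrightarrow>
    (\<And>y. d / 2 ^ i < norm (y - x) \<Longrightarrow> \<Psi> y = 0) \<Longrightarrow>
    epowr (ennreal (cmod (f \<Psi>))) q \<le> ennreal C1 * (\<Sum>k. ennreal (2 powr (- real k * (real (?n + N') * q)))
      * cell_sum q (grand_maximal N f) (i + k) x (K / 2 ^ i))"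
    unfolding K_def by (rule fine_scale_estimate[OF \<rho> q I, where m = N' and d = d and N = N]) (auto intro: that)
  define V where "V = (2 * r) ^ ?n"
  have V: "0 < V" using r by (simp add: V_def)
  define C where "C = max (max C0 1 * V powr q) C1"
  have C: "0 < C" using C1 by (simp add: C_def)
  have main: "epowr (ennreal (cmod (conv (dilate t \<psi>) (loc_frac_int \<phi>0 \<alpha> f) x))) q
      \<le> ennreal (2 * C) * scale_sum (\<alpha> * q) (real (?n + N') * q) q K (grand_maximal N f) x"
    if f: "f \<in> distributions" and t: "0 < t" "t < 1" and \<psi>: "\<psi> \<in> test_functions" "supp \<psi> \<subseteq> ball 0 r" "derivs_bounded N' \<psi> 1"
    for f :: "'n functional" and x t \<psi>
  proof -
    let ?G = "\<lambda>i j. cell_sum q (grand_maximal N f) j x (K / 2 ^ i)"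
    let ?T = "\<lambda>i k. ennreal (2 powr (- real i * (\<alpha> * q) - real k * (real (?n + N') * q))) * ?G i (i + k)"
    define P where "P = (\<lambda>y. dilate t \<psi> (x - y))"
    note P = dilate_reflect[OF t(1) \<psi> P_def]
    let ?F = "\<lambda>j. ennreal (cmod (f (convol P (dyadic ?\<eta> j))))"
    have Pi: "integrable lborel P" by (rule test_integrable[OF P(1)])
    have Pm: "P \<in> borel_measurable borel" using P(1) by (auto intro: test_measurable)
    obtain PB where PB: "\<And>y. cmod (P y) \<le> PB" using test_bounded[OF P(1)] by blast
    obtain i where i: "1 / 2 ^ Suc i \<le> t" "t \<le> 1 / 2 ^ i" using dyadic_scale_exists[OF t] by blast
    have ti: "1 / t \<le> 2 * 2 ^ i" using i(1) t by (simp add: field_simps)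
    define c where "c j = 2 powr (- real j * \<alpha>)" for j
    have c: "0 < c j" for j by (simp add: c_def)
    have cq: "ennreal (c j powr q) * ennreal (2 powr (- real k * b)) = ennreal (2 powr (- real j * (\<alpha> * q) - real k * b))" for j k b
      unfolding c_def powr_powr by (simp add: ennreal_mult'[symmetric] powr_add[symmetric] mult.assoc)
    have \<kappa>i: "integrable lborel ?\<kappa>" by (rule frac_kernel_integrable[OF \<phi>0 \<alpha>])
    have \<kappa>di: "integrable lborel (dyadic ?\<kappa> i)" by (rule dyadic_integral[OF \<kappa>i])
    have \<kappa>dout: "dyadic ?\<kappa> i y = 0" if "real ?n / 2 ^ i < norm (y - 0)" for y
      using dyadic_outside[OF frac_kernel_out[OF \<phi>0 \<alpha>], where j = i and y = y] that by simp
    have \<eta>t: "dyadic ?\<eta> j \<in> test_functions" for j by (rule dyadic_test[OF \<eta>])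
    have \<eta>m: "dyadic ?\<eta> j \<in> borel_measurable borel" for j using \<eta>t by (auto intro: test_measurable)
    define \<Psi> where "\<Psi> = convol (dyadic ?\<kappa> i) P"
    have \<Psi>t: "\<Psi> \<in> test_functions" unfolding \<Psi>_def by (rule convol_test_function[OF \<kappa>di \<kappa>dout P(1)])
    have \<Psi>b: "cmod (iter_pderiv is \<Psi> y) \<le> I * (2 ^ i) ^ (?n + length is)" if len: "length is \<le> N'" for "is" y
    proof -
      have "cmod (iter_pderiv is \<Psi> y) \<le> L1_norm (dyadic ?\<kappa> i) * (2 * 2 ^ i) ^ (?n + length is)"
        unfolding \<Psi>_def
      proof (rule convol_test_sup_bound[OF \<kappa>di P(1)])
        fix y
        have "cmod (iter_pderiv is P y) \<le> (1 / t) ^ (?n + length is)" by (rule P(2)[OF len])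
        also have "\<dots> \<le> (2 * 2 ^ i) ^ (?n + length is)" using ti t by (intro power_mono) auto
        finally show "cmod (iter_pderiv is P y) \<le> (2 * 2 ^ i) ^ (?n + length is)" .
      qed
      also have "\<dots> = (L1_norm ?\<kappa> * 2 ^ (?n + length is)) * (2 ^ i) ^ (?n + length is)"
        unfolding dyadic_integral(3)[OF \<kappa>i] by (simp add: power_mult_distrib)
      also have "\<dots> \<le> I * (2 ^ i) ^ (?n + length is)"
        unfolding I_def using \<kappa>0 len by (intro mult_right_mono mult_mono power_increasing) auto
      finally show ?thesis .
    qed
    have \<Psi>0: "cmod (\<Psi> y) \<le> I * (2 ^ i) ^ ?n" for y
    proof -
      have "length ([] :: 'n list) \<le> N'" by simp
      from \<Psi>b[OF this, of y] show ?thesis by (simp only: iter_pderiv_Nil list.size(3) add_0_right)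
    qed
    have Pout: "P y = 0" if "r / 2 ^ j < norm (y - x)" "j \<le> i" for y j
    proof (rule P(3))
      have "r * t \<le> r * (1 / 2 ^ i)" using i(2) r by (intro mult_left_mono) auto
      also have "\<dots> \<le> r * (1 / 2 ^ j)" using that(2) r by (intro mult_left_mono divide_left_mono power_increasing) auto
      finally show "r * t < norm (y - x)" using that(1) by simp
    qed
    have \<Psi>out: "\<Psi> y = 0" if "d / 2 ^ i < norm (y - x)" for y
      unfolding \<Psi>_def
      by (rule convol_outside[where u = 0 and v = x, OF \<kappa>dout Pout[of i]]) (use that in \<open>auto simp: d_def add_divide_distrib\<close>)
    \<comment> \<open>the tested function as bumps of the scales \<open>j < i\<close> and the remainder \<open>\<Psi>\<close>\<close>
    have dec: "convol ?\<kappa> P = (\<lambda>y. (\<Sum>j<i. of_real (c j) * convol P (dyadic ?\<eta> j) y) + of_real (c i) * \<Psi> y)"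
    proof
      fix y
      have ie: "integrable lborel (\<lambda>u. dyadic ?\<eta> j u * P (y - u))" for j
        by (rule convol_integrable[OF test_integrable[OF \<eta>t] Pm PB])
      have ik: "integrable lborel (\<lambda>u. dyadic ?\<kappa> i u * P (y - u))"
        by (rule convol_integrable[OF \<kappa>di Pm PB])
      have "?\<kappa> u * P (y - u) = (\<Sum>j<i. of_real (c j) * (dyadic ?\<eta> j u * P (y - u))) + of_real (c i) * (dyadic ?\<kappa> i u * P (y - u))" for u
        by (subst frac_kernel_decomposition[OF \<phi>0 \<alpha>, of _ i]) (simp add: c_def algebra_simps sum_distrib_left)
      then have "convol ?\<kappa> P y = (\<integral>u. (\<Sum>j<i. of_real (c j) * (dyadic ?\<eta> j u * P (y - u))) + of_real (c i) * (dyadic ?\<kappa> i u * P (y - u)) \<partial>lborel)"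
        by (simp add: convol_def)
      also have "\<dots> = (\<Sum>j<i. of_real (c j) * convol (dyadic ?\<eta> j) P y) + of_real (c i) * \<Psi> y"
        unfolding \<Psi>_def convol_def
        by (subst Bochner_Integration.integral_add, intro Bochner_Integration.integrable_sum integrable_mult_right ie,
            intro integrable_mult_right ik, subst Bochner_Integration.integral_sum, intro integrable_mult_right ie, simp)
      finally show "convol ?\<kappa> P y = (\<Sum>j<i. of_real (c j) * convol P (dyadic ?\<eta> j) y) + of_real (c i) * \<Psi> y"
        unfolding convol_commute[OF \<eta>m Pm] .
    qed
    have Pet: "convol P (dyadic ?\<eta> j) \<in> test_functions" for j
      by (rule convol_test_function[OF Pi Pout[of 0] \<eta>t]) auto
    have "conv (dilate t \<psi>) (loc_frac_int \<phi>0 \<alpha> f) x = f (convol ?\<kappa> P)"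
      using loc_frac_int_convol[OF \<phi>0(1) P(1)] by (simp add: conv_def P_def)
    also have "\<dots> = (\<Sum>j<i. of_real (c j) * f (convol P (dyadic ?\<eta> j))) + of_real (c i) * f \<Psi>"
      unfolding dec
      by (subst distribution_add[OF f], intro test_sum test_cmult Pet, simp, intro test_cmult \<Psi>t,
          subst distribution_sum[OF f], simp, intro test_cmult Pet, simp add: distribution_cmult[OF f] Pet \<Psi>t)
    also have "cmod \<dots> \<le> (\<Sum>j<i. c j * cmod (f (convol P (dyadic ?\<eta> j)))) + c i * cmod (f \<Psi>)"
      using c by (intro norm_triangle_le add_mono sum_norm_le) (auto simp: norm_mult less_imp_le)
    finally have "ennreal (cmod (conv (dilate t \<psi>) (loc_frac_int \<phi>0 \<alpha> f) x))
        \<le> (\<Sum>j<i. ennreal (c j) * ?F j) + ennreal (c i) * ennreal (cmod (f \<Psi>))"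
      using c by (simp add: sum_ennreal ennreal_plus[symmetric] ennreal_mult'[symmetric] sum_nonneg ennreal_leI less_imp_le del: ennreal_plus)
    from epowr_mono[OF q(1) this]
    have "epowr (ennreal (cmod (conv (dilate t \<psi>) (loc_frac_int \<phi>0 \<alpha> f) x))) q
        \<le> epowr ((\<Sum>j<i. ennreal (c j) * ?F j) + ennreal (c i) * ennreal (cmod (f \<Psi>))) q" .
    also have "\<dots> \<le> (\<Sum>j<i. epowr (ennreal (c j) * ?F j) q) + epowr (ennreal (c i) * ennreal (cmod (f \<Psi>))) q"
      by (rule order_trans[OF epowr_add_le[OF q] add_right_mono[OF epowr_sum_le[OF q]]]) simp
    also have "\<dots> = (\<Sum>j<i. ennreal (c j powr q) * epowr (?F j) q) + ennreal (c i powr q) * epowr (ennreal (cmod (f \<Psi>))) q"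
      using c q by (simp add: epowr_mult epowr_ennreal less_imp_le)
    also have "\<dots> \<le> (\<Sum>j<i. ennreal C * ?T j 0) + ennreal C * (\<Sum>k. ?T i k)"
    proof (intro add_mono sum_mono)
      fix j assume j: "j \<in> {..<i}"
      have "epowr (?F j) q \<le> ennreal (max C0 1 * V powr q) * cell_sum q (grand_maximal N f) j x (2 * (r / 2 ^ j) + 2 / 2 ^ j)"
      proof (rule bump_boundD[OF B f Pi])
        show "P y = 0" if "y \<notin> cube x (2 * (r / 2 ^ j))" for y
          using outside_cube[of "r / 2 ^ j" x P y] Pout[of j] that j by auto
        fix z
        have "(\<integral>y. indicator (cell j z) y * cmod (P y) \<partial>lborel) \<le> L1_norm P"
          using integrable_mult_indicator[of "cell j z" lborel "\<lambda>y. cmod (P y)"] Pi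
          by (intro integral_mono) (auto split: split_indicator)
        also have "\<dots> \<le> V"
          unfolding P(4) V_def by (rule test_integral_le[OF \<psi> r])
        finally show "(\<integral>y. indicator (cell j z) y * cmod (P y) \<partial>lborel) \<le> V" .
      qed (rule V)
      also have "\<dots> \<le> ennreal C * ?G j j"
      proof (rule mult_mono[OF ennreal_leI cell_sum_mono])
        have "2 * (r / 2 ^ j) + 2 / 2 ^ j = (2 * r + 2) / 2 ^ j" by (simp add: add_divide_distrib)
        also have "\<dots> \<le> K / 2 ^ j" by (intro divide_right_mono) (auto simp: K_def d_def)
        finally show "2 * (r / 2 ^ j) + 2 / 2 ^ j \<le> K / 2 ^ j" .
      qed (auto simp: C_def)
      finally have "ennreal (c j powr q) * epowr (?F j) q \<le> ennreal (c j powr q) * (ennreal C * ?G j j)"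
        by (rule mult_left_mono) simp
      also have "\<dots> = ennreal C * ?T j 0"
        using cq[of j 0 0] by (simp add: mult.left_commute)
      finally show "ennreal (c j powr q) * epowr (?F j) q \<le> ennreal C * ?T j 0" .
    next
      have Tk: "ennreal (c i powr q) * (ennreal (2 powr (- real k * (real (?n + N') * q))) * ?G i (i + k)) = ?T i k" for k
        by (subst mult.assoc[symmetric], subst cq) (rule refl)
      have ord: "order_bounded N' \<Psi> (I * (2 ^ i) ^ (?n + N'))"
        unfolding order_bounded_def using \<Psi>b by auto
      have "epowr (ennreal (cmod (f \<Psi>))) q \<le> ennreal C1 * (\<Sum>k. ennreal (2 powr (- real k * (real (?n + N') * q))) * ?G i (i + k))"
        by (intro fine f \<Psi>t \<Psi>0 ord \<Psi>out)
      also have "\<dots> \<le> ennreal C * (\<Sum>k. ennreal (2 powr (- real k * (real (?n + N') * q))) * ?G i (i + k))"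
        by (intro mult_right_mono ennreal_leI) (auto simp: C_def)
      finally have "ennreal (c i powr q) * epowr (ennreal (cmod (f \<Psi>))) q
          \<le> ennreal (c i powr q) * (ennreal C * (\<Sum>k. ennreal (2 powr (- real k * (real (?n + N') * q))) * ?G i (i + k)))"
        by (rule mult_left_mono) simp
      also have "\<dots> = ennreal C * (\<Sum>k. ennreal (c i powr q) * (ennreal (2 powr (- real k * (real (?n + N') * q))) * ?G i (i + k)))"
        by (simp add: mult.left_commute)
      finally show "ennreal (c i powr q) * epowr (ennreal (cmod (f \<Psi>))) q \<le> ennreal C * (\<Sum>k. ?T i k)"
        unfolding Tk .
    qed
    also have "\<dots> \<le> ennreal C * scale_sum (\<alpha> * q) (real (?n + N') * q) q K (grand_maximal N f) x
        + ennreal C * scale_sum (\<alpha> * q) (real (?n + N') * q) q K (grand_maximal N f) x"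
    proof (intro add_mono)
      have T0: "?T j 0 \<le> (\<Sum>k. ?T j k)" for j
        using sum_le_suminf[of "?T j" "{0}"] by simp
      have "(\<Sum>j<i. ?T j 0) \<le> (\<Sum>j<i. \<Sum>k. ?T j k)" by (intro sum_mono T0)
      also have "\<dots> \<le> (\<Sum>j. \<Sum>k. ?T j k)" by (rule sum_le_suminf) auto
      finally show "(\<Sum>j<i. ennreal C * ?T j 0) \<le> ennreal C * scale_sum (\<alpha> * q) (real (?n + N') * q) q K (grand_maximal N f) x"
        unfolding scale_sum_def by (simp only: sum_distrib_left[symmetric] mult_left_mono zero_le)
      have "(\<Sum>k. ?T i k) \<le> (\<Sum>j. \<Sum>k. ?T j k)"
        using sum_le_suminf[of "\<lambda>j. \<Sum>k. ?T j k" "{i}"] by simp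
      then show "ennreal C * (\<Sum>k. ?T i k) \<le> ennreal C * scale_sum (\<alpha> * q) (real (?n + N') * q) q K (grand_maximal N f) x"
        unfolding scale_sum_def by (simp only: mult_left_mono zero_le)
    qed
    also have "\<dots> = ennreal (2 * C) * scale_sum (\<alpha> * q) (real (?n + N') * q) q K (grand_maximal N f) x"
      using C by (simp add: ennreal_mult' mult_2[symmetric] mult.assoc mult.left_commute)
    finally show ?thesis .
  qed
  show ?thesis
  proof (rule exI[of _ "2 * C"], rule exI[of _ K], intro conjI ballI allI)
    fix f :: "'n functional" and x assume f: "f \<in> distributions"
    show "epowr (grand_maximal N' (loc_frac_int \<phi>0 \<alpha> f) x) q
      \<le> ennreal (2 * C) * scale_sum (\<alpha> * q) (real (?n + N') * q) q K (grand_maximal N f) x"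
      unfolding epowr_le_iff[OF q(1)] grand_maximal_def[of N' "loc_frac_int \<phi>0 \<alpha> f"]
    proof (rule SUP_least)
      fix s assume "s \<in> {(t :: real, \<psi> :: real^'n \<Rightarrow> complex). 0 < t \<and> t < 1 \<and> \<psi> \<in> test_functions
          \<and> supp \<psi> \<subseteq> ball 0 (2 ^ (3 * (10 + ?n))) \<and> derivs_bounded N' \<psi> 1}"
      then obtain t \<psi> where s: "s = (t, \<psi>)" and "0 < t" "t < 1" "\<psi> \<in> test_functions"
          "supp \<psi> \<subseteq> ball 0 r" "derivs_bounded N' \<psi> 1"
        unfolding r_def by blast
      from main[OF f this(2-6), of x]
      show "(case s of (t, \<psi>) \<Rightarrow> ennreal (cmod (conv (dilate t \<psi>) (loc_frac_int \<phi>0 \<alpha> f) x)))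
        \<le> epowr (ennreal (2 * C) * scale_sum (\<alpha> * q) (real (?n + N') * q) q K (grand_maximal N f) x) (1 / q)"
        unfolding epowr_le_iff[OF q(1)] s prod.case .
    qed
  qed (use C K in auto)
qed

section \<open>Local \<open>A\<^sub>1\<close> weights\<close>

lemma ennreal_cancel_le:
  assumes "0 < a" "0 \<le> b" "x * ennreal a \<le> ennreal b * y"
  shows "x \<le> ennreal (b / a) * y"
proof -
  have "x = ennreal (1 / a) * (x * ennreal a)"
    using assms(1) by (simp add: mult.left_commute ennreal_mult'[symmetric])
  also have "\<dots> \<le> ennreal (1 / a) * (ennreal b * y)" by (intro mult_left_mono assms) simp
  also have "\<dots> = ennreal (b / a) * y"
    using assms by (simp add: mult.assoc[symmetric] ennreal_mult'[symmetric])
  finally show ?thesis .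
qed

lemma cube_sym: "y \<in> cube x t \<longleftrightarrow> x \<in> cube y t"
  by (auto simp: cube_def abs_minus_commute)

lemma cube_pred [measurable]: "Measurable.pred (borel \<Otimes>\<^sub>M borel) (\<lambda>(x :: real^'n::finite, y). y \<in> cube x t)"
  unfolding cube_def by measurable

text \<open>The weight is Borel measurable and takes values in \<open>[0,\<infinity>]\<close>, so that its mass can be integrated by
  Tonelli's theorem.\<close>

locale local_A1 =
  fixes v :: "real^'n::finite \<Rightarrow> ennreal" and A :: real
  assumes v_measurable [measurable]: "v \<in> borel_measurable borel"
    and A: "0 < A"
    and A1: "\<And>c s. 0 < s \<Longrightarrow> s \<le> 1 \<Longrightarrow>
      AE y in lborel. y \<in> cube c s \<longrightarrow> (\<integral>\<^sup>+x\<in>cube c s. v x \<partial>lborel) \<le> ennreal (A * s ^ CARD('n)) * v y"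
begin

definition mass :: "(real^'n) set \<Rightarrow> ennreal" where "mass E = (\<integral>\<^sup>+x\<in>E. v x \<partial>lborel)"

lemma mass_mono: "E \<subseteq> F \<Longrightarrow> mass E \<le> mass F"
  unfolding mass_def by (intro nn_integral_mono mult_left_mono indicator_leI) auto

text \<open>Integrate the \<open>A\<^sub>1\<close> inequality over \<open>E\<close>.\<close>

lemma mass_subset:
  assumes s: "0 < s" "s \<le> 1" and [measurable]: "E \<in> sets borel" and E: "E \<subseteq> cube c s"
  shows "mass (cube c s) * emeasure lborel E \<le> ennreal (A * s ^ CARD('n)) * mass E"
proof -
  have "mass (cube c s) * emeasure lborel E = (\<integral>\<^sup>+y. mass (cube c s) * indicator E y \<partial>lborel)"
    by (subst nn_integral_cmult_indicator) auto
  also have "\<dots> \<le> (\<integral>\<^sup>+y. ennreal (A * s ^ CARD('n)) * (v y * indicator E y) \<partial>lborel)"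
    using A1[OF s, of c] E unfolding mass_def
    by (intro nn_integral_mono_AE) (auto split: split_indicator)
  also have "\<dots> = ennreal (A * s ^ CARD('n)) * mass E"
    unfolding mass_def by (rule nn_integral_cmult) simp
  finally show ?thesis .
qed

text \<open>Both cubes contain the cube of half the side around the midpoint of their centres.\<close>

lemma mass_near:
  assumes s: "0 < s" "s \<le> 1" and near: "\<And>i. \<bar>c $ i - c' $ i\<bar> \<le> s / 2"
  shows "mass (cube c s) \<le> ennreal (A * 2 ^ CARD('n)) * mass (cube c' s)"
proof -
  define m where "m = (1 / 2) *\<^sub>R (c + c')"
  have sub: "cube m (s / 2) \<subseteq> cube c s" "cube m (s / 2) \<subseteq> cube c' s"
  proof -
    have mi: "m $ i = (c $ i + c' $ i) / 2" for i by (simp add: m_def)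
    have "\<bar>y $ i - c $ i\<bar> \<le> s / 2 \<and> \<bar>y $ i - c' $ i\<bar> \<le> s / 2" if "\<bar>y $ i - m $ i\<bar> \<le> s / 2 / 2" for y i
      using near[of i] that unfolding mi by argo
    then show "cube m (s / 2) \<subseteq> cube c s" "cube m (s / 2) \<subseteq> cube c' s"
      unfolding cube_def by blast+
  qed
  have "mass (cube c s) * ennreal ((s / 2) ^ CARD('n)) \<le> ennreal (A * s ^ CARD('n)) * mass (cube m (s / 2))"
    using mass_subset[OF s _ sub(1)] emeasure_cube[of "s / 2" m] s by simp
  also have "\<dots> \<le> ennreal (A * s ^ CARD('n)) * mass (cube c' s)"
    by (intro mult_left_mono mass_mono sub) simp
  finally have "mass (cube c s) \<le> ennreal (A * s ^ CARD('n) / (s / 2) ^ CARD('n)) * mass (cube c' s)"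
    using s A by (intro ennreal_cancel_le) auto
  also have "A * s ^ CARD('n) / (s / 2) ^ CARD('n) = A * 2 ^ CARD('n)"
    using s by (simp add: power_divide)
  finally show ?thesis .
qed

text \<open>Walk from \<open>c'\<close> to \<open>c\<close> in \<open>k\<close> steps of length at most \<open>s / 2\<close>.\<close>

lemma mass_chain:
  assumes s: "0 < s" "s \<le> 1" and near: "\<And>i. \<bar>c $ i - c' $ i\<bar> \<le> real k * s / 2"
  shows "mass (cube c s) \<le> ennreal (A * 2 ^ CARD('n)) ^ k * mass (cube c' s)"
  using near
proof (induction k arbitrary: c')
  case 0
  then have "c = c'" by (simp add: vec_eq_iff)
  then show ?case by simp
next
  case (Suc k)
  define c'' where "c'' = c' + (1 / real (Suc k)) *\<^sub>R (c - c')"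
  have a: "\<bar>c $ i - c'' $ i\<bar> \<le> real k * s / 2" and b: "\<bar>c'' $ i - c' $ i\<bar> \<le> s / 2" for i
  proof -
    have "c $ i - c'' $ i = (real k / real (Suc k)) * (c $ i - c' $ i)"
    proof -
      have "c $ i - c'' $ i = (1 - 1 / real (Suc k)) * (c $ i - c' $ i)"
        unfolding c''_def by (simp add: left_diff_distrib del: of_nat_Suc)
      also have "1 - 1 / real (Suc k) = real k / real (Suc k)" by (simp add: field_simps)
      finally show ?thesis .
    qed
    then have "\<bar>c $ i - c'' $ i\<bar> = (real k / real (Suc k)) * \<bar>c $ i - c' $ i\<bar>" by (simp add: abs_mult)
    also have "\<dots> \<le> (real k / real (Suc k)) * (real (Suc k) * s / 2)"
      by (intro mult_left_mono Suc.prems) simp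
    finally show "\<bar>c $ i - c'' $ i\<bar> \<le> real k * s / 2" by simp
    have "c'' $ i - c' $ i = (1 / real (Suc k)) * (c $ i - c' $ i)" by (simp add: c''_def)
    then have "\<bar>c'' $ i - c' $ i\<bar> = (1 / real (Suc k)) * \<bar>c $ i - c' $ i\<bar>" by (simp add: abs_mult)
    also have "\<dots> \<le> (1 / real (Suc k)) * (real (Suc k) * s / 2)"
      by (intro mult_left_mono Suc.prems) simp
    finally show "\<bar>c'' $ i - c' $ i\<bar> \<le> s / 2" by simp
  qed
  have "mass (cube c s) \<le> ennreal (A * 2 ^ CARD('n)) ^ k * mass (cube c'' s)" by (rule Suc.IH[OF a])
  also have "\<dots> \<le> ennreal (A * 2 ^ CARD('n)) ^ k * (ennreal (A * 2 ^ CARD('n)) * mass (cube c' s))"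
    by (intro mult_left_mono mass_near s b) simp
  finally show ?case by (simp add: mult.assoc mult.left_commute)
qed

text \<open>By Tonelli's theorem the mass of the large cube is bounded by an average of the masses of cubes of
  side \<open>s\<close> with centres near \<open>y\<close>, which \<open>mass_chain\<close> compares with the one at \<open>y\<close>.  This also covers
  cubes of side larger than 1.\<close>

lemma mass_doubling:
  assumes K: "0 < K"
  shows "\<exists>C>0. \<forall>y s. 0 < s \<longrightarrow> s \<le> 1 \<longrightarrow> mass (cube y (K * s)) \<le> ennreal C * mass (cube y s)"
proof -
  define k where "k = nat \<lceil>K + 1\<rceil>"
  have k: "K + 1 \<le> real k" unfolding k_def by (rule real_nat_ceiling_ge)
  define B where "B = (A * 2 ^ CARD('n)) ^ k"
  have B: "0 < B" "ennreal (A * 2 ^ CARD('n)) ^ k = ennreal B"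
    using A by (auto simp: B_def ennreal_power)
  have "mass (cube y (K * s)) \<le> ennreal ((K + 1) ^ CARD('n) * B) * mass (cube y s)" if s: "0 < s" "s \<le> 1" for y s
  proof -
    have "mass (cube y (K * s)) * ennreal (s ^ CARD('n)) = (\<integral>\<^sup>+x. v x * indicator (cube y (K * s)) x * ennreal (s ^ CARD('n)) \<partial>lborel)"
      unfolding mass_def by (rule nn_integral_multc[symmetric]) simp
    also have "\<dots> = (\<integral>\<^sup>+x. v x * indicator (cube y (K * s)) x * (\<integral>\<^sup>+z. indicator (cube x s) z \<partial>lborel) \<partial>lborel)"
      using s by (simp add: emeasure_cube)
    also have "\<dots> = (\<integral>\<^sup>+x. \<integral>\<^sup>+z. v x * indicator (cube y (K * s)) x * indicator (cube x s) z \<partial>lborel \<partial>lborel)"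
      by (simp add: nn_integral_cmult)
    also have "\<dots> = (\<integral>\<^sup>+z. \<integral>\<^sup>+x. v x * indicator (cube y (K * s)) x * indicator (cube x s) z \<partial>lborel \<partial>lborel)"
      by (rule lborel_pair.Fubini'[symmetric]) measurable
    also have "\<dots> \<le> (\<integral>\<^sup>+z. (ennreal B * mass (cube y s)) * indicator (cube y ((K + 1) * s)) z \<partial>lborel)"
    proof (rule nn_integral_mono)
      fix z
      show "(\<integral>\<^sup>+x. v x * indicator (cube y (K * s)) x * indicator (cube x s) z \<partial>lborel)
          \<le> (ennreal B * mass (cube y s)) * indicator (cube y ((K + 1) * s)) z"
      proof (cases "z \<in> cube y ((K + 1) * s)")
        case True
        have "(\<integral>\<^sup>+x. v x * indicator (cube y (K * s)) x * indicator (cube x s) z \<partial>lborel) \<le> mass (cube z s)"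
          unfolding mass_def by (intro nn_integral_mono) (auto split: split_indicator simp: cube_sym[of z])
        also have "\<dots> \<le> ennreal (A * 2 ^ CARD('n)) ^ k * mass (cube y s)"
        proof (rule mass_chain[OF s])
          fix i
          have "\<bar>z $ i - y $ i\<bar> \<le> (K + 1) * s / 2" using True by (simp add: cube_def)
          also have "\<dots> \<le> real k * s / 2" using k s by (intro divide_right_mono mult_right_mono) auto
          finally show "\<bar>z $ i - y $ i\<bar> \<le> real k * s / 2" .
        qed
        finally show ?thesis using True B by simp
      next
        case False
        have "v x * indicator (cube y (K * s)) x * indicator (cube x s) z = 0" for x
        proof (rule ccontr)
          assume "\<not> ?thesis"
          then have "x \<in> cube y (K * s)" "z \<in> cube x s" by (auto split: split_indicator_asm)
          then have "\<bar>x $ i - y $ i\<bar> \<le> K * s / 2" "\<bar>z $ i - x $ i\<bar> \<le> s / 2" for i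
            unfolding cube_def by blast+
          then have "\<bar>z $ i - y $ i\<bar> \<le> s / 2 + K * s / 2" for i
            using abs_triangle_ineq[of "z $ i - x $ i" "x $ i - y $ i"] by (smt (verit))
          then have "z \<in> cube y ((K + 1) * s)"
            unfolding cube_def by (simp add: algebra_simps add_divide_distrib)
          with False show False by simp
        qed
        then have "(\<lambda>x. v x * indicator (cube y (K * s)) x * indicator (cube x s) z) = (\<lambda>x. 0)" by (rule ext)
        then show ?thesis by simp
      qed
    qed
    also have "\<dots> = (ennreal B * mass (cube y s)) * ennreal (((K + 1) * s) ^ CARD('n))"
      using K s by (subst nn_integral_cmult_indicator) (auto simp: emeasure_cube)
    finally have "mass (cube y (K * s)) * ennreal (s ^ CARD('n)) \<le> ennreal (B * ((K + 1) * s) ^ CARD('n)) * mass (cube y s)"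
      using B by (simp add: ennreal_mult' mult_ac)
    then have "mass (cube y (K * s)) \<le> ennreal (B * ((K + 1) * s) ^ CARD('n) / s ^ CARD('n)) * mass (cube y s)"
      using s B K by (intro ennreal_cancel_le) auto
    also have "B * ((K + 1) * s) ^ CARD('n) / s ^ CARD('n) = (K + 1) ^ CARD('n) * B"
      using s by (simp add: power_mult_distrib)
    finally show ?thesis .
  qed
  moreover have "0 < (K + 1) ^ CARD('n) * B" using B K by simp
  ultimately show ?thesis by blast
qed

definition cell_center :: "nat \<Rightarrow> int^'n \<Rightarrow> real^'n" where
  "cell_center j z = (\<chi> i. (of_int (z $ i) + 1 / 2) / 2 ^ j)"

lemma cell_near_center:
  assumes "y \<in> cell j z"
  shows "\<bar>y $ i - cell_center j z $ i\<bar> \<le> 1 / 2 ^ j / 2"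
proof -
  have e: "cell_center j z $ i = of_int (z $ i) / 2 ^ j + 1 / 2 ^ j / 2"
    by (simp add: cell_center_def add_divide_distrib)
  have "(of_int (z $ i) + 1) / 2 ^ j = of_int (z $ i) / 2 ^ j + 1 / (2::real) ^ j" by (simp add: add_divide_distrib)
  with cell_coord[OF assms, of i]
  have "of_int (z $ i) / 2 ^ j \<le> y $ i" "y $ i < of_int (z $ i) / 2 ^ j + 1 / 2 ^ j" by simp_all
  moreover have "\<bar>u - (a + d / 2)\<bar> \<le> d / 2" if "a \<le> u" "u < a + d" for a u d :: real
    using that by argo
  ultimately show ?thesis unfolding e by blast
qed

lemma cell_subset_cube: "cell j z \<subseteq> cube (cell_center j z) (1 / 2 ^ j)"
  using cell_near_center by (auto simp: cube_def)

text \<open>By \<open>A\<^sub>1\<close> a cell carries at least a constant times its share of the mass of a cube of side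
  \<open>1 / 2 ^ i\<close> around it.\<close>

lemma mass_cube_cell:
  assumes K: "0 < K"
  shows "\<exists>C>0. \<forall>i k y. mass (cube y (K / 2 ^ i)) \<le> ennreal (C * 2 ^ (k * CARD('n))) * mass (cell (i + k) (cell_of (i + k) y))"
proof -
  obtain C where C: "0 < C" "\<And>y s. 0 < s \<Longrightarrow> s \<le> 1 \<Longrightarrow> mass (cube y (K * s)) \<le> ennreal C * mass (cube y s)"
    using mass_doubling[OF K] by blast
  have "mass (cube y (K / 2 ^ i)) \<le> ennreal ((C * (A * 2 ^ CARD('n)) * A) * 2 ^ (k * CARD('n))) * mass (cell (i + k) (cell_of (i + k) y))" for i k y
  proof -
    define s where "s = 1 / (2::real) ^ i"
    have s: "0 < s" "s \<le> 1" by (auto simp: s_def)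
    define c where "c = cell_center (i + k) (cell_of (i + k) y)"
    have le: "1 / 2 ^ (i + k) \<le> s" unfolding s_def by (intro divide_left_mono power_increasing) auto
    have sub: "cell (i + k) (cell_of (i + k) y) \<subseteq> cube c s"
    proof -
      have "cube c (1 / 2 ^ (i + k)) \<subseteq> cube c s"
        by (rule cube_mono[OF le])
      then show ?thesis using cell_subset_cube unfolding c_def by blast
    qed
    have "mass (cube c s) * ennreal ((1 / 2 ^ (i + k)) ^ CARD('n)) \<le> ennreal (A * s ^ CARD('n)) * mass (cell (i + k) (cell_of (i + k) y))"
      using mass_subset[OF s cell_borel sub] unfolding emeasure_cell .
    then have "mass (cube c s) \<le> ennreal (A * s ^ CARD('n) / (1 / 2 ^ (i + k)) ^ CARD('n)) * mass (cell (i + k) (cell_of (i + k) y))"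
      using A s by (intro ennreal_cancel_le) auto
    also have "A * s ^ CARD('n) / (1 / 2 ^ (i + k)) ^ CARD('n) = A * 2 ^ (k * CARD('n))"
      by (simp add: s_def power_divide power_add power_mult power_mult_distrib)
    finally have 3: "mass (cube c s) \<le> ennreal (A * 2 ^ (k * CARD('n))) * mass (cell (i + k) (cell_of (i + k) y))" .
    have 2: "mass (cube y s) \<le> ennreal (A * 2 ^ CARD('n)) * mass (cube c s)"
    proof (rule mass_near[OF s])
      fix l
      have "\<bar>y $ l - c $ l\<bar> \<le> 1 / 2 ^ (i + k) / 2"
        unfolding c_def by (rule cell_near_center[OF mem_cell_of])
      also have "\<dots> \<le> s / 2" by (rule divide_right_mono[OF le]) simp
      finally show "\<bar>y $ l - c $ l\<bar> \<le> s / 2" .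
    qed
    have "mass (cube y (K / 2 ^ i)) \<le> ennreal C * mass (cube y s)"
      using C(2)[OF s, of y] by (simp add: s_def)
    also have "\<dots> \<le> ennreal C * (ennreal (A * 2 ^ CARD('n)) * (ennreal (A * 2 ^ (k * CARD('n))) * mass (cell (i + k) (cell_of (i + k) y))))"
      by (intro mult_left_mono order_trans[OF 2] 3) auto
    also have "\<dots> = ennreal ((C * (A * 2 ^ CARD('n)) * A) * 2 ^ (k * CARD('n))) * mass (cell (i + k) (cell_of (i + k) y))"
      using C A by (simp add: ennreal_mult' mult.assoc)
    finally show ?thesis .
  qed
  moreover have "0 < C * (A * 2 ^ CARD('n)) * A" using C A by simp
  ultimately show ?thesis by blast
qed

definition cell_avg :: "nat \<Rightarrow> real^'n \<Rightarrow> ennreal" where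
  "cell_avg j y = ennreal (2 ^ (j * CARD('n))) * mass (cell j (cell_of j y))"

lemma cell_avg_measurable [measurable]: "cell_avg j \<in> borel_measurable borel"
proof -
  have "cell_avg j = (\<lambda>z. ennreal (2 ^ (j * CARD('n))) * mass (cell j z)) \<circ> cell_of j" by (auto simp: cell_avg_def)
  also have "\<dots> \<in> borel_measurable borel"
    by (rule measurable_comp[OF cell_of_measurable]) simp
  finally show ?thesis .
qed

lemma cell_avg_le: "AE y in lborel. \<forall>j. cell_avg j y \<le> ennreal A * v y"
proof -
  have "AE y in lborel. \<forall>j. \<forall>z. y \<in> cell j z \<longrightarrow> ennreal (2 ^ (j * CARD('n))) * mass (cell j z) \<le> ennreal A * v y"
  proof (subst AE_all_countable, intro allI, subst AE_all_countable, intro allI)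
    fix j z
    have "AE y in lborel. y \<in> cube (cell_center j z) (1 / 2 ^ j) \<longrightarrow>
        mass (cube (cell_center j z) (1 / 2 ^ j)) \<le> ennreal (A * (1 / 2 ^ j) ^ CARD('n)) * v y"
      unfolding mass_def by (rule A1) auto
    then show "AE y in lborel. y \<in> cell j z \<longrightarrow> ennreal (2 ^ (j * CARD('n))) * mass (cell j z) \<le> ennreal A * v y"
    proof eventually_elim
      case (elim y)
      show ?case
      proof
        assume "y \<in> cell j z"
        then have "mass (cube (cell_center j z) (1 / 2 ^ j)) \<le> ennreal (A * (1 / 2 ^ j) ^ CARD('n)) * v y"
          using elim cell_subset_cube by blast
        then have "mass (cell j z) \<le> ennreal (A * (1 / 2 ^ j) ^ CARD('n)) * v y"
          using mass_mono[OF cell_subset_cube] order_trans by blast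
        then have "ennreal (2 ^ (j * CARD('n))) * mass (cell j z) \<le> ennreal (2 ^ (j * CARD('n))) * (ennreal (A * (1 / 2 ^ j) ^ CARD('n)) * v y)"
          by (rule mult_left_mono) simp
        also have "\<dots> = ennreal A * v y"
          unfolding mult.assoc[symmetric] by (simp add: ennreal_mult'[symmetric] power_divide power_mult)
        finally show "ennreal (2 ^ (j * CARD('n))) * mass (cell j z) \<le> ennreal A * v y" .
      qed
    qed
  qed
  then show ?thesis by eventually_elim (auto simp: cell_avg_def mem_cell_of)
qed

end

section \<open>Summation over the scales\<close>

lemma two_powr_sum: "(2::real) ^ (j * d) = 2 powr (real j * real d)"
  by (simp add: powr_realpow[symmetric])

lemma ennreal_suminf_swap:
  fixes f :: "nat \<Rightarrow> nat \<Rightarrow> ennreal"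
  shows "(\<Sum>i. \<Sum>k. f i k) = (\<Sum>k. \<Sum>i. f i k)"
proof -
  have "(\<Sum>k. \<Sum>i. f i k) = (\<integral>\<^sup>+k. (\<Sum>i. f i k) \<partial>count_space UNIV)"
    by (rule nn_integral_count_space_nat[symmetric])
  also have "\<dots> = (\<Sum>i. \<integral>\<^sup>+k. f i k \<partial>count_space UNIV)"
    by (rule nn_integral_suminf) simp
  finally show ?thesis by (simp add: nn_integral_count_space_nat)
qed

lemma suminf_shift_le:
  fixes a :: "nat \<Rightarrow> ennreal"
  shows "(\<Sum>i. a (i + k)) \<le> (\<Sum>j. a j)"
  by (subst suminf_offset[of a k]) auto

context local_A1
begin

text \<open>Tonelli's theorem weights a cell of level \<open>i + k\<close> with the mass of a cube of side \<open>K / 2 ^ i\<close>, which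
  is at most \<open>C 2 ^ (k n)\<close> times the mass of the cell.  For fixed level \<open>j = i + k\<close> the coefficients are
  then \<open>2 powr (- j a)\<close> times a geometric sequence in \<open>k\<close> of ratio \<open>2 powr (n + a - b) < 1\<close>.\<close>

lemma scale_sum_integral:
  assumes q: "0 < q" and K: "0 < K" and ab: "real CARD('n) + a < b"
  shows "\<exists>C>0. \<forall>g. (\<integral>\<^sup>+x. scale_sum a b q K g x * v x \<partial>lborel)
    \<le> ennreal C * (\<Sum>j. ennreal (2 powr (- real j * a)) * (\<integral>\<^sup>+y. epowr (cell_min j g y) q * cell_avg j y \<partial>lborel))"
proof -
  let ?n = "CARD('n)"
  define \<delta> where "\<delta> = b - a - real ?n"
  have \<delta>: "0 < \<delta>" using ab by (simp add: \<delta>_def)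
  obtain C where C: "0 < C" "\<And>i k y. mass (cube y (K / 2 ^ i)) \<le> ennreal (C * 2 ^ (k * ?n)) * mass (cell (i + k) (cell_of (i + k) y))"
    using mass_cube_cell[OF K] by blast
  define w where "w k = (2 powr (- \<delta>)) ^ k" for k :: nat
  have r: "0 < (2::real) powr (- \<delta>)" "(2::real) powr (- \<delta>) < 1" using \<delta> powr_less_one[of 2 "- \<delta>"] by auto
  have w: "summable w" "(\<Sum>k. ennreal (w k)) = ennreal (\<Sum>k. w k)" "0 < (\<Sum>k. w k)"
  proof -
    show s: "summable w" unfolding w_def using r by (intro summable_geometric) auto
    show "(\<Sum>k. ennreal (w k)) = ennreal (\<Sum>k. w k)"
      using r by (intro suminf_ennreal2 s) (auto simp: w_def)
    show "0 < (\<Sum>k. w k)" using r by (intro suminf_pos s) (auto simp: w_def)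
  qed
  have "(\<integral>\<^sup>+x. scale_sum a b q K g x * v x \<partial>lborel) \<le> ennreal (C * (\<Sum>k. w k))
      * (\<Sum>j. ennreal (2 powr (- real j * a)) * (\<integral>\<^sup>+y. epowr (cell_min j g y) q * cell_avg j y \<partial>lborel))" for g
  proof -
    define X where "X j = (\<integral>\<^sup>+y. epowr (cell_min j g y) q * cell_avg j y \<partial>lborel)" for j
    have [measurable]: "(\<lambda>y. epowr (cell_min j g y) q) \<in> borel_measurable borel" for j
      using measurable_comp[OF cell_min_measurable measurable_epowr[OF q]] by (simp add: comp_def)
    have [measurable]: "(\<lambda>x. cell_sum q g j x t) \<in> borel_measurable borel" for j t
      unfolding cell_sum_def by measurable
    have term_le: "(\<integral>\<^sup>+x. cell_sum q g (i + k) x (K / 2 ^ i) * v x \<partial>lborel) \<le> ennreal (C * 2 ^ (k * ?n)) * X (i + k)" for i k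
    proof -
      let ?B = "\<lambda>y. epowr (cell_min (i + k) g y) q" and ?N = "ennreal (2 ^ ((i + k) * ?n))"
      let ?Q = "\<lambda>x. cube x (K / 2 ^ i)"
      have [measurable]: "(\<lambda>y. mass (?Q y)) \<in> borel_measurable borel"
        unfolding mass_def by measurable
      have "(\<integral>\<^sup>+x. cell_sum q g (i + k) x (K / 2 ^ i) * v x \<partial>lborel)
          = ?N * (\<integral>\<^sup>+x. (\<integral>\<^sup>+y\<in>?Q x. ?B y \<partial>lborel) * v x \<partial>lborel)"
        unfolding cell_sum_def mult.assoc by (rule nn_integral_cmult) measurable
      also have "(\<integral>\<^sup>+x. (\<integral>\<^sup>+y\<in>?Q x. ?B y \<partial>lborel) * v x \<partial>lborel)
          = (\<integral>\<^sup>+x. \<integral>\<^sup>+y. ?B y * indicator (?Q x) y * v x \<partial>lborel \<partial>lborel)"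
        by (intro nn_integral_cong nn_integral_multc[symmetric]) measurable
      also have "\<dots> = (\<integral>\<^sup>+y. \<integral>\<^sup>+x. ?B y * indicator (?Q x) y * v x \<partial>lborel \<partial>lborel)"
        by (rule lborel_pair.Fubini'[symmetric]) measurable
      also have "\<dots> = (\<integral>\<^sup>+y. ?B y * mass (?Q y) \<partial>lborel)"
      proof (rule nn_integral_cong)
        fix y
        have "(\<integral>\<^sup>+x. ?B y * indicator (?Q x) y * v x \<partial>lborel) = (\<integral>\<^sup>+x. ?B y * (v x * indicator (?Q y) x) \<partial>lborel)"
          by (intro nn_integral_cong) (auto simp: cube_sym[of y] split: split_indicator)
        then show "(\<integral>\<^sup>+x. ?B y * indicator (?Q x) y * v x \<partial>lborel) = ?B y * mass (?Q y)"
          unfolding mass_def by (simp add: nn_integral_cmult)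
      qed
      finally have "(\<integral>\<^sup>+x. cell_sum q g (i + k) x (K / 2 ^ i) * v x \<partial>lborel) = (\<integral>\<^sup>+y. ?N * (?B y * mass (?Q y)) \<partial>lborel)"
        by (subst nn_integral_cmult) auto
      also have "\<dots> \<le> (\<integral>\<^sup>+y. ennreal (C * 2 ^ (k * ?n)) * (?B y * cell_avg (i + k) y) \<partial>lborel)"
      proof (rule nn_integral_mono)
        fix y
        show "?N * (?B y * mass (?Q y)) \<le> ennreal (C * 2 ^ (k * ?n)) * (?B y * cell_avg (i + k) y)"
          using mult_left_mono[OF C(2)[of y i k], of "?N * ?B y"] by (simp add: cell_avg_def mult_ac)
      qed
      also have "\<dots> = ennreal (C * 2 ^ (k * ?n)) * X (i + k)"
        unfolding X_def by (rule nn_integral_cmult) measurable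
      finally show ?thesis .
    qed
    have weight: "2 powr (- real i * a - real k * b) * (C * 2 ^ (k * ?n)) = C * w k * 2 powr (- real (i + k) * a)" for i k
    proof -
      have "2 powr (- real i * a - real k * b) * 2 ^ (k * ?n) = 2 powr (- \<delta> * real k) * 2 powr (- real (i + k) * a)"
        unfolding two_powr_sum powr_add[symmetric] by (simp add: \<delta>_def algebra_simps)
      also have "2 powr (- \<delta> * real k) = w k" by (simp add: w_def powr_realpow[symmetric] powr_powr)
      finally show ?thesis by (simp add: mult.left_commute mult.assoc)
    qed
    have weight_term: "ennreal (2 powr (- real i * a - real k * b)) * (ennreal (C * 2 ^ (k * ?n)) * y)
        = ennreal (C * w k) * (ennreal (2 powr (- real (i + k) * a)) * y)" for i k y
    proof -
      have "0 \<le> C * w k" using C(1) r by (simp add: w_def)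
      then have "ennreal (2 powr (- real i * a - real k * b)) * ennreal (C * 2 ^ (k * ?n))
          = ennreal (C * w k) * ennreal (2 powr (- real (i + k) * a))"
        by (simp only: ennreal_mult'[symmetric] powr_ge_zero weight)
      then show ?thesis by (simp only: mult.assoc[symmetric])
    qed
    have "(\<integral>\<^sup>+x. scale_sum a b q K g x * v x \<partial>lborel)
        = (\<integral>\<^sup>+x. (\<Sum>i. \<Sum>k. ennreal (2 powr (- real i * a - real k * b)) * (cell_sum q g (i + k) x (K / 2 ^ i) * v x)) \<partial>lborel)"
      by (simp add: scale_sum_def mult.assoc flip: ennreal_suminf_multc)
    also have "\<dots> = (\<Sum>i. \<Sum>k. ennreal (2 powr (- real i * a - real k * b)) * (\<integral>\<^sup>+x. cell_sum q g (i + k) x (K / 2 ^ i) * v x \<partial>lborel))"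
      by (subst nn_integral_suminf, measurable, subst nn_integral_suminf, measurable, subst nn_integral_cmult, measurable)
    also have "\<dots> \<le> (\<Sum>i. \<Sum>k. ennreal (2 powr (- real i * a - real k * b)) * (ennreal (C * 2 ^ (k * ?n)) * X (i + k)))"
      by (intro suminf_le mult_left_mono term_le) auto
    also have "\<dots> = (\<Sum>i. \<Sum>k. ennreal (C * w k) * (ennreal (2 powr (- real (i + k) * a)) * X (i + k)))"
      by (simp only: weight_term)
    also have "\<dots> = (\<Sum>k. \<Sum>i. ennreal (C * w k) * (ennreal (2 powr (- real (i + k) * a)) * X (i + k)))"
      by (rule ennreal_suminf_swap)
    also have "\<dots> \<le> (\<Sum>k. ennreal (C * w k) * (\<Sum>j. ennreal (2 powr (- real j * a)) * X j))"
    proof (intro suminf_le)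
      fix k
      show "(\<Sum>i. ennreal (C * w k) * (ennreal (2 powr (- real (i + k) * a)) * X (i + k))) \<le> ennreal (C * w k) * (\<Sum>j. ennreal (2 powr (- real j * a)) * X j)"
        using mult_left_mono[OF suminf_shift_le[of "\<lambda>j. ennreal (2 powr (- real j * a)) * X j" k], of "ennreal (C * w k)"] by simp
    qed auto
    also have "\<dots> = ennreal (C * (\<Sum>k. w k)) * (\<Sum>j. ennreal (2 powr (- real j * a)) * X j)"
      using C(1) by (simp add: ennreal_mult' w mult.assoc)
    finally show ?thesis by (simp add: X_def)
  qed
  moreover have "0 < C * (\<Sum>k. w k)" using C w by simp
  ultimately show ?thesis by blast
qed

end

lemma geometric_sum_le:
  assumes "0 \<le> s" "s < (1::real)"
  shows "(\<Sum>j<m. s ^ j) \<le> 1 / (1 - s)"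
proof -
  have "(\<Sum>j<m. s ^ j) \<le> (\<Sum>j. s ^ j)"
    using assms by (intro sum_le_suminf summable_geometric) auto
  then show ?thesis using assms by (simp add: suminf_geometric)
qed

text \<open>Let \<open>m\<close> be the first level with \<open>U \<le> 2 powr (m d) H\<close>.  Up to \<open>m\<close> the second bound for \<open>c\<close> gives an
  increasing geometric sequence, from \<open>m\<close> on the first one gives a decreasing one, and both sums are
  comparable to their terms near \<open>m\<close>.\<close>

lemma scale_sum_bound:
  fixes c :: "nat \<Rightarrow> real"
  assumes \<epsilon>: "0 < \<epsilon>" and d: "0 < d" and H: "0 < H"
    and c: "\<And>j. 0 \<le> c j" "\<And>j. c j \<le> U" "\<And>j. c j \<le> 2 powr (real j * d) * H"
  shows "(\<Sum>j<J. 2 powr (- real j * \<epsilon>) * c j powr (1 + \<epsilon> / d))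
    \<le> (1 / (1 - 2 powr (- d)) + 1 / (1 - 2 powr (- \<epsilon>))) * (U * H powr (\<epsilon> / d))"
proof (cases "U = 0")
  case True
  then have "c j = 0" for j using c(1,2)[of j] by simp
  then show ?thesis using True by simp
next
  case False
  then have U: "0 < U" using c(1,2)[of 0] by simp
  define s where "s = (2::real) powr (- d)"
  define r where "r = (2::real) powr (- \<epsilon>)"
  have s: "0 < s" "s < 1" using d powr_less_one[of 2 "- d"] by (auto simp: s_def)
  have r: "0 < r" "r < 1" using \<epsilon> powr_less_one[of 2 "- \<epsilon>"] by (auto simp: r_def)
  define P where "P j \<longleftrightarrow> U \<le> 2 powr (real j * d) * H" for j :: nat
  have ex: "\<exists>j. P j"
  proof -
    obtain j where j: "U / H < (2 powr d) ^ j" using real_arch_pow[of "2 powr d" "U / H"] d by auto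
    then have "U \<le> 2 powr (real j * d) * H"
      using H by (simp add: powr_realpow[symmetric] powr_powr divide_less_eq mult.commute)
    then show ?thesis by (auto simp: P_def)
  qed
  define m where "m = (LEAST j. P j)"
  have Pm: "U \<le> 2 powr (real m * d) * H" using LeastI_ex[OF ex] by (simp add: m_def P_def)
  have nP: "2 powr (real j * d) * H < U" if "j < m" for j
    using not_less_Least[of j P] that by (simp add: m_def P_def)
  define B where "B = U * H powr (\<epsilon> / d)"
  have B: "0 \<le> B" using U by (simp add: B_def)
  define t where "t j = 2 powr (- real j * \<epsilon>) * c j powr (1 + \<epsilon> / d)" for j
  have fine: "t (m + j) \<le> r ^ j * B" for j
  proof -
    have "t (m + j) \<le> 2 powr (- real (m + j) * \<epsilon>) * U powr (1 + \<epsilon> / d)"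
      unfolding t_def using c \<epsilon> d by (intro mult_left_mono powr_mono2) auto
    also have "U powr (1 + \<epsilon> / d) = U * U powr (\<epsilon> / d)" using U by (simp add: powr_add)
    also have "U powr (\<epsilon> / d) \<le> (2 powr (real m * d) * H) powr (\<epsilon> / d)"
      using Pm U \<epsilon> d by (intro powr_mono2) auto
    also have "(2 powr (real m * d) * H) powr (\<epsilon> / d) = 2 powr (real m * \<epsilon>) * H powr (\<epsilon> / d)"
      using H d by (simp add: powr_mult powr_powr)
    finally have "t (m + j) \<le> 2 powr (- real (m + j) * \<epsilon>) * (U * (2 powr (real m * \<epsilon>) * H powr (\<epsilon> / d)))"
      using U by (simp add: mult_left_mono)
    also have "\<dots> = (2 powr (- real (m + j) * \<epsilon>) * 2 powr (real m * \<epsilon>)) * B" by (simp add: B_def)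
    also have "2 powr (- real (m + j) * \<epsilon>) * 2 powr (real m * \<epsilon>) = r ^ j"
      unfolding powr_add[symmetric] r_def by (simp add: powr_realpow[symmetric] powr_powr algebra_simps)
    finally show ?thesis .
  qed
  have coarse: "t j \<le> s ^ (m - Suc j) * B" if "j < m" for j
  proof -
    have "t j \<le> 2 powr (- real j * \<epsilon>) * (2 powr (real j * d) * H) powr (1 + \<epsilon> / d)"
      unfolding t_def using c \<epsilon> d by (intro mult_left_mono powr_mono2) auto
    also have "(2 powr (real j * d) * H) powr (1 + \<epsilon> / d) = 2 powr (real j * d + real j * \<epsilon>) * (H * H powr (\<epsilon> / d))"
      using H d by (simp add: powr_mult powr_powr powr_add distrib_left)
    also have "2 powr (- real j * \<epsilon>) * (2 powr (real j * d + real j * \<epsilon>) * (H * H powr (\<epsilon> / d))) = (2 powr (real j * d) * H) * H powr (\<epsilon> / d)"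
      by (simp add: powr_add powr_minus)
    also have "2 powr (real j * d) = s ^ (m - Suc j) * 2 powr (real (m - 1) * d)"
    proof -
      have e: "real j = real (m - 1) - real (m - Suc j)" using that by (simp add: of_nat_diff)
      have "s ^ (m - Suc j) = 2 powr (- d * real (m - Suc j))"
        by (simp add: s_def powr_realpow[symmetric] powr_powr)
      then have "s ^ (m - Suc j) * 2 powr (real (m - 1) * d) = 2 powr ((real (m - 1) - real (m - Suc j)) * d)"
        by (simp add: powr_add[symmetric] algebra_simps)
      then show ?thesis unfolding e[symmetric] by simp
    qed
    also have "s ^ (m - Suc j) * 2 powr (real (m - 1) * d) * H * H powr (\<epsilon> / d) \<le> s ^ (m - Suc j) * B"
    proof -
      have "2 powr (real (m - 1) * d) * H \<le> U" using nP[of "m - 1"] that by simp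
      then have "(2 powr (real (m - 1) * d) * H) * H powr (\<epsilon> / d) \<le> U * H powr (\<epsilon> / d)"
        by (rule mult_right_mono) simp
      then have "s ^ (m - Suc j) * ((2 powr (real (m - 1) * d) * H) * H powr (\<epsilon> / d)) \<le> s ^ (m - Suc j) * (U * H powr (\<epsilon> / d))"
        using s by (intro mult_left_mono) auto
      then show ?thesis by (simp add: B_def mult.assoc)
    qed
    finally show ?thesis .
  qed
  have tn: "0 \<le> t j" for j by (simp add: t_def)
  have "(\<Sum>j<J. t j) \<le> (\<Sum>j<m + J. t j)" using tn by (intro sum_mono2) auto
  also have "\<dots> = (\<Sum>j<m. t j) + (\<Sum>j<J. t (m + j))"
    by (induction J) (auto simp: add.assoc)
  also have "\<dots> \<le> (\<Sum>j<m. s ^ (m - Suc j) * B) + (\<Sum>j<J. r ^ j * B)"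
    by (intro add_mono sum_mono fine coarse) auto
  also have "(\<Sum>j<m. s ^ (m - Suc j) * B) = (\<Sum>j<m. s ^ j * B)"
    by (rule sum.nat_diff_reindex)
  also have "(\<Sum>j<m. s ^ j * B) + (\<Sum>j<J. r ^ j * B) = ((\<Sum>j<m. s ^ j) + (\<Sum>j<J. r ^ j)) * B"
    by (simp add: sum_distrib_right distrib_right)
  also have "\<dots> \<le> (1 / (1 - s) + 1 / (1 - r)) * B"
    using s r B by (intro mult_right_mono add_mono geometric_sum_le) auto
  finally show ?thesis by (simp add: t_def B_def s_def r_def)
qed

text \<open>Being constant on a cell and at most \<open>\<Phi>\<close> there, \<open>c j\<close> is at most the average of \<open>\<Phi>\<close> over the cell
  and so at most \<open>2 powr (j n)\<close> times the integral of \<open>\<Phi>\<close>.  With \<open>U\<close> the supremum of the \<open>c j\<close>,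
  which is at most \<open>\<Phi>\<close> almost everywhere, \<open>scale_sum_bound\<close> applies at each point.\<close>

lemma cellwise_embedding:
  fixes \<Phi> :: "real^'n::finite \<Rightarrow> ennreal" and c :: "nat \<Rightarrow> real^'n \<Rightarrow> ennreal"
  assumes \<epsilon>: "0 < \<epsilon>"
    and m [measurable]: "\<And>j. c j \<in> borel_measurable borel"
    and const: "\<And>j y y'. cell_of j y = cell_of j y' \<Longrightarrow> c j y = c j y'"
    and le: "AE y in lborel. \<forall>j. c j y \<le> \<Phi> y"
    and fin: "(\<integral>\<^sup>+y. \<Phi> y \<partial>lborel) < top"
  shows "(\<Sum>j. ennreal (2 powr (- real j * \<epsilon>)) * (\<integral>\<^sup>+y. epowr (c j y) (1 + \<epsilon> / real CARD('n)) \<partial>lborel))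
    \<le> ennreal (1 / (1 - 2 powr (- real CARD('n))) + 1 / (1 - 2 powr (- \<epsilon>)))
      * epowr (\<integral>\<^sup>+y. \<Phi> y \<partial>lborel) (1 + \<epsilon> / real CARD('n))"
proof -
  let ?n = "real CARD('n)"
  define \<kappa> where "\<kappa> = 1 + \<epsilon> / ?n"
  define C where "C = 1 / (1 - 2 powr (- ?n)) + 1 / (1 - 2 powr (- \<epsilon>))"
  have n: "0 < ?n" by simp
  have \<kappa>: "0 < \<kappa>" using \<epsilon> by (simp add: \<kappa>_def add_pos_nonneg)
  have C: "0 \<le> C" unfolding C_def
    using \<epsilon> powr_less_one[of 2 "- \<epsilon>"] powr_less_one[of 2 "- ?n"] by (intro add_nonneg_nonneg) auto
  define H where "H = (\<integral>\<^sup>+y. \<Phi> y \<partial>lborel)"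
  define U where "U y = (SUP j. c j y)" for y
  have [measurable]: "U \<in> borel_measurable borel" unfolding U_def[abs_def] by measurable
  have UH: "(\<integral>\<^sup>+y. U y \<partial>lborel) \<le> H"
    unfolding H_def using le by (intro nn_integral_mono_AE) (auto simp: U_def intro!: SUP_least)
  \<comment> \<open>\<open>c j\<close> is constant on the cell of \<open>y\<close> and at most \<open>\<Phi>\<close> there\<close>
  have cH: "c j y \<le> ennreal (2 powr (real j * ?n)) * H" for j y
  proof -
    have "c j y * emeasure lborel (cell j (cell_of j y)) = (\<integral>\<^sup>+y'. c j y * indicator (cell j (cell_of j y)) y' \<partial>lborel)"
      by (rule nn_integral_cmult_indicator[symmetric]) simp
    also have "\<dots> \<le> H"
      unfolding H_def using le
    proof (intro nn_integral_mono_AE, eventually_elim)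
      case (elim y')
      have "c j y \<le> \<Phi> y'" if "y' \<in> cell j (cell_of j y)"
        using spec[OF elim(2), of j] const[of j y' y] that by (simp add: cell_def)
      then show ?case by (auto split: split_indicator)
    qed
    finally have "c j y * ennreal ((1 / 2 ^ j) ^ CARD('n)) \<le> ennreal 1 * H" unfolding emeasure_cell by simp
    then have "c j y \<le> ennreal (1 / (1 / 2 ^ j) ^ CARD('n)) * H"
      by (intro ennreal_cancel_le) auto
    also have "1 / (1 / 2 ^ j) ^ CARD('n) = (2::real) powr (real j * ?n)"
      unfolding two_powr_sum[symmetric] by (simp add: power_divide power_mult)
    finally show ?thesis .
  qed
  have em [measurable]: "(\<lambda>y. epowr (c j y) \<kappa>) \<in> borel_measurable borel" for j
    using measurable_comp[OF m measurable_epowr[OF \<kappa>]] by (simp add: comp_def)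
  have main: "(\<integral>\<^sup>+y. (\<Sum>j. ennreal (2 powr (- real j * \<epsilon>)) * epowr (c j y) \<kappa>) \<partial>lborel) \<le> ennreal C * epowr H \<kappa>"
  proof (cases "H = 0")
    case True
    then have "c j y = 0" for j y using cH[of j y] by simp
    then show ?thesis using \<kappa> by simp
  next
    case False
    have Hfin: "H < top" using fin by (simp add: H_def)
    define h where "h = enn2real H"
    have h: "H = ennreal h" "0 < h" using False Hfin by (auto simp: h_def enn2real_positive_iff less_top zero_less_iff_neq_zero)
    have "AE y in lborel. U y \<noteq> \<infinity>"
      using UH Hfin by (intro nn_integral_noteq_infinite) (auto simp: top_unique)
    then have "AE y in lborel. (\<Sum>j. ennreal (2 powr (- real j * \<epsilon>)) * epowr (c j y) \<kappa>) \<le> ennreal (C * h powr (\<epsilon> / ?n)) * U y"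
    proof eventually_elim
      case (elim y)
      define u where "u = enn2real (U y)"
      have u: "U y = ennreal u" "0 \<le> u" using elim by (auto simp: u_def less_top)
      define cr where "cr j = enn2real (c j y)" for j
      have cU: "c j y \<le> U y" for j unfolding U_def by (rule SUP_upper) simp
      have cr: "c j y = ennreal (cr j)" "0 \<le> cr j" for j
        using cU[of j] elim by (auto simp: cr_def less_top top_unique)
      have c1: "cr j \<le> u" for j using cU[of j] u cr by (simp add: ennreal_le_iff)
      have c2: "cr j \<le> 2 powr (real j * ?n) * h" for j
        using cH[of j y] h cr by (simp add: ennreal_mult'[symmetric])
      have "(\<Sum>j<J. ennreal (2 powr (- real j * \<epsilon>)) * epowr (c j y) \<kappa>) \<le> ennreal (C * h powr (\<epsilon> / ?n)) * U y" for J
      proof -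
        have "(\<Sum>j<J. ennreal (2 powr (- real j * \<epsilon>)) * epowr (c j y) \<kappa>) = ennreal (\<Sum>j<J. 2 powr (- real j * \<epsilon>) * cr j powr \<kappa>)"
          using cr \<kappa> by (simp add: epowr_ennreal ennreal_mult'[symmetric] sum_ennreal)
        also have "\<dots> \<le> ennreal (C * (u * h powr (\<epsilon> / ?n)))"
          unfolding \<kappa>_def C_def by (intro ennreal_leI scale_sum_bound \<epsilon> n h cr c1 c2)
        also have "\<dots> = ennreal (C * h powr (\<epsilon> / ?n)) * U y"
          using C u by (simp add: ennreal_mult'[symmetric] mult_ac)
        finally show ?thesis .
      qed
      then show ?case by (intro suminf_le_const) auto
    qed
    then have "(\<integral>\<^sup>+y. (\<Sum>j. ennreal (2 powr (- real j * \<epsilon>)) * epowr (c j y) \<kappa>) \<partial>lborel) \<le> (\<integral>\<^sup>+y. ennreal (C * h powr (\<epsilon> / ?n)) * U y \<partial>lborel)"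
      by (rule nn_integral_mono_AE)
    also have "\<dots> = ennreal (C * h powr (\<epsilon> / ?n)) * (\<integral>\<^sup>+y. U y \<partial>lborel)"
      by (rule nn_integral_cmult) simp
    also have "\<dots> \<le> ennreal (C * h powr (\<epsilon> / ?n)) * H" by (intro mult_left_mono UH) simp
    also have "\<dots> = ennreal C * epowr H \<kappa>"
      using h C \<kappa> by (simp add: epowr_ennreal ennreal_mult'[symmetric] \<kappa>_def powr_add mult_ac)
    finally show ?thesis .
  qed
  have "(\<Sum>j. ennreal (2 powr (- real j * \<epsilon>)) * (\<integral>\<^sup>+y. epowr (c j y) \<kappa> \<partial>lborel)) =
      (\<integral>\<^sup>+y. (\<Sum>j. ennreal (2 powr (- real j * \<epsilon>)) * epowr (c j y) \<kappa>) \<partial>lborel)"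
    by (subst nn_integral_suminf) (auto simp: nn_integral_cmult)
  with main show ?thesis by (simp add: \<kappa>_def C_def H_def)
qed

section \<open>Weights in \<open>A_loc 1\<close> and their powers\<close>

lemma locally_integrable_measurable:
  assumes "locally_integrable (w :: real^'n::finite \<Rightarrow> real)"
  shows "w \<in> borel_measurable lebesgue"
proof (rule borel_measurable_LIMSEQ_real)
  fix k :: nat
  have "w absolutely_integrable_on cball 0 (real k)"
    using assms by (simp add: locally_integrable_def)
  then show "(\<lambda>x. indicator (cball 0 (real k)) x *\<^sub>R w x) \<in> borel_measurable lebesgue"
    unfolding set_integrable_def by (rule borel_measurable_integrable)
next
  fix x :: "real^'n"
  obtain k where k: "norm x \<le> real k" using real_arch_simple by blast
  have "\<forall>\<^sub>F m in sequentially. indicator (cball 0 (real m)) x *\<^sub>R w x = w x"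
    using eventually_ge_at_top[of k] by eventually_elim (use k in \<open>auto split: split_indicator\<close>)
  then show "(\<lambda>k. indicator (cball 0 (real k)) x *\<^sub>R w x) \<longlonglongrightarrow> w x"
    by (rule tendsto_eventually)
qed

lemma vol_cube: "0 \<le> t \<Longrightarrow> vol (cube (x :: real^'n::finite) t) = t ^ CARD('n)"
  by (simp add: vol_def measure_def emeasure_cube)

lemma cube_small: "0 < s \<Longrightarrow> s \<le> 1 \<Longrightarrow> cube (c :: real^'n::finite) s \<in> small_cubes"
proof -
  assume s: "0 < s" "s \<le> 1"
  then have "vol (cube c s) \<le> 1" by (simp add: vol_cube power_le_one)
  with s show ?thesis unfolding small_cubes_def by blast
qed

lemma small_cubeE:
  assumes "Q \<in> (small_cubes :: (real^'n::finite) set set)"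
  obtains c s where "Q = cube c s" "0 < s" "s \<le> 1"
proof -
  obtain c s where Q: "Q = cube c s" "0 < s" "vol (cube c s) \<le> 1"
    using assms by (auto simp: small_cubes_def)
  have "s \<le> 1"
  proof (rule ccontr)
    assume "\<not> s \<le> 1"
    then have "1 < s ^ CARD('n)" by (intro one_less_power) auto
    with Q vol_cube[of s c] show False by simp
  qed
  with Q that show thesis by blast
qed

text \<open>The essential supremum of \<open>1 / u\<close> over a cube bounds \<open>1 / u\<close> almost everywhere on it.\<close>

lemma A_loc_imp_local_A1:
  fixes u :: "real^'n::finite \<Rightarrow> real"
  assumes u: "u \<in> A_loc 1" and pos: "AE x in lebesgue. 0 < u x"
    and v: "v \<in> borel_measurable borel" and uv: "AE x in lborel. ennreal (u x) = v x"
  shows "\<exists>B. local_A1 v B"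
proof -
  define B where "B = enn2real (A_loc_const 1 u) + 1"
  have B: "0 < B" by (simp add: B_def add_nonneg_pos)
  have "A_loc_const 1 u = ennreal (enn2real (A_loc_const 1 u))" using u by (auto simp: A_loc_def less_top)
  also have "\<dots> \<le> ennreal B" by (rule ennreal_leI) (simp add: B_def)
  finally have fin: "A_loc_const 1 u \<le> ennreal B" .
  have "local_A1 v B"
  proof
    fix c :: "real^'n" and s :: real assume s: "0 < s" "s \<le> 1"
    let ?Q = "cube c s"
    let ?I = "\<integral>\<^sup>+x\<in>?Q. v x \<partial>lborel"
    let ?E = "esssup (lebesgue_on ?Q) (\<lambda>x. inverse (ennreal (u x)))"
    have ln: "(\<integral>\<^sup>+x\<in>?Q. ennreal (u x) \<partial>lebesgue) = ?I"
      unfolding nn_integral_completion using uv by (intro nn_integral_cong_AE) auto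
    have "ennreal (1 / vol ?Q) * (\<integral>\<^sup>+x\<in>?Q. ennreal (u x) \<partial>lebesgue) * ?E \<le> A_loc_const 1 u"
      unfolding A_loc_const_def if_P[OF refl] by (rule SUP_upper[OF cube_small[OF s]])
    then have le: "ennreal (1 / s ^ CARD('n)) * ?I * ?E \<le> ennreal B"
      using vol_cube[of s c] s fin by (simp add: ln)
    have "AE x in lebesgue_on ?Q. inverse (ennreal (u x)) \<le> ?E" by (rule esssup_AE)
    then have "AE x in lborel. x \<in> ?Q \<longrightarrow> inverse (ennreal (u x)) \<le> ?E"
      by (subst (asm) AE_restrict_space_iff) (auto simp: AE_completion_iff)
    with pos[unfolded AE_completion_iff] uv
    show "AE y in lborel. y \<in> ?Q \<longrightarrow> ?I \<le> ennreal (B * s ^ CARD('n)) * v y"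
    proof eventually_elim
      case (elim y)
      show ?case
      proof
        assume "y \<in> ?Q"
        then have i: "inverse (ennreal (u y)) \<le> ?E" using elim by simp
        have "?I * ennreal (1 / (s ^ CARD('n) * u y)) = ennreal (1 / s ^ CARD('n)) * ?I * inverse (ennreal (u y))"
          using elim(1) s by (simp add: inverse_ennreal divide_inverse ennreal_mult' mult_ac)
        also have "\<dots> \<le> ennreal (1 / s ^ CARD('n)) * ?I * ?E" by (intro mult_left_mono i) simp
        also have "\<dots> \<le> ennreal B * 1" using le by simp
        finally have "?I \<le> ennreal (B / (1 / (s ^ CARD('n) * u y))) * 1"
          using elim s B by (intro ennreal_cancel_le) auto
        also have "\<dots> = ennreal (B * s ^ CARD('n)) * v y"
          using elim s B by (simp add: ennreal_mult'[symmetric] mult.assoc flip: elim(2))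
        finally show "?I \<le> ennreal (B * s ^ CARD('n)) * v y" .
      qed
    qed
  qed (use v B in auto)
  then show ?thesis ..
qed

lemma powr_split_bound:
  fixes a b q \<sigma> :: real
  assumes "0 < a" "0 \<le> b" "0 < q" "q \<le> \<sigma>"
  shows "b powr q \<le> a powr q + a powr (q - \<sigma>) * b powr \<sigma>"
proof (cases "b \<le> a")
  case True
  then have "b powr q \<le> a powr q" using assms by (intro powr_mono2) auto
  then show ?thesis by (simp add: add_increasing2)
next
  case False
  then have b: "0 < b" "a \<le> b" using assms by auto
  have "b powr q = b powr (q - \<sigma>) * b powr \<sigma>" using b by (simp add: powr_add[symmetric])
  also have "\<dots> \<le> a powr (q - \<sigma>) * b powr \<sigma>"
    using b assms by (intro mult_right_mono powr_mono2') auto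
  finally show ?thesis by (simp add: add_increasing)
qed

text \<open>For almost every \<open>y\<close> in the cube, split \<open>\<omega> x powr q\<close> at the level \<open>a = \<omega> y\<close>: values up to \<open>a\<close>
  contribute at most \<open>a powr q\<close>, and for the larger ones the \<open>A\<^sub>1\<close> inequality for \<open>\<omega> powr \<sigma>\<close> at \<open>y\<close> is
  used.\<close>

lemma local_A1_lower_power:
  fixes \<omega> :: "real^'n::finite \<Rightarrow> real"
  assumes [measurable]: "\<omega> \<in> borel_measurable borel" and nn: "\<And>x. 0 \<le> \<omega> x" and pos: "AE x in lborel. 0 < \<omega> x"
    and q: "0 < q" "q \<le> \<sigma>" and L: "local_A1 (\<lambda>x. ennreal (\<omega> x powr \<sigma>)) B"
  shows "local_A1 (\<lambda>x. ennreal (\<omega> x powr q)) (1 + B)"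
proof
  interpret L: local_A1 "\<lambda>x. ennreal (\<omega> x powr \<sigma>)" B by (rule L)
  show "(\<lambda>x. ennreal (\<omega> x powr q)) \<in> borel_measurable borel" by measurable
  show "0 < 1 + B" using L.A by simp
  fix c :: "real^'n" and s :: real assume s: "0 < s" "s \<le> 1"
  let ?Q = "cube c s"
  show "AE y in lborel. y \<in> ?Q \<longrightarrow> (\<integral>\<^sup>+x\<in>?Q. ennreal (\<omega> x powr q) \<partial>lborel) \<le> ennreal ((1 + B) * s ^ CARD('n)) * ennreal (\<omega> y powr q)"
    using L.A1[OF s, of c] pos
  proof eventually_elim
    case (elim y)
    show ?case
    proof
      assume y: "y \<in> ?Q"
      let ?a = "\<omega> y"
      have "(\<integral>\<^sup>+x\<in>?Q. ennreal (\<omega> x powr q) \<partial>lborel)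
          \<le> (\<integral>\<^sup>+x. ennreal (?a powr q) * indicator ?Q x + ennreal (?a powr (q - \<sigma>)) * (ennreal (\<omega> x powr \<sigma>) * indicator ?Q x) \<partial>lborel)"
      proof (rule nn_integral_mono)
        fix x
        have "ennreal (\<omega> x powr q) \<le> ennreal (?a powr q) + ennreal (?a powr (q - \<sigma>)) * ennreal (\<omega> x powr \<sigma>)"
          using powr_split_bound[OF elim(2) nn[of x] q]
          by (simp add: ennreal_plus[symmetric] ennreal_mult'[symmetric] ennreal_leI del: ennreal_plus)
        then show "ennreal (\<omega> x powr q) * indicator ?Q x \<le> ennreal (?a powr q) * indicator ?Q x + ennreal (?a powr (q - \<sigma>)) * (ennreal (\<omega> x powr \<sigma>) * indicator ?Q x)"
          by (auto split: split_indicator)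
      qed
      also have "\<dots> = ennreal (?a powr q) * ennreal (s ^ CARD('n)) + ennreal (?a powr (q - \<sigma>)) * (\<integral>\<^sup>+x\<in>?Q. ennreal (\<omega> x powr \<sigma>) \<partial>lborel)"
        using s by (subst nn_integral_add) (auto simp: nn_integral_cmult nn_integral_cmult_indicator emeasure_cube)
      also have "\<dots> \<le> ennreal (?a powr q) * ennreal (s ^ CARD('n)) + ennreal (?a powr (q - \<sigma>)) * (ennreal (B * s ^ CARD('n)) * ennreal (?a powr \<sigma>))"
        using elim(1) y by (intro add_left_mono mult_left_mono) auto
      also have "\<dots> = ennreal (?a powr q * s ^ CARD('n) + ?a powr (q - \<sigma>) * (B * s ^ CARD('n) * ?a powr \<sigma>))"
        using s L.A by (simp add: ennreal_mult'[symmetric])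
      also have "?a powr q * s ^ CARD('n) + ?a powr (q - \<sigma>) * (B * s ^ CARD('n) * ?a powr \<sigma>) = (1 + B) * s ^ CARD('n) * ?a powr q"
      proof -
        have "?a powr (q - \<sigma>) * ?a powr \<sigma> = ?a powr q" using elim(2) by (simp add: powr_add[symmetric])
        then have "?a powr (q - \<sigma>) * (B * s ^ CARD('n) * ?a powr \<sigma>) = B * s ^ CARD('n) * ?a powr q"
          by (metis mult.assoc mult.commute)
        then show ?thesis by (simp add: algebra_simps)
      qed
      finally show "(\<integral>\<^sup>+x\<in>?Q. ennreal (\<omega> x powr q) \<partial>lborel) \<le> ennreal ((1 + B) * s ^ CARD('n)) * ennreal (?a powr q)"
        using s L.A by (simp add: ennreal_mult'[symmetric])
    qed
  qed
qed

text \<open>The converse serves to show that the infimum in \<open>q_crit\<close> is taken over a nonempty set of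
  exponents.\<close>

lemma local_A1_imp_A_loc:
  fixes u :: "real^'n::finite \<Rightarrow> real"
  assumes li: "locally_integrable u" and pos: "AE x in lebesgue. 0 < u x"
    and v: "local_A1 v A" and uv: "AE x in lborel. ennreal (u x) = v x"
  shows "u \<in> A_loc 1"
proof -
  interpret local_A1 v A by (rule v)
  have um [measurable]: "u \<in> borel_measurable lebesgue" by (rule locally_integrable_measurable[OF li])
  have "A_loc_const 1 u \<le> ennreal A"
    unfolding A_loc_const_def
  proof (simp, rule SUP_least)
    fix Q :: "(real^'n) set" assume "Q \<in> small_cubes"
    then obtain c s where Q: "Q = cube c s" "0 < s" "s \<le> 1" by (rule small_cubeE)
    have "(\<integral>\<^sup>+x\<in>Q. ennreal (u x) \<partial>lebesgue) = (\<integral>\<^sup>+x\<in>Q. v x \<partial>lborel)"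
      unfolding nn_integral_completion using uv by (intro nn_integral_cong_AE) auto
    then have I: "(\<integral>\<^sup>+x\<in>Q. ennreal (u x) \<partial>lebesgue) = mass Q" by (simp add: mass_def)
    show "ennreal (1 / vol Q) * (\<integral>\<^sup>+x\<in>Q. ennreal (u x) \<partial>lebesgue) * esssup (lebesgue_on Q) (\<lambda>x. inverse (ennreal (u x))) \<le> ennreal A"
    proof (cases "mass Q = 0")
      case False
      have ae: "AE y in lborel. 0 < u y \<and> (y \<in> Q \<longrightarrow> mass Q \<le> ennreal (A * s ^ CARD('n)) * ennreal (u y))"
      proof -
        have "AE y in lborel. 0 < u y" using pos by (simp add: AE_completion_iff)
        then show ?thesis using A1[OF Q(2,3), of c] uv unfolding mass_def Q(1)
          by eventually_elim simp
      qed
      have "emeasure lborel Q \<noteq> 0" using Q by (simp add: emeasure_cube)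
      have fin: "mass Q \<noteq> top"
      proof
        assume top: "mass Q = top"
        have "AE y in lborel. y \<notin> Q"
          using ae by eventually_elim (auto simp: top top_unique ennreal_mult_eq_top_iff)
        then have "emeasure lborel Q = 0"
          using Q by (subst (asm) AE_iff_measurable[of Q]) auto
        with \<open>emeasure lborel Q \<noteq> 0\<close> show False by simp
      qed
      define m where "m = enn2real (mass Q)"
      have m: "mass Q = ennreal m" "0 < m"
        using False fin by (auto simp: m_def less_top enn2real_positive_iff zero_less_iff_neq_zero)
      have "esssup (lebesgue_on Q) (\<lambda>x. inverse (ennreal (u x))) \<le> ennreal (A * s ^ CARD('n) / m)"
      proof (rule esssup_I)
        show "(\<lambda>x. inverse (ennreal (u x))) \<in> borel_measurable (lebesgue_on Q)"
          by (rule measurable_restrict_space1) measurable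
        have "AE x in lebesgue. x \<in> Q \<longrightarrow> inverse (ennreal (u x)) \<le> ennreal (A * s ^ CARD('n) / m)"
          unfolding AE_completion_iff using ae
        proof eventually_elim
          case (elim x)
          show ?case
          proof
            assume "x \<in> Q"
            have "0 \<le> A * s ^ CARD('n) * u x" using elim A Q by simp
            moreover have "ennreal m \<le> ennreal (A * s ^ CARD('n) * u x)"
              using elim A Q m \<open>x \<in> Q\<close> by (simp add: ennreal_mult'[symmetric])
            ultimately have "m \<le> A * s ^ CARD('n) * u x"
              by (simp only: ennreal_le_iff)
            then have "inverse (u x) \<le> A * s ^ CARD('n) / m"
              using elim m by (simp add: field_simps)
            then show "inverse (ennreal (u x)) \<le> ennreal (A * s ^ CARD('n) / m)"
              using elim by (simp add: inverse_ennreal ennreal_leI)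
          qed
        qed
        then show "AE x in lebesgue_on Q. inverse (ennreal (u x)) \<le> ennreal (A * s ^ CARD('n) / m)"
          using Q by (subst AE_restrict_space_iff) auto
      qed
      then have "ennreal (1 / vol Q) * (\<integral>\<^sup>+x\<in>Q. ennreal (u x) \<partial>lebesgue) * esssup (lebesgue_on Q) (\<lambda>x. inverse (ennreal (u x)))
          \<le> ennreal (1 / s ^ CARD('n)) * ennreal m * ennreal (A * s ^ CARD('n) / m)"
        unfolding I m(1) using Q vol_cube[of s c] by (intro mult_mono) auto
      also have "\<dots> = ennreal A" using Q m A by (simp add: ennreal_mult'[symmetric])
      finally show ?thesis .
    qed (simp add: I)
  qed
  then have "A_loc_const 1 u < top" by (rule le_less_trans) simp
  then show ?thesis using li pos by (auto simp: A_loc_def elim: AE_mp)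
qed

lemma q_crit_ge_1:
  assumes "u \<in> A_loc 1"
  shows "1 \<le> q_crit u"
  unfolding q_crit_def using assms by (intro cInf_greatest) auto

lemma locally_integrable_powr:
  fixes \<omega> :: "real^'n::finite \<Rightarrow> real"
  assumes w: "locally_integrable \<omega>" and nn: "AE x in lebesgue. 0 < \<omega> x" and s: "locally_integrable (\<lambda>x. \<omega> x powr \<sigma>)" and q: "0 < q" "q \<le> \<sigma>"
  shows "locally_integrable (\<lambda>x. \<omega> x powr q)"
  unfolding locally_integrable_def
proof (intro allI impI)
  fix K :: "(real^'n) set" assume K: "compact K"
  have [measurable]: "\<omega> \<in> borel_measurable lebesgue" by (rule locally_integrable_measurable[OF w])
  have [measurable]: "K \<in> sets lebesgue" using K by (simp add: lmeasurable_compact fmeasurableD)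
  have 1: "(\<lambda>x. 1 :: real) absolutely_integrable_on K"
    using K by (intro absolutely_integrable_on_const lmeasurable_compact)
  have 2: "(\<lambda>x. \<omega> x powr \<sigma>) absolutely_integrable_on K" using s K by (simp add: locally_integrable_def)
  have "(\<lambda>x. 1 + \<omega> x powr \<sigma>) absolutely_integrable_on K" by (rule set_integral_add(1)[OF 1 2])
  then show "(\<lambda>x. \<omega> x powr q) absolutely_integrable_on K"
    unfolding set_integrable_def
  proof (rule Bochner_Integration.integrable_bound)
    show "(\<lambda>x. indicator K x *\<^sub>R \<omega> x powr q) \<in> borel_measurable lebesgue" by measurable
    show "AE x in lebesgue. norm (indicator K x *\<^sub>R \<omega> x powr q) \<le> norm (indicator K x *\<^sub>R (1 + \<omega> x powr \<sigma>))"
      using nn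
    proof eventually_elim
      case (elim x)
      then have "\<omega> x powr q \<le> 1 + \<omega> x powr \<sigma>" using powr_split_bound[of 1 "\<omega> x" q \<sigma>] q by simp
      then show ?case by (auto split: split_indicator)
    qed
  qed
qed

section \<open>Boundedness of the fractional integral\<close>

lemma normalized_bump_exists:
  fixes \<psi>0 :: "real^'n::finite \<Rightarrow> complex"
  assumes "\<psi>0 \<in> test_functions" "(\<integral>x. \<psi>0 x \<partial>lborel) \<noteq> 0"
  obtains \<rho> :: "real^'n \<Rightarrow> complex" where "\<rho> \<in> test_functions" "(\<integral>y. \<rho> y \<partial>lborel) = 1" "\<And>y. 1 < norm y \<Longrightarrow> \<rho> y = 0"
proof -
  obtain r where r: "\<And>y. r < norm y \<Longrightarrow> \<psi>0 y = 0" using assms by (auto simp: test_functions_iff)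
  obtain J where J: "r < 2 ^ J" using real_arch_pow[of 2 r] by auto
  define \<rho> where "\<rho> = (\<lambda>y. (1 / (\<integral>x. \<psi>0 x \<partial>lborel)) * dyadic \<psi>0 J y)"
  show thesis
  proof (rule that[of \<rho>])
    show "\<rho> \<in> test_functions" unfolding \<rho>_def by (intro test_cmult dyadic_test assms)
    show "(\<integral>y. \<rho> y \<partial>lborel) = 1"
      unfolding \<rho>_def using assms(2) dyadic_integral(2)[OF test_integrable[OF assms(1)], of J] by simp
    show "\<rho> y = 0" if "1 < norm y" for y
    proof -
      have "r / 2 ^ J < 1" using J by (simp add: divide_less_eq)
      then have "r / 2 ^ J < norm y" using that by linarith
      then have "dyadic \<psi>0 J y = 0" by (intro dyadic_outside[OF r])
      then show ?thesis by (simp add: \<rho>_def)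
    qed
  qed
qed

theorem theorem8p11:
  fixes \<phi>0 \<psi>0 :: "real^'n::finite \<Rightarrow> complex"
    and \<omega> :: "real^'n \<Rightarrow> real"
    and \<alpha> p q r A0 :: real
    and N N' :: nat
  assumes "\<phi>0 \<in> test_functions"
    and "\<forall>x\<in>cube 0 1. \<phi>0 x = 1"
    and "supp \<phi>0 \<subseteq> cube 0 2"
    and "\<psi>0 \<in> test_functions"
    and "(\<integral>x. \<psi>0 x \<partial>lborel) \<noteq> 0"
    and "peetre_constant (supp \<psi>0) A0"
    and "0 < \<alpha>" and "\<alpha> < 1"
    and "0 < p" and "p \<le> real CARD('n) / (real CARD('n) + \<alpha>)"
    and "1 / q = 1 / p - \<alpha> / real CARD('n)"
    and "real CARD('n) / (real CARD('n) - \<alpha>) < r"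
    and "weight \<omega>"
    and "(\<lambda>x. \<omega> x powr (real CARD('n) * r / (real CARD('n) * r - real CARD('n) - r * \<alpha>))) \<in> A_loc 1"
    and "(\<integral>\<^sup>+x. ennreal (\<omega> x powr p) \<partial>lebesgue) = \<infinity>"
    and "N_crit A0 p (\<lambda>x. \<omega> x powr p) \<le> int N"
    and "N_crit A0 q (\<lambda>x. \<omega> x powr q) \<le> int N'"
  shows "\<exists>C::real. 0 < C \<and>
    (\<forall>f \<in> hardy N p (\<lambda>x. \<omega> x powr p).
       loc_frac_int \<phi>0 \<alpha> f \<in> hardy N' q (\<lambda>x. \<omega> x powr q) \<and>
       hardy_norm N' q (\<lambda>x. \<omega> x powr q) (loc_frac_int \<phi>0 \<alpha> f)
         \<le> ennreal C * hardy_norm N p (\<lambda>x. \<omega> x powr p) f)"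
proof -
  note \<phi>0 = assms(1-3)
  note \<alpha> = assms(7,8)
  let ?n = "real CARD('n)"
  define \<sigma> where "\<sigma> = ?n * r / (?n * r - ?n - r * \<alpha>)"
  have n: "1 \<le> ?n" by (simp add: Suc_le_eq)
  have p: "0 < p" by (rule assms(9))
  have "?n + \<alpha> \<le> ?n / p" using assms(10) p n \<alpha> by (simp add: field_simps)
  then have "1 + \<alpha> / ?n \<le> 1 / p" using n by (simp add: field_simps)
  then have q1: "1 \<le> 1 / q" using assms(11) by simp
  then have q: "0 < q" "q \<le> 1" by (auto simp: divide_simps split: if_splits)
  define \<epsilon> where "\<epsilon> = \<alpha> * q"
  have \<epsilon>: "0 < \<epsilon>" using \<alpha> q by (simp add: \<epsilon>_def)
  have qp: "q / p = 1 + \<epsilon> / ?n"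
  proof -
    have "1 / p = 1 / q + \<alpha> / ?n" using assms(11) by simp
    then have "q * (1 / p) = q * (1 / q + \<alpha> / ?n)" by simp
    then show ?thesis using q by (simp add: \<epsilon>_def distrib_left mult.commute)
  qed
  have \<sigma>: "1 \<le> \<sigma>"
  proof -
    have na: "0 < ?n - \<alpha>" using n \<alpha> by linarith
    have "?n < r * (?n - \<alpha>)" using assms(12) na by (simp add: pos_divide_less_eq)
    then have den: "0 < ?n * r - ?n - r * \<alpha>" by (simp add: algebra_simps)
    have "0 < r" using assms(12) na n by (meson divide_pos_pos less_le_trans less_trans zero_less_one)
    then have "0 \<le> r * \<alpha>" using \<alpha> by simp
    then have "?n * r - ?n - r * \<alpha> \<le> ?n * r" using n by linarith
    then show ?thesis unfolding \<sigma>_def using den by (simp add: le_divide_eq)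
  qed
  have w: "locally_integrable \<omega>" "AE x in lebesgue. 0 < \<omega> x" using assms(13) by (auto simp: weight_def)
  have ws: "(\<lambda>x. \<omega> x powr \<sigma>) \<in> A_loc 1" using assms(14) by (simp add: \<sigma>_def)
  have wspos: "AE x in lebesgue. 0 < \<omega> x powr \<sigma>" using w(2) by eventually_elim simp
  \<comment> \<open>a nonnegative Borel measurable version of \<open>\<omega>\<close>\<close>
  obtain \<omega>1 where \<omega>1: "\<omega>1 \<in> borel_measurable lborel" "AE x in lborel. \<omega> x = \<omega>1 x"
    using completion_ex_borel_measurable_real[OF locally_integrable_measurable[OF w(1)]] by blast
  define \<omega>' where "\<omega>' x = max 0 (\<omega>1 x)" for x
  have [measurable]: "\<omega>' \<in> borel_measurable borel" using \<omega>1(1) unfolding \<omega>'_def[abs_def] by simp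
  have \<omega>': "0 \<le> \<omega>' x" for x by (simp add: \<omega>'_def)
  have eq: "AE x in lborel. 0 < \<omega> x \<and> \<omega> x = \<omega>' x"
    using w(2)[unfolded AE_completion_iff] \<omega>1(2) by eventually_elim (simp add: \<omega>'_def)
  have pos': "AE x in lborel. 0 < \<omega>' x" using eq by eventually_elim simp
  have "AE x in lborel. ennreal (\<omega> x powr \<sigma>) = ennreal (\<omega>' x powr \<sigma>)" using eq by eventually_elim simp
  then obtain B where B: "local_A1 (\<lambda>x. ennreal (\<omega>' x powr \<sigma>)) B"
    using A_loc_imp_local_A1[OF ws wspos, of "\<lambda>x. ennreal (\<omega>' x powr \<sigma>)"] by auto
  define v where "v x = ennreal (\<omega>' x powr q)" for x
  define A where "A = 1 + B"
  have lA: "local_A1 v A"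
    unfolding v_def[abs_def] A_def
    by (rule local_A1_lower_power[OF _ \<omega>' pos' q(1) _ B]) (use q \<sigma> in auto)
  interpret local_A1 v A by (rule lA)
  \<comment> \<open>the first entry of the maximum in \<open>N_crit\<close>\<close>
  have Nbig: "?n + \<alpha> * q < real (CARD('n) + N') * q"
  proof -
    have li: "locally_integrable (\<lambda>x. \<omega> x powr q)"
      by (rule locally_integrable_powr[OF w _ q(1), of \<sigma>]) (use ws q \<sigma> in \<open>auto simp: A_loc_def\<close>)
    have "(\<lambda>x. \<omega> x powr q) \<in> A_loc 1"
    proof (rule local_A1_imp_A_loc[OF li _ lA])
      show "AE x in lebesgue. 0 < \<omega> x powr q" using w(2) by eventually_elim simp
      show "AE x in lborel. ennreal (\<omega> x powr q) = v x" using eq by eventually_elim (simp add: v_def)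
    qed
    then have qc: "1 \<le> q_crit (\<lambda>x. \<omega> x powr q)" by (rule q_crit_ge_1)
    define x where "x = ?n * (q_crit (\<lambda>x. \<omega> x powr q) / q - 1)"
    have "?n * (1 / q - 1) \<le> x"
      unfolding x_def using qc q by (intro mult_left_mono diff_right_mono divide_right_mono) auto
    moreover have "\<lfloor>x\<rfloor> + 2 \<le> int N'" using assms(17) unfolding N_crit_def x_def by simp
    then have "x + 1 < real N'" by linarith
    ultimately have "?n / q - ?n + 1 < real N'" by (simp add: algebra_simps)
    then have "?n / q < ?n + real N' - \<alpha>" using \<alpha> by linarith
    then have "?n < (?n + real N' - \<alpha>) * q" using q by (simp add: pos_divide_less_eq)
    then show ?thesis by (simp add: algebra_simps)
  qed
  obtain \<rho> :: "real^'n \<Rightarrow> complex" where \<rho>: "\<rho> \<in> test_functions" "(\<integral>y. \<rho> y \<partial>lborel) = 1" "\<And>y. 1 < norm y \<Longrightarrow> \<rho> y = 0"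
    using normalized_bump_exists[OF assms(4,5)] by blast
  obtain C1 K where C1: "0 < C1" and K: "0 < K" and pw: "\<And>f x. f \<in> distributions \<Longrightarrow>
      epowr (grand_maximal N' (loc_frac_int \<phi>0 \<alpha> f) x) q
      \<le> ennreal C1 * scale_sum \<epsilon> (real (CARD('n) + N') * q) q K (grand_maximal N f) x"
    using pointwise_estimate[OF \<phi>0 \<alpha>(1) q \<rho>, of N' N] unfolding \<epsilon>_def by blast
  obtain C2 where C2: "0 < C2" and ts: "\<And>g. (\<integral>\<^sup>+x. scale_sum \<epsilon> (real (CARD('n) + N') * q) q K g x * v x \<partial>lborel)
    \<le> ennreal C2 * (\<Sum>j. ennreal (2 powr (- real j * \<epsilon>)) * (\<integral>\<^sup>+y. epowr (cell_min j g y) q * cell_avg j y \<partial>lborel))"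
    using scale_sum_integral[OF q(1) K Nbig] unfolding \<epsilon>_def by blast
  define C3 where "C3 = 1 / (1 - 2 powr (- ?n)) + 1 / (1 - 2 powr (- \<epsilon>))"
  have C3: "0 < C3"
    unfolding C3_def using \<epsilon> n powr_less_one[of 2 "- \<epsilon>"] powr_less_one[of 2 "- ?n"] by (intro add_pos_pos) auto
  have qp0: "0 < q / p" "0 < p / q" using p q by auto
  have emb: "(\<Sum>j. ennreal (2 powr (- real j * \<epsilon>)) * (\<integral>\<^sup>+y. epowr (cell_min j g y) q * cell_avg j y \<partial>lborel))
      \<le> ennreal (A * C3) * epowr (\<integral>\<^sup>+y. epowr (g y) p * ennreal (\<omega>' y powr p) \<partial>lborel) (q / p)"
    if fin: "(\<integral>\<^sup>+y. epowr (g y) p * ennreal (\<omega>' y powr p) \<partial>lborel) < top" for g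
  proof -
    \<comment> \<open>its power \<open>q / p\<close> is the integrand, and the constant makes it at most \<open>g\<^sup>p \<omega>\<^sup>p\<close>\<close>
    define c where "c j y = ennreal (A powr (- (p / q))) * (epowr (cell_min j g y) p * epowr (cell_avg j y) (p / q))" for j y
    have cm [measurable]: "c j \<in> borel_measurable borel" for j
    proof -
      have [measurable]: "(\<lambda>y. epowr (cell_min j g y) p) \<in> borel_measurable borel" "(\<lambda>y. epowr (cell_avg j y) (p / q)) \<in> borel_measurable borel"
        using measurable_comp[OF cell_min_measurable measurable_epowr[OF p]]
          measurable_comp[OF cell_avg_measurable measurable_epowr[OF qp0(2)]] by (simp_all add: comp_def)
      show ?thesis unfolding c_def[abs_def] by measurable
    qed
    have cc: "c j y = c j y'" if "cell_of j y = cell_of j y'" for j y y'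
      using that by (simp add: c_def cell_min_def cell_avg_def)
    have cl: "AE y in lborel. \<forall>j. c j y \<le> epowr (g y) p * ennreal (\<omega>' y powr p)"
      using cell_avg_le
    proof eventually_elim
      case (elim y)
      show ?case
      proof
        fix j
        have "epowr (cell_avg j y) (p / q) \<le> epowr (ennreal A * v y) (p / q)"
          using elim qp0 by (intro epowr_mono) auto
        also have "\<dots> = ennreal (A powr (p / q)) * ennreal (\<omega>' y powr p)"
          using A qp0 q by (simp add: epowr_mult epowr_ennreal v_def powr_powr)
        finally have "c j y \<le> ennreal (A powr (- (p / q))) * (epowr (g y) p * (ennreal (A powr (p / q)) * ennreal (\<omega>' y powr p)))"
          unfolding c_def using p by (intro mult_left_mono mult_mono epowr_mono cell_min_le) auto
        also have "\<dots> = (ennreal (A powr (- (p / q))) * ennreal (A powr (p / q))) * (epowr (g y) p * ennreal (\<omega>' y powr p))"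
          by (simp add: mult_ac)
        also have "ennreal (A powr (- (p / q))) * ennreal (A powr (p / q)) = 1"
          using A by (simp add: ennreal_mult'[symmetric] powr_add[symmetric])
        finally show "c j y \<le> epowr (g y) p * ennreal (\<omega>' y powr p)" by simp
      qed
    qed
    have ck: "epowr (cell_min j g y) q * cell_avg j y = ennreal A * epowr (c j y) (q / p)" for j y
    proof -
      have "epowr (c j y) (q / p) = ennreal (A powr (- 1)) * (epowr (cell_min j g y) q * cell_avg j y)"
        unfolding c_def using A p q qp0 by (simp add: epowr_mult epowr_ennreal epowr_epowr powr_powr)
      then show ?thesis using A by (simp add: mult.assoc[symmetric] ennreal_mult'[symmetric] powr_minus_divide)
    qed
    have "(\<Sum>j. ennreal (2 powr (- real j * \<epsilon>)) * (\<integral>\<^sup>+y. epowr (cell_min j g y) q * cell_avg j y \<partial>lborel))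
        = ennreal A * (\<Sum>j. ennreal (2 powr (- real j * \<epsilon>)) * (\<integral>\<^sup>+y. epowr (c j y) (1 + \<epsilon> / ?n) \<partial>lborel))"
    proof -
      have [measurable]: "(\<lambda>y. epowr (c j y) (q / p)) \<in> borel_measurable borel" for j
        using measurable_comp[OF cm measurable_epowr[OF qp0(1)]] by (simp add: comp_def)
      show ?thesis unfolding ck qp[symmetric]
        by (simp add: nn_integral_cmult mult.left_commute)
    qed
    also have "\<dots> \<le> ennreal A * (ennreal C3 * epowr (\<integral>\<^sup>+y. epowr (g y) p * ennreal (\<omega>' y powr p) \<partial>lborel) (1 + \<epsilon> / ?n))"
      unfolding C3_def by (intro mult_left_mono cellwise_embedding[OF \<epsilon> cm cc cl fin]) auto
    finally show ?thesis using A by (simp add: qp ennreal_mult' mult.assoc)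
  qed
  define D where "D = C1 * C2 * (A * C3)"
  have D: "0 < D" using C1 C2 A C3 by (simp add: D_def)
  show ?thesis
  proof (intro exI[of _ "D powr (1 / q)"] conjI ballI)
    show "0 < D powr (1 / q)" using D by simp
    fix f assume f: "f \<in> hardy N p (\<lambda>x. \<omega> x powr p)"
    let ?g = "grand_maximal N f"
    let ?G = "grand_maximal N' (loc_frac_int \<phi>0 \<alpha> f)"
    have fd: "f \<in> distributions" and fn: "hardy_norm N p (\<lambda>x. \<omega> x powr p) f < top"
      using f by (auto simp: hardy_def)
    define H where "H = (\<integral>\<^sup>+y. epowr (?g y) p * ennreal (\<omega>' y powr p) \<partial>lborel)"
    have "(\<integral>\<^sup>+x. epowr (?g x) p * ennreal (\<omega> x powr p) \<partial>lebesgue) = H"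
      unfolding H_def nn_integral_completion using eq by (intro nn_integral_cong_AE) auto
    then have hn: "hardy_norm N p (\<lambda>x. \<omega> x powr p) f = epowr H (1 / p)"
      by (simp add: hardy_norm_def Lp_norm_def)
    have Hfin: "H < top"
    proof (rule ccontr)
      assume "\<not> H < top"
      then have "H = top" using less_top[of H] by blast
      with fn hn p show False by simp
    qed
    have "(\<integral>\<^sup>+x. epowr (?G x) q * ennreal (\<omega> x powr q) \<partial>lebesgue) = (\<integral>\<^sup>+x. epowr (?G x) q * v x \<partial>lborel)"
      unfolding nn_integral_completion using eq by (intro nn_integral_cong_AE) (auto simp: v_def)
    also have "\<dots> \<le> (\<integral>\<^sup>+x. ennreal C1 * (scale_sum \<epsilon> (real (CARD('n) + N') * q) q K ?g x * v x) \<partial>lborel)"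
      unfolding mult.assoc[symmetric] by (intro nn_integral_mono mult_right_mono pw fd) simp
    also have "\<dots> = ennreal C1 * (\<integral>\<^sup>+x. scale_sum \<epsilon> (real (CARD('n) + N') * q) q K ?g x * v x \<partial>lborel)"
    proof (rule nn_integral_cmult)
      have [measurable]: "(\<lambda>y. epowr (cell_min j ?g y) q) \<in> borel_measurable borel" for j
        using measurable_comp[OF cell_min_measurable measurable_epowr[OF q(1)]] by (simp add: comp_def)
      have [measurable]: "(\<lambda>x. scale_sum \<epsilon> (real (CARD('n) + N') * q) q K ?g x) \<in> borel_measurable borel"
        unfolding scale_sum_def cell_sum_def by measurable
      show "(\<lambda>x. scale_sum \<epsilon> (real (CARD('n) + N') * q) q K ?g x * v x) \<in> borel_measurable lborel" by measurable
    qed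
    also have "\<dots> \<le> ennreal C1 * (ennreal C2 * (ennreal (A * C3) * epowr H (q / p)))"
      using order_trans[OF ts mult_left_mono[OF emb]] Hfin unfolding H_def by (intro mult_left_mono) auto
    also have "\<dots> = ennreal D * epowr H (q / p)"
      using C1 C2 A C3 by (simp add: D_def ennreal_mult' mult.assoc)
    finally have "hardy_norm N' q (\<lambda>x. \<omega> x powr q) (loc_frac_int \<phi>0 \<alpha> f) \<le> epowr (ennreal D * epowr H (q / p)) (1 / q)"
      unfolding hardy_norm_def Lp_norm_def using q by (intro epowr_mono) auto
    also have "\<dots> = ennreal (D powr (1 / q)) * epowr H (1 / p)"
      using q p D qp0 by (simp add: epowr_mult epowr_ennreal epowr_epowr)
    finally have fin: "hardy_norm N' q (\<lambda>x. \<omega> x powr q) (loc_frac_int \<phi>0 \<alpha> f)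
        \<le> ennreal (D powr (1 / q)) * hardy_norm N p (\<lambda>x. \<omega> x powr p) f" unfolding hn .
    then show "hardy_norm N' q (\<lambda>x. \<omega> x powr q) (loc_frac_int \<phi>0 \<alpha> f)
        \<le> ennreal (D powr (1 / q)) * hardy_norm N p (\<lambda>x. \<omega> x powr p) f" .
    have "ennreal (D powr (1 / q)) * hardy_norm N p (\<lambda>x. \<omega> x powr p) f < top"
      using fn by (simp add: ennreal_mult_less_top)
    with fin have "hardy_norm N' q (\<lambda>x. \<omega> x powr q) (loc_frac_int \<phi>0 \<alpha> f) < top"
      by (rule le_less_trans)
    then show "loc_frac_int \<phi>0 \<alpha> f \<in> hardy N' q (\<lambda>x. \<omega> x powr q)"
      using loc_frac_int_distribution[OF \<phi>0 \<alpha>(1) fd] by (simp add: hardy_def)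
  qed
qed

end
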